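(* (i) Let $\vec p,\vec s$ be $n$-tuples with entries in $[1,\infty]$ and $\frac1n\sum_{i=1}^n\frac1{s_i}\le\frac1\alpha\le\frac1n\sum_{i=1}^n\frac1{p_i}$. If $g\in(L^{\vec p},\ell^{\vec s})^{\alpha}(\mathbb R^n)$ and $f\in\mathcal H(\vec p\,',\vec s\,',\alpha')$, then $fg\in L^1(\mathbb R^n)$ and $$\Big|\int_{\mathbb R^n}f(x)g(x)\,dx\Big|\le\|g\|_{(L^{\vec p},\ell^{\vec s})^{\alpha}}\|f\|_{\mathcal H(\vec p\,',\vec s\,',\alpha')}.$$ (ii) Let $\vec p,\vec s$ be $n$-tuples with entries in $(1,\infty]$ and $\frac1n\sum_{i=1}^n\frac1{s_i}\le\frac1\alpha\le\frac1n\sum_{i=1}^n\frac1{p_i}$. The operator $T:g\mapsto T_g$ defined by $\langle T_g,f\rangle=\int_{\mathbb R^n}f(x)g(x)\,dx$ for $g\in(L^{\vec p},\ell^{\vec s})^{\alpha}(\mathbb R^n)$ and $f\in\mathcal H(\vec p\,',\vec s\,',\alpha')$ is an isometric isomorphism of $(L^{\vec p},\ell^{\vec s})^{\alpha}(\mathbb R^n)$ into $\mathcal H(\vec p\,',\vec s\,',\alpha')^{*}$.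
   Context: For $\vec p=(p_1,\dots,p_n)$ with $1\le p_i\le\infty$, $\|f\|_{L^{\vec p}}=\Big(\int_{\mathbb R}\cdots\Big(\int_{\mathbb R}|f(x)|^{p_1}\,dx_1\Big)^{p_2/p_1}\cdots dx_n\Big)^{1/p_n}$ (usual modification when some $p_i=\infty$); primes denote conjugate exponents componentwise ($1/p_i+1/p_i'=1$, $1/\alpha+1/\alpha'=1$). For $r>0$, $k\in\mathbb Z^n$, $Q_{r,k}=r(k+[0,1)^n)$; for a sequence $\{a_k\}_{k\in\mathbb Z^n}$, $\|\{a_k\}\|_{\ell^{\vec s}}=\Big(\sum_{k_n}\cdots\Big(\sum_{k_1}|a_k|^{s_1}\Big)^{s_2/s_1}\cdots\Big)^{1/s_n}$ (usual modification for $s_i=\infty$). Set ${}_r\|f\|_{\vec p,\vec s}=\big\|\{\|f\chi_{Q_{r,k}}\|_{L^{\vec p}}\}_k\big\|_{\ell^{\vec s}}$, $\|f\|_{\vec p,\vec s}={}_1\|f\|_{\vec p,\vec s}$, and $\|f\|_{(L^{\vec p},\ell^{\vec s})^{\alpha}}=\sup_{r>0}r^{\frac n\alpha-\sum_{i=1}^n\frac1{p_i}}\,{}_r\|f\|_{\vec p,\vec s}$; $(L^{\vec p},\ell^{\vec s})^{\alpha}(\mathbb R^n)$ is the set of $f\in L^1_{loc}$ with this quantity finite, and $(L^{\vec p\,'},\ell^{\vec s\,'})(\mathbb R^n)$ the set of $f\in L^1_{loc}$ with $\|f\|_{\vec p\,',\vec s\,'}<\infty$. For $r>0$, $St^{(\alpha')}_r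 f(x)=r^{-n/\alpha'}f(x/r)$. The space $\mathcal H(\vec p\,',\vec s\,',\alpha')$ is the set of $f\in L^1_{loc}(\mathbb R^n)$ for which there is a sequence $\{(c_j,r_j,f_j)\}_{j\ge1}\subset\mathbb C\times(0,\infty)\times(L^{\vec p\,'},\ell^{\vec s\,'})(\mathbb R^n)$ (a block decomposition) with $f=\sum_{j\ge1}c_jSt^{(\alpha')}_{r_j}(f_j)$ in $L^1_{loc}(\mathbb R^n)$, $\|f_j\|_{\vec p\,',\vec s\,'}\le1$ for all $j$, and $\sum_j|c_j|<\infty$; its norm is $\|f\|_{\mathcal H(\vec p\,',\vec s\,',\alpha')}=\inf\sum_{j\ge1}|c_j|$ over all block decompositions of $f$. $\mathcal H(\vec p\,',\vec s\,',\alpha')^{*}$ is its dual space. *)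

theory Defs
  imports "HOL-Analysis.Analysis"
begin

definition recip :: "ereal \<Rightarrow> real" where
  "recip x = (if x = \<infinity> then 0 else 1 / real_of_ereal x)"

definition conj_exp :: "ereal \<Rightarrow> ereal" where
  "conj_exp x = (if x = 1 then \<infinity> else if x = \<infinity> then 1 else x / (x - 1))"

definition enn_pow :: "ennreal \<Rightarrow> real \<Rightarrow> ennreal" where
  "enn_pow x a = (if x = \<infinity> then \<infinity> else ennreal (enn2real x powr a))"

definition ess_sup_enn :: "'a measure \<Rightarrow> ('a \<Rightarrow> ennreal) \<Rightarrow> ennreal" where
  "ess_sup_enn M F = Inf {c. AE t in M. F t \<le> c}"

text \<open>Points of the n-fold product are functions nat => 'a, extensional outside {..<n}.
  One step takes the L^p(M)-norm in coordinate k (index k corresponds to x_(k+1)).\<close>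
definition lp_step :: "'a measure \<Rightarrow> ereal \<Rightarrow> nat \<Rightarrow> ((nat \<Rightarrow> 'a) \<Rightarrow> ennreal)
    \<Rightarrow> (nat \<Rightarrow> 'a) \<Rightarrow> ennreal" where
  "lp_step M p k F x =
     (if p = \<infinity> then ess_sup_enn M (\<lambda>t. F (x(k := t)))
      else enn_pow (\<integral>\<^sup>+ t. enn_pow (F (x(k := t))) (real_of_ereal p) \<partial>M) (1 / real_of_ereal p))"

fun mixed_norm_aux :: "'a measure \<Rightarrow> (nat \<Rightarrow> ereal) \<Rightarrow> nat \<Rightarrow> ((nat \<Rightarrow> 'a) \<Rightarrow> ennreal)
    \<Rightarrow> (nat \<Rightarrow> 'a) \<Rightarrow> ennreal" where
  "mixed_norm_aux M p 0 F = F"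
| "mixed_norm_aux M p (Suc k) F = lp_step M (p k) k (mixed_norm_aux M p k F)"

definition mixed_norm :: "'a measure \<Rightarrow> nat \<Rightarrow> (nat \<Rightarrow> ereal) \<Rightarrow> ((nat \<Rightarrow> 'a) \<Rightarrow> ennreal) \<Rightarrow> ennreal" where
  "mixed_norm M n p F = mixed_norm_aux M p n F (\<lambda>_. undefined)"

definition Rn :: "nat \<Rightarrow> (nat \<Rightarrow> real) measure" where
  "Rn n = PiM {..<n} (\<lambda>_. lborel)"

definition Lmixed_norm :: "nat \<Rightarrow> (nat \<Rightarrow> ereal) \<Rightarrow> ((nat \<Rightarrow> real) \<Rightarrow> complex) \<Rightarrow> ennreal" where
  "Lmixed_norm n p f = mixed_norm lborel n p (\<lambda>x. ennreal (norm (f x)))"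

definition lmixed_norm :: "nat \<Rightarrow> (nat \<Rightarrow> ereal) \<Rightarrow> ((nat \<Rightarrow> int) \<Rightarrow> ennreal) \<Rightarrow> ennreal" where
  "lmixed_norm n s a = mixed_norm (count_space UNIV) n s a"

definition cube :: "nat \<Rightarrow> real \<Rightarrow> (nat \<Rightarrow> int) \<Rightarrow> (nat \<Rightarrow> real) set" where
  "cube n r k = {x. \<forall>i<n. r * of_int (k i) \<le> x i \<and> x i < r * (of_int (k i) + 1)}"

definition amalg_r :: "nat \<Rightarrow> (nat \<Rightarrow> ereal) \<Rightarrow> (nat \<Rightarrow> ereal) \<Rightarrow> real
    \<Rightarrow> ((nat \<Rightarrow> real) \<Rightarrow> complex) \<Rightarrow> ennreal" where
  "amalg_r n p s r f =
     lmixed_norm n s (\<lambda>k. Lmixed_norm n p (\<lambda>x. f x * of_real (indicator (cube n r k) x)))"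

definition amalg_alpha_norm :: "nat \<Rightarrow> (nat \<Rightarrow> ereal) \<Rightarrow> (nat \<Rightarrow> ereal) \<Rightarrow> ereal
    \<Rightarrow> ((nat \<Rightarrow> real) \<Rightarrow> complex) \<Rightarrow> ennreal" where
  "amalg_alpha_norm n p s \<alpha> f =
     (SUP r\<in>{0<..}. ennreal (r powr (real n * recip \<alpha> - (\<Sum>i<n. recip (p i)))) * amalg_r n p s r f)"

definition loc_int :: "nat \<Rightarrow> ((nat \<Rightarrow> real) \<Rightarrow> complex) \<Rightarrow> bool" where
  "loc_int n f = (\<forall>R::real. set_integrable (Rn n) {x\<in>space (Rn n). \<forall>i<n. \<bar>x i\<bar> \<le> R} f)"

definition amalg_alpha_space :: "nat \<Rightarrow> (nat \<Rightarrow> ereal) \<Rightarrow> (nat \<Rightarrow> ereal) \<Rightarrow> ereal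
    \<Rightarrow> ((nat \<Rightarrow> real) \<Rightarrow> complex) set" where
  "amalg_alpha_space n p s \<alpha> = {f. loc_int n f \<and> amalg_alpha_norm n p s \<alpha> f < \<infinity>}"

definition amalg_space :: "nat \<Rightarrow> (nat \<Rightarrow> ereal) \<Rightarrow> (nat \<Rightarrow> ereal)
    \<Rightarrow> ((nat \<Rightarrow> real) \<Rightarrow> complex) set" where
  "amalg_space n p s = {f. loc_int n f \<and> amalg_r n p s 1 f < \<infinity>}"

section \<open>Block spaces H(q,t,beta) (to be used with q = p', t = s', beta = alpha')\<close>

definition dilate :: "nat \<Rightarrow> ereal \<Rightarrow> real \<Rightarrow> ((nat \<Rightarrow> real) \<Rightarrow> complex) \<Rightarrow> (nat \<Rightarrow> real) \<Rightarrow> complex" where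
  "dilate n \<beta> r f x = of_real (r powr (- real n * recip \<beta>)) * f (\<lambda>i\<in>{..<n}. x i / r)"

definition conv_L1loc :: "nat \<Rightarrow> (nat \<Rightarrow> (nat \<Rightarrow> real) \<Rightarrow> complex) \<Rightarrow> ((nat \<Rightarrow> real) \<Rightarrow> complex) \<Rightarrow> bool" where
  "conv_L1loc n S f = (\<forall>R::real.
     (\<lambda>N. \<integral>\<^sup>+ x. ennreal (norm (f x - S N x))
            * indicator {x. \<forall>i<n. \<bar>x i\<bar> \<le> R} x \<partial>Rn n) \<longlonglongrightarrow> 0)"

definition block_decomp :: "nat \<Rightarrow> (nat \<Rightarrow> ereal) \<Rightarrow> (nat \<Rightarrow> ereal) \<Rightarrow> ereal
    \<Rightarrow> ((nat \<Rightarrow> real) \<Rightarrow> complex) \<Rightarrow> (nat \<Rightarrow> complex) \<Rightarrow> (nat \<Rightarrow> real)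
    \<Rightarrow> (nat \<Rightarrow> (nat \<Rightarrow> real) \<Rightarrow> complex) \<Rightarrow> bool" where
  "block_decomp n q t \<beta> f c r fs =
     ((\<forall>j. 0 < r j) \<and> (\<forall>j. fs j \<in> amalg_space n q t \<and> amalg_r n q t 1 (fs j) \<le> 1)
      \<and> summable (\<lambda>j. norm (c j))
      \<and> conv_L1loc n (\<lambda>N x. \<Sum>j<N. c j * dilate n \<beta> (r j) (fs j) x) f)"

definition block_space :: "nat \<Rightarrow> (nat \<Rightarrow> ereal) \<Rightarrow> (nat \<Rightarrow> ereal) \<Rightarrow> ereal
    \<Rightarrow> ((nat \<Rightarrow> real) \<Rightarrow> complex) set" where
  "block_space n q t \<beta> = {f. loc_int n f \<and> (\<exists>c r fs. block_decomp n q t \<beta> f c r fs)}"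

definition block_norm :: "nat \<Rightarrow> (nat \<Rightarrow> ereal) \<Rightarrow> (nat \<Rightarrow> ereal) \<Rightarrow> ereal
    \<Rightarrow> ((nat \<Rightarrow> real) \<Rightarrow> complex) \<Rightarrow> real" where
  "block_norm n q t \<beta> f =
     Inf {(\<Sum>j. norm (c j)) | c r fs. block_decomp n q t \<beta> f c r fs}"

definition block_dual :: "nat \<Rightarrow> (nat \<Rightarrow> ereal) \<Rightarrow> (nat \<Rightarrow> ereal) \<Rightarrow> ereal
    \<Rightarrow> (((nat \<Rightarrow> real) \<Rightarrow> complex) \<Rightarrow> complex) set" where
  "block_dual n q t \<beta> = {L.
     (\<forall>f\<in>block_space n q t \<beta>. \<forall>g\<in>block_space n q t \<beta>. L (\<lambda>x. f x + g x) = L f + L g)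
   \<and> (\<forall>a. \<forall>f\<in>block_space n q t \<beta>. L (\<lambda>x. a * f x) = a * L f)
   \<and> (\<exists>C. \<forall>f\<in>block_space n q t \<beta>. norm (L f) \<le> C * block_norm n q t \<beta> f)}"

definition dual_norm :: "nat \<Rightarrow> (nat \<Rightarrow> ereal) \<Rightarrow> (nat \<Rightarrow> ereal) \<Rightarrow> ereal
    \<Rightarrow> (((nat \<Rightarrow> real) \<Rightarrow> complex) \<Rightarrow> complex) \<Rightarrow> real" where
  "dual_norm n q t \<beta> L =
     Sup {norm (L f) | f. f \<in> block_space n q t \<beta> \<and> block_norm n q t \<beta> f \<le> 1}"

definition pairing :: "nat \<Rightarrow> ((nat \<Rightarrow> real) \<Rightarrow> complex) \<Rightarrow> ((nat \<Rightarrow> real) \<Rightarrow> complex) \<Rightarrow> complex" where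
  "pairing n g f = (\<integral>x. f x * g x \<partial>Rn n)"

end

theory Submission
  imports Defs
begin

text \<open>
  Part (i) is Hoelder's inequality for the mixed norms, applied first on every unit cube and then to the
  sequence over the cubes; the dilation by \<open>r\<close> of a block is moved to \<open>g\<close>, where it produces exactly
  the weight in the supremum over \<open>r\<close>, and \<open>|f|\<close> is almost everywhere at most the sum of the
  \<open>|c\<^sub>j| |St f\<^sub>j|\<close>.

  For part (ii) near-extremal functions for Hoelder's inequality are built one coordinate at a time.
  Hence the norm of \<open>g\<close> is the supremum of its pairings with dilates of bounded, boundedly supported
  functions of norm at most 1; isometry, injectivity and the triangle inequality follow.
  For surjectivity, a functional \<open>L\<close> gives on each unit cube the complex measure
  \<open>A \<mapsto> L 1\<^bsub>A \<inter> Q\<^esub>\<close>, countably additive by dominated convergence because all conjugate exponents are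
  finite. Its densities are glued to a locally integrable \<open>g\<close>, which lies in the space by
  the duality formula, and bounded, boundedly supported functions determine \<open>L\<close>.
\<close>

section \<open>Powers and one-variable norms\<close>

text \<open>The exponents vary from coordinate to coordinate and may be infinite, so the duality of
  a single Lebesgue space does not apply directly. The coordinatewise construction works because
  \<open>mixed_norm_aux\<close> keeps the coordinates that are not yet integrated as parameters: a
  factor depending on these alone is constant for the norms already taken and leaves them. The
  near-extremal function is therefore a product whose k-th factor sees the coordinates from k on.
  Each coordinate costs a factor \<theta> < 1, once for the points and once for the cube indices,
  whence \<theta> ^ (2 * n), and \<theta> tends to 1 at the end. The test functions must have finite
  norm for all exponents and be integrable against every locally integrable g; this dictates the
  class \<open>tame\<close>. Since no triangle inequality is available beforehand, membership of
  sums is always obtained from domination or from duality. That tame functions determine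
  \<open>L\<close> is used in the form: the difference of \<open>L\<close> and a pairing is again a
  bounded functional, and it vanishes on tame functions.\<close>

lemma enn_pow_mono: "0 \<le> a \<Longrightarrow> x \<le> y \<Longrightarrow> enn_pow x a \<le> enn_pow y a"
  by (cases x; cases y) (auto simp: enn_pow_def top_unique intro!: ennreal_leI powr_mono2)

lemma enn_pow_ennreal: "0 \<le> x \<Longrightarrow> enn_pow (ennreal x) a = ennreal (x powr a)"
  by (simp add: enn_pow_def)

lemma enn_pow_top [simp]: "enn_pow top a = top"
  by (simp add: enn_pow_def)

lemma enn_pow_zero [simp]: "enn_pow 0 a = 0"
  by (simp add: enn_pow_def)

lemma enn_pow_one [simp]: "enn_pow x 1 = x"
  by (cases x) (auto simp: enn_pow_def)

lemma enn_pow_eq_0_iff [simp]: "enn_pow x a = 0 \<longleftrightarrow> x = 0"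
  by (cases x) (auto simp: enn_pow_def ennreal_eq_0_iff)

lemma enn_pow_eq_top_iff [simp]: "enn_pow x a = top \<longleftrightarrow> x = top"
  by (cases x) (auto simp: enn_pow_def)

lemma enn_pow_enn_pow: "enn_pow (enn_pow x a) b = enn_pow x (a * b)"
  by (cases x) (auto simp: enn_pow_ennreal powr_powr)

lemma enn_pow_mult: "enn_pow (x * y) a = enn_pow x a * enn_pow y a"
  by (cases x; cases y)
    (auto simp: enn_pow_ennreal powr_mult ennreal_top_mult ennreal_mult_top ennreal_mult[symmetric])

text \<open>For a > 0 the power is an order isomorphism whose inverse has the exponent 1 / a; this
  adjunction carries powers through suprema and through limits at 0.\<close>

lemma enn_pow_le_iff: "0 < a \<Longrightarrow> enn_pow x a \<le> y \<longleftrightarrow> x \<le> enn_pow y (1 / a)"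
  using enn_pow_mono[of "1/a" "enn_pow x a" y] enn_pow_mono[of a x "enn_pow y (1 / a)"]
  by (auto simp: enn_pow_enn_pow)

lemma enn_pow_SUP: "0 < a \<Longrightarrow> enn_pow (SUP i\<in>I. f i) a = (SUP i\<in>I. enn_pow (f i) a)"
proof (rule antisym)
  assume a: "0 < a"
  have "f i \<le> enn_pow (SUP i\<in>I. enn_pow (f i) a) (1 / a)" if "i \<in> I" for i
    using that a by (subst enn_pow_le_iff[symmetric]) (auto intro: SUP_upper)
  with a show "enn_pow (SUP i\<in>I. f i) a \<le> (SUP i\<in>I. enn_pow (f i) a)"
    by (auto simp: enn_pow_le_iff intro!: SUP_least)
  from a show "(SUP i\<in>I. enn_pow (f i) a) \<le> enn_pow (SUP i\<in>I. f i) a"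
    by (intro SUP_least enn_pow_mono SUP_upper) auto
qed

lemma measurable_enn_pow [measurable]:
  assumes [measurable]: "f \<in> borel_measurable M"
  shows "(\<lambda>x. enn_pow (f x) a) \<in> borel_measurable M"
  unfolding enn_pow_def by measurable

lemma tendsto_enn_pow_zero:
  assumes a: "0 < a" and f: "(f \<longlongrightarrow> 0) F"
  shows "((\<lambda>m. enn_pow (f m) a) \<longlongrightarrow> 0) F"
proof (rule order_tendstoI)
  fix e :: ennreal assume "0 < e"
  then have "eventually (\<lambda>m. f m < enn_pow e (1 / a)) F"
    using order_tendstoD(2)[OF f, of "enn_pow e (1 / a)"] by (simp add: zero_less_iff_neq_zero)
  then show "eventually (\<lambda>m. enn_pow (f m) a < e) F"
  proof eventually_elim
    case (elim m)
    then show ?case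
      using enn_pow_le_iff[of "1/a" e "f m"] a by (auto simp: not_le[symmetric])
  qed
qed simp

section \<open>Essential suprema and norms in one variable\<close>

lemma ess_sup_enn_AE: "AE t in M. F t \<le> ess_sup_enn M F"
proof -
  have ne: "{c. AE t in M. F t \<le> c} \<noteq> {}"
    by (auto intro!: exI[of _ top])
  \<comment> \<open>The infimum is reached along a sequence, so only countably many exceptional null
    sets have to be united.\<close>
  obtain u :: "nat \<Rightarrow> ennreal" where u: "range u \<subseteq> {c. AE t in M. F t \<le> c}" "Inf {c. AE t in M. F t \<le> c} = (INF i. u i)"
    using ennreal_Inf_countable_INF[OF ne] by blast
  then have "AE t in M. \<forall>i. F t \<le> u i"
    by (subst AE_all_countable) auto
  then show ?thesis
    unfolding ess_sup_enn_def u(2) by (auto elim!: eventually_mono intro: INF_greatest)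
qed

lemma ess_sup_enn_le_iff: "ess_sup_enn M F \<le> c \<longleftrightarrow> (AE t in M. F t \<le> c)"
proof
  assume "ess_sup_enn M F \<le> c"
  with ess_sup_enn_AE[of F M] show "AE t in M. F t \<le> c"
    by (auto elim!: eventually_mono)
qed (auto simp: ess_sup_enn_def intro: Inf_lower)

text \<open>The body of \<open>lp_step\<close> without the point and the coordinate: facts about one
  variable are stated for it over any measure and lifted coordinate by coordinate through
  \<open>lp_step_eq\<close>.\<close>

definition lp_norm :: "'a measure \<Rightarrow> ereal \<Rightarrow> ('a \<Rightarrow> ennreal) \<Rightarrow> ennreal" where
  "lp_norm M p f = (if p = \<infinity> then ess_sup_enn M f
     else enn_pow (\<integral>\<^sup>+ t. enn_pow (f t) (real_of_ereal p) \<partial>M) (1 / real_of_ereal p))"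

lemma lp_step_eq: "lp_step M p k F x = lp_norm M p (\<lambda>t. F (x(k := t)))"
  by (simp add: lp_step_def lp_norm_def)

lemma exponent_cases [consumes 1, case_names infinite real]:
  assumes "1 \<le> p"
  obtains "p = \<infinity>" | r where "p = ereal r" "1 \<le> r"
  using assms by (cases p) auto

lemma lp_norm_infinite: "lp_norm M \<infinity> f = ess_sup_enn M f"
  by (simp add: lp_norm_def)

lemma lp_norm_real: "lp_norm M (ereal r) f = enn_pow (\<integral>\<^sup>+ t. enn_pow (f t) r \<partial>M) (1 / r)"
  by (simp add: lp_norm_def)

lemma lp_norm_one: "lp_norm M 1 f = (\<integral>\<^sup>+ t. f t \<partial>M)"
  by (simp add: one_ereal_def lp_norm_real)

lemma lp_norm_mono_AE:
  assumes "1 \<le> p" "AE t in M. f t \<le> g t"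
  shows "lp_norm M p f \<le> lp_norm M p g"
  using assms(1)
proof (cases rule: exponent_cases)
  case infinite
  have "AE t in M. f t \<le> ess_sup_enn M g"
    using assms(2) ess_sup_enn_AE[of g M] by eventually_elim auto
  with infinite show ?thesis
    by (simp add: lp_norm_infinite ess_sup_enn_le_iff)
next
  case (real r)
  with assms(2) show ?thesis
    by (auto simp: lp_norm_real intro!: enn_pow_mono nn_integral_mono_AE elim!: eventually_mono)
qed

lemma lp_norm_mono: "1 \<le> p \<Longrightarrow> (\<And>t. t \<in> space M \<Longrightarrow> f t \<le> g t) \<Longrightarrow> lp_norm M p f \<le> lp_norm M p g"
  by (rule lp_norm_mono_AE) auto

lemma lp_norm_cong: "1 \<le> p \<Longrightarrow> (\<And>t. t \<in> space M \<Longrightarrow> f t = g t) \<Longrightarrow> lp_norm M p f = lp_norm M p g"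
  by (intro antisym lp_norm_mono) auto

lemma lp_norm_eq_0_iff:
  assumes "1 \<le> p" and [measurable]: "f \<in> borel_measurable M"
  shows "lp_norm M p f = 0 \<longleftrightarrow> (AE t in M. f t = 0)"
  using assms(1)
proof (cases rule: exponent_cases)
  case infinite
  then show ?thesis
    using ess_sup_enn_le_iff[of M f 0] by (simp add: lp_norm_infinite)
next
  case (real r)
  then show ?thesis by (simp add: lp_norm_real nn_integral_0_iff_AE)
qed

lemma lp_norm_cmult_le:
  assumes "1 \<le> p" "c \<noteq> top" and [measurable]: "f \<in> borel_measurable M"
  shows "lp_norm M p (\<lambda>t. c * f t) \<le> c * lp_norm M p f"
  using assms(1)
proof (cases rule: exponent_cases)
  case infinite
  then show ?thesis
    using ess_sup_enn_AE[of f M]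
    by (auto simp: lp_norm_infinite ess_sup_enn_le_iff elim!: eventually_mono intro: mult_left_mono)
next
  case (real r)
  then show ?thesis
    by (simp add: lp_norm_real enn_pow_mult nn_integral_cmult enn_pow_enn_pow)
qed

text \<open>The converse of \<open>lp_norm_cmult_le\<close> is that same inequality for the factor
  \<open>inverse c\<close>.\<close>

lemma lp_norm_cmult:
  assumes "1 \<le> p" "c \<noteq> top" and f[measurable]: "f \<in> borel_measurable M"
  shows "lp_norm M p (\<lambda>t. c * f t) = c * lp_norm M p f"
proof (cases "c = 0")
  case True
  then show ?thesis using lp_norm_eq_0_iff[OF assms(1), of "\<lambda>_. 0" M] by simp
next
  case False
  have inv: "inverse c \<noteq> top" "inverse c * c = 1" "c * inverse c = 1"
    using False assms(2) by (auto simp: ennreal_inverse_eq_top_iff mult.commute less_top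
      intro: ennreal_divide_self[unfolded divide_ennreal_def])
  have "lp_norm M p f = lp_norm M p (\<lambda>t. inverse c * (c * f t))"
    by (simp add: mult.assoc[symmetric] inv)
  also have "\<dots> \<le> inverse c * lp_norm M p (\<lambda>t. c * f t)"
    using inv by (intro lp_norm_cmult_le assms) auto
  finally have "c * lp_norm M p f \<le> c * (inverse c * lp_norm M p (\<lambda>t. c * f t))"
    by (rule mult_left_mono) simp
  then have "c * lp_norm M p f \<le> lp_norm M p (\<lambda>t. c * f t)"
    by (simp add: mult.assoc[symmetric] inv)
  with lp_norm_cmult_le[OF assms] show ?thesis by (rule antisym)
qed

text \<open>Monotone convergence for finite exponents; for the infinite one, countably many
  essential bounds hold simultaneously almost everywhere.\<close>

lemma lp_norm_SUP:
  assumes "1 \<le> p" and [measurable]: "\<And>m::nat. f m \<in> borel_measurable M"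
    and inc: "\<And>m t. t \<in> space M \<Longrightarrow> f m t \<le> f (Suc m) t"
  shows "lp_norm M p (\<lambda>t. SUP m. f m t) = (SUP m. lp_norm M p (f m))"
proof (rule antisym)
  show "(SUP m. lp_norm M p (f m)) \<le> lp_norm M p (\<lambda>t. SUP m. f m t)"
    by (intro SUP_least lp_norm_mono assms SUP_upper) auto
  show "lp_norm M p (\<lambda>t. SUP m. f m t) \<le> (SUP m. lp_norm M p (f m))"
    using assms(1)
  proof (cases rule: exponent_cases)
    case infinite
    have "AE t in M. \<forall>m. f m t \<le> ess_sup_enn M (f m)"
      by (simp add: AE_all_countable ess_sup_enn_AE)
    with infinite show ?thesis
      by (auto simp: lp_norm_infinite ess_sup_enn_le_iff elim!: eventually_mono intro!: SUP_mono)
  next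
    case (real r)
    have "(\<integral>\<^sup>+ t. (SUP m. enn_pow (f m t) r) \<partial>M) = (SUP m. \<integral>\<^sup>+ t. enn_pow (f m t) r \<partial>M)"
      using real by (intro nn_integral_monotone_convergence_SUP_AE AE_I2 enn_pow_mono inc) auto
    with real show ?thesis
      by (simp add: lp_norm_real enn_pow_SUP)
  qed
qed

text \<open>Dominated convergence for the r-th powers; for p = \<infinity>, indicators of shrinking
  intervals are a counterexample. Convergence is demanded only where the majorant is finite, because
  in the induction over coordinates the majorant is an inner norm, which can be infinite on a null
  set of parameters.\<close>

lemma lp_norm_dominated:
  assumes "1 \<le> p" "p \<noteq> \<infinity>" and [measurable]: "\<And>m::nat. f m \<in> borel_measurable M" "h \<in> borel_measurable M"
    and le: "\<And>m t. t \<in> space M \<Longrightarrow> f m t \<le> h t"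
    and lim: "\<And>t. t \<in> space M \<Longrightarrow> h t < top \<Longrightarrow> (\<lambda>m. f m t) \<longlonglongrightarrow> 0"
    and fin: "lp_norm M p h < top"
  shows "(\<lambda>m. lp_norm M p (f m)) \<longlonglongrightarrow> 0"
proof -
  obtain r where r: "p = ereal r" "1 \<le> r"
    using assms(1,2) by (cases rule: exponent_cases) auto
  have fin': "(\<integral>\<^sup>+ t. enn_pow (h t) r \<partial>M) \<noteq> top"
    using fin r by (simp add: lp_norm_real flip: less_top)
  have "AE t in M. enn_pow (h t) r \<noteq> \<infinity>"
    using fin' by (intro nn_integral_PInf_AE) auto
  then have "AE t in M. (\<lambda>m. enn_pow (f m t) r) \<longlonglongrightarrow> 0"
    using AE_space
  proof eventually_elim
    case (elim t)
    then show ?case using r lim[of t] by (auto intro!: tendsto_enn_pow_zero simp: less_top)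
  qed
  then have "(\<lambda>m. \<integral>\<^sup>+ t. enn_pow (f m t) r \<partial>M) \<longlonglongrightarrow> (\<integral>\<^sup>+ t. 0 \<partial>M)"
  proof (intro nn_integral_dominated_convergence[where w="\<lambda>t. enn_pow (h t) r"])
    show "(\<integral>\<^sup>+ t. enn_pow (h t) r \<partial>M) < \<infinity>"
      using fin' by (simp add: less_top)
    show "AE t in M. enn_pow (f m t) r \<le> enn_pow (h t) r" for m
      using r le by (intro AE_I2 enn_pow_mono) auto
  qed auto
  then show ?thesis
    using r by (auto simp: lp_norm_real intro!: tendsto_enn_pow_zero)
qed

section \<open>Conjugate exponents, Hoelder's inequality and its extremal functions\<close>

lemma conj_exp_infinite [simp]: "conj_exp \<infinity> = 1"
  by (simp add: conj_exp_def one_ereal_def)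

lemma conj_exp_one [simp]: "conj_exp 1 = \<infinity>"
  by (simp add: conj_exp_def)

lemma conj_exp_real: "1 < r \<Longrightarrow> conj_exp (ereal r) = ereal (r / (r - 1))"
  by (auto simp: conj_exp_def one_ereal_def)

lemma conj_exp_ge_1:
  assumes "1 \<le> p" shows "1 \<le> conj_exp p"
  using assms
proof (cases rule: exponent_cases)
  case (real r)
  then show ?thesis
    by (cases "r = 1") (auto simp: conj_exp_real one_ereal_def[symmetric] simp del: one_ereal_def)
qed (auto)

lemma conj_exp_finite: "1 < p \<Longrightarrow> conj_exp p \<noteq> \<infinity>"
proof (cases p)
  case (real r)
  then show "1 < p \<Longrightarrow> ?thesis" by (auto simp: conj_exp_real)
qed auto

lemma recip_conj_exp:
  assumes "1 \<le> p" shows "recip (conj_exp p) = 1 - recip p"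
  using assms
proof (cases rule: exponent_cases)
  case (real r)
  then show ?thesis
    by (cases "r = 1") (auto simp: conj_exp_real recip_def field_simps simp flip: one_ereal_def)
qed (auto simp: recip_def)

lemma Holder_real_exponent:
  assumes r: "1 < r" and [measurable]: "f \<in> borel_measurable M" "g \<in> borel_measurable M"
  shows "(\<integral>\<^sup>+ t. f t * g t \<partial>M) \<le> lp_norm M (ereal r) f * lp_norm M (ereal (r / (r - 1))) g"
proof -
  define q where "q = r / (r - 1)"
  have q: "1 < q" "1 / r + 1 / q = 1"
    using r by (auto simp: q_def field_simps)
  define A where "A = (\<integral>\<^sup>+ t. enn_pow (f t) r \<partial>M)"
  define B where "B = (\<integral>\<^sup>+ t. enn_pow (g t) q \<partial>M)"
  have norms: "lp_norm M (ereal r) f = enn_pow A (1 / r)" "lp_norm M (ereal q) g = enn_pow B (1 / q)"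
    by (simp_all add: lp_norm_real A_def B_def)
  \<comment> \<open>With values in \<open>ennreal\<close>, a zero or infinite norm has to be dealt
    with before the functions can be divided by their norms.\<close>
  consider "A = 0 \<or> B = 0" | "A \<noteq> 0" "B \<noteq> 0" "A = top \<or> B = top" | "A \<noteq> 0" "B \<noteq> 0" "A \<noteq> top" "B \<noteq> top"
    by blast
  then have "(\<integral>\<^sup>+ t. f t * g t \<partial>M) \<le> enn_pow A (1 / r) * enn_pow B (1 / q)"
  proof cases
    case 1
    then have "AE t in M. f t * g t = 0"
      by (auto simp: A_def B_def nn_integral_0_iff_AE elim!: eventually_mono)
    then have "(\<integral>\<^sup>+ t. f t * g t \<partial>M) = 0"
      by (subst nn_integral_0_iff_AE) auto
    then show ?thesis by simp
  next
    case 2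
    then have "enn_pow A (1 / r) * enn_pow B (1 / q) = top"
      by (auto simp: ennreal_top_mult ennreal_mult_top)
    then show ?thesis by simp
  next
    case 3
    obtain a where a: "enn_pow A (1 / r) = ennreal a" "0 < a"
      using 3 by (cases "enn_pow A (1/r)" rule: ennreal_cases) (auto simp: less_le, metis enn_pow_eq_0_iff ennreal_0)
    obtain b where b: "enn_pow B (1 / q) = ennreal b" "0 < b"
      using 3 by (cases "enn_pow B (1/q)" rule: ennreal_cases) (auto simp: less_le, metis enn_pow_eq_0_iff ennreal_0)
    have A: "A = ennreal (a powr r)"
      using arg_cong[OF a(1), of "\<lambda>x. enn_pow x r"] r a(2) by (simp add: enn_pow_enn_pow enn_pow_ennreal)
    have B: "B = ennreal (b powr q)"
      using arg_cong[OF b(1), of "\<lambda>x. enn_pow x q"] q b(2) by (simp add: enn_pow_enn_pow enn_pow_ennreal)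
    \<comment> \<open>The weights come from Young's inequality for u / a and v / b, multiplied by a
      * b. After integration the two terms are a * b / r and a * b / q, which add up to a *
      b.\<close>
    define c where "c = a * b / (r * a powr r)"
    define d where "d = a * b / (q * b powr q)"
    have cd: "0 < c" "0 < d" "c * a powr r = a * b / r" "d * b powr q = a * b / q"
      using a b r q by (auto simp: c_def d_def)
    have pw: "f t * g t \<le> ennreal c * enn_pow (f t) r + ennreal d * enn_pow (g t) q" for t
    proof (cases "f t = top \<or> g t = top")
      case True
      then have "ennreal c * enn_pow (f t) r + ennreal d * enn_pow (g t) q = top"
        using cd by (auto simp: ennreal_mult_top)
      then show ?thesis by (metis top_greatest)
    next
      case False
      then obtain u v where uv: "f t = ennreal u" "g t = ennreal v" "0 \<le> u" "0 \<le> v"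
        by (metis ennreal_cases)
      have "(u / a) * (v / b) \<le> (u / a) powr r / r + (v / b) powr q / q"
        using Youngs_inequality[of r q "u / a" "v / b"] r q uv a b by auto
      then have "a * b * ((u / a) * (v / b)) \<le> a * b * ((u / a) powr r / r + (v / b) powr q / q)"
        using a b by (intro mult_left_mono) auto
      also have "a * b * ((u / a) powr r / r + (v / b) powr q / q) = c * u powr r + d * v powr q"
        using a b uv by (simp add: c_def d_def powr_divide field_simps)
      also have "a * b * ((u / a) * (v / b)) = u * v"
        using a b by simp
      finally show ?thesis
        using uv cd by (simp add: enn_pow_ennreal flip: ennreal_mult ennreal_plus)
    qed
    have "(\<integral>\<^sup>+ t. f t * g t \<partial>M) \<le> (\<integral>\<^sup>+ t. ennreal c * enn_pow (f t) r + ennreal d * enn_pow (g t) q \<partial>M)"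
      by (intro nn_integral_mono pw)
    also have "\<dots> = ennreal c * A + ennreal d * B"
      by (simp add: nn_integral_add nn_integral_cmult A_def B_def)
    also have "\<dots> = ennreal (a * b / r + a * b / q)"
      using cd a b r q by (simp add: A B flip: ennreal_mult ennreal_plus)
    also have "a * b / r + a * b / q = a * b * (1 / r + 1 / q)"
      by (simp add: field_simps)
    finally show ?thesis
      using a b q by (simp add: ennreal_mult)
  qed
  then show ?thesis by (simp add: norms q_def[symmetric])
qed

lemma lp_norm_Holder:
  assumes "1 \<le> p" and [measurable]: "f \<in> borel_measurable M" "g \<in> borel_measurable M"
  shows "(\<integral>\<^sup>+ t. f t * g t \<partial>M) \<le> lp_norm M p f * lp_norm M (conj_exp p) g"
  using assms(1)
proof (cases rule: exponent_cases)
  case infinite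
  have "(\<integral>\<^sup>+ t. f t * g t \<partial>M) \<le> (\<integral>\<^sup>+ t. ess_sup_enn M f * g t \<partial>M)"
    using ess_sup_enn_AE[of f M] by (intro nn_integral_mono_AE) (auto elim!: eventually_mono intro: mult_right_mono)
  with infinite show ?thesis
    by (simp add: nn_integral_cmult lp_norm_infinite lp_norm_one)
next
  case (real r)
  show ?thesis
  proof (cases "r = 1")
    case True
    have "(\<integral>\<^sup>+ t. f t * g t \<partial>M) \<le> (\<integral>\<^sup>+ t. f t * ess_sup_enn M g \<partial>M)"
      using ess_sup_enn_AE[of g M] by (intro nn_integral_mono_AE) (auto elim!: eventually_mono intro: mult_left_mono)
    with True real show ?thesis
      by (simp add: nn_integral_multc lp_norm_infinite lp_norm_one flip: one_ereal_def)
  next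
    case False
    with real Holder_real_exponent[of r f M g] show ?thesis by (simp add: conj_exp_real)
  qed
qed

text \<open>For infinite exponents the norm need not be attained; the level set of height
  \<open>\<theta>\<close> times the norm, restricted to a set \<open>B\<close> of finite measure, nearly attains it.\<close>
definition lp_test :: "'a measure \<Rightarrow> ereal \<Rightarrow> real \<Rightarrow> 'a set \<Rightarrow> ('a \<Rightarrow> ennreal) \<Rightarrow> 'a \<Rightarrow> ennreal" where
  "lp_test M p \<theta> B f t =
     (if lp_norm M p f = 0 then 0
      else if p = \<infinity> then
        (if t \<in> B \<and> ennreal \<theta> * lp_norm M p f < f t then 1 else 0) /
        (\<integral>\<^sup>+ u. (if u \<in> B \<and> ennreal \<theta> * lp_norm M p f < f u then 1 else 0) \<partial>M)
      else enn_pow (f t / lp_norm M p f) (real_of_ereal p - 1))"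

text \<open>For finite exponents the test function is extremal without loss: with S the norm of f,
  the q-th power of (f / S) ^ (r - 1) is (f / S) ^ r because (r - 1) * q = r. For p = \<infinity> it
  is the normalised indicator of a level set, whose measure is finite inside \<open>B\<close> and
  positive because \<theta> * S lies below the essential supremum. Finiteness of its values is what
  later allows it to be pulled out of inner norms.\<close>

lemma lp_test:
  assumes p: "1 < p" and f[measurable]: "f \<in> borel_measurable M" and B[measurable]: "B \<in> sets M"
    and fB: "emeasure M B < top" "\<And>t. t \<in> space M \<Longrightarrow> t \<notin> B \<Longrightarrow> f t = 0"
    and fin: "lp_norm M p f < top" and \<theta>: "0 < \<theta>" "\<theta> < 1"
    and ffin: "\<And>t. t \<in> space M \<Longrightarrow> f t < top"
  shows "lp_norm M (conj_exp p) (lp_test M p \<theta> B f) \<le> 1"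
    and "ennreal \<theta> * lp_norm M p f \<le> (\<integral>\<^sup>+ t. lp_test M p \<theta> B f t * f t \<partial>M)"
    and "t \<in> space M \<Longrightarrow> lp_test M p \<theta> B f t < top"
proof -
  define S where "S = lp_norm M p f"
  have "lp_norm M (conj_exp p) (lp_test M p \<theta> B f) \<le> 1 \<and>
     ennreal \<theta> * S \<le> (\<integral>\<^sup>+ t. lp_test M p \<theta> B f t * f t \<partial>M) \<and>
     (t \<in> space M \<longrightarrow> lp_test M p \<theta> B f t < top)"
  proof (cases "S = 0")
    case True
    then have "lp_test M p \<theta> B f = (\<lambda>_. 0)"
      by (auto simp: lp_test_def S_def)
    moreover have "lp_norm M (conj_exp p) (\<lambda>_. 0) = 0"
      using p by (subst lp_norm_eq_0_iff) (auto intro: conj_exp_ge_1)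
    ultimately show ?thesis by (simp add: True)
  next
    case S0: False
    show ?thesis
    proof (cases "p = \<infinity>")
      case True
      define w where "w t = (if t \<in> B \<and> ennreal \<theta> * S < f t then 1 else 0 :: ennreal)" for t
      have [measurable]: "w \<in> borel_measurable M" unfolding w_def by measurable
      define m where "m = (\<integral>\<^sup>+ t. w t \<partial>M)"
      have test: "lp_test M p \<theta> B f = (\<lambda>t. w t / m)"
        using S0 True by (auto simp: lp_test_def S_def m_def w_def fun_eq_iff)
      have "m \<le> (\<integral>\<^sup>+ t. indicator B t \<partial>M)"
        unfolding m_def w_def by (intro nn_integral_mono) auto
      then have mtop: "m < top" using fB(1) B by (simp add: le_less_trans)
      have "m \<noteq> 0"
      proof
        assume "m = 0"
        then have "AE t in M. w t = 0" unfolding m_def by (simp add: nn_integral_0_iff_AE)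
        then have "AE t in M. f t \<le> ennreal \<theta> * S"
          using AE_space
        proof eventually_elim
          case (elim t)
          then show ?case using fB(2)[of t] by (cases "t \<in> B") (auto simp: w_def split: if_splits)
        qed
        then have "S \<le> ennreal \<theta> * S"
          using True by (simp add: S_def lp_norm_infinite ess_sup_enn_le_iff)
        moreover obtain x where "S = ennreal x" "0 < x"
          using fin S0 by (cases S rule: ennreal_cases) (auto simp: S_def less_le)
        ultimately show False using \<theta> by (simp flip: ennreal_mult)
      qed
      then have mm: "m / m = 1" using mtop by (simp add: less_top)
      have "(\<integral>\<^sup>+ t. w t / m \<partial>M) = 1"
        by (simp add: nn_integral_divide m_def[symmetric] mm)
      then have 1: "lp_norm M (conj_exp p) (lp_test M p \<theta> B f) \<le> 1"
        unfolding test by (simp add: True lp_norm_one)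
      have "ennreal \<theta> * S = (\<integral>\<^sup>+ t. w t / m * (ennreal \<theta> * S) \<partial>M)"
        by (simp add: nn_integral_divide nn_integral_multc m_def[symmetric] mm)
      also have "\<dots> \<le> (\<integral>\<^sup>+ t. w t / m * f t \<partial>M)"
        by (intro nn_integral_mono) (auto simp: w_def intro: mult_left_mono)
      finally have 2: "ennreal \<theta> * S \<le> (\<integral>\<^sup>+ t. lp_test M p \<theta> B f t * f t \<partial>M)"
        by (simp add: test)
      have 3: "lp_test M p \<theta> B f t < top" for t
        using \<open>m \<noteq> 0\<close> by (auto simp: test w_def ennreal_divide_eq_top_iff simp flip: less_top)
      from 1 2 3 show ?thesis by simp
    next
      case False
      then obtain r where r: "p = ereal r" "1 < r"
        using p by (cases p) auto
      define q where "q = r / (r - 1)"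
      have q: "1 < q" "(r - 1) * q = r" using r by (auto simp: q_def field_simps)
      have cq: "conj_exp p = ereal q" using r by (simp add: conj_exp_real q_def)
      obtain z where z: "S = ennreal z" "0 < z"
        using fin S0 by (cases S rule: ennreal_cases) (auto simp: S_def less_le)
      have A: "(\<integral>\<^sup>+ t. enn_pow (f t) r \<partial>M) = ennreal (z powr r)"
      proof -
        have "enn_pow S r = (\<integral>\<^sup>+ t. enn_pow (f t) r \<partial>M)"
          using r by (simp add: S_def lp_norm_real enn_pow_enn_pow)
        then show ?thesis using z by (simp add: enn_pow_ennreal)
      qed
      have test: "lp_test M p \<theta> B f t = ennreal (1 / z powr (r - 1)) * enn_pow (f t) (r - 1)" for t
      proof -
        have "f t / S = ennreal (1 / z) * f t"
          using z by (simp add: divide_ennreal_def inverse_ennreal mult.commute divide_inverse)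
        then have "lp_test M p \<theta> B f t = enn_pow (ennreal (1 / z)) (r - 1) * enn_pow (f t) (r - 1)"
          using S0 r(2) unfolding lp_test_def S_def[symmetric] by (simp add: r(1) enn_pow_mult)
        then show ?thesis using z by (simp add: enn_pow_ennreal powr_divide)
      qed
      have "(\<integral>\<^sup>+ t. enn_pow (lp_test M p \<theta> B f t) q \<partial>M) =
          (\<integral>\<^sup>+ t. ennreal (1 / z powr r) * enn_pow (f t) r \<partial>M)"
        using z q by (simp add: test enn_pow_mult enn_pow_enn_pow enn_pow_ennreal powr_divide powr_powr)
      also have "\<dots> = 1"
        using z by (simp add: nn_integral_cmult A flip: ennreal_mult)
      finally have 1: "lp_norm M (conj_exp p) (lp_test M p \<theta> B f) \<le> 1"
        by (simp add: cq lp_norm_real enn_pow_def)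
      have prod: "enn_pow (f t) (r - 1) * f t = enn_pow (f t) r" for t
      proof (cases "f t" rule: ennreal_cases)
        case (real x)
        then show ?thesis
          by (cases "x = 0") (auto simp: enn_pow_ennreal powr_diff simp flip: ennreal_mult)
      qed simp
      have "(\<integral>\<^sup>+ t. lp_test M p \<theta> B f t * f t \<partial>M) =
          (\<integral>\<^sup>+ t. ennreal (1 / z powr (r - 1)) * enn_pow (f t) r \<partial>M)"
        by (simp add: test mult.assoc prod)
      also have "\<dots> = S"
        using z by (simp add: nn_integral_cmult A powr_diff flip: ennreal_mult)
      finally have 2: "ennreal \<theta> * S \<le> (\<integral>\<^sup>+ t. lp_test M p \<theta> B f t * f t \<partial>M)"
        using \<theta> z by (simp flip: ennreal_mult)
      have 3: "t \<in> space M \<Longrightarrow> lp_test M p \<theta> B f t < top"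
        using ffin[of t] unfolding less_top[symmetric] by (simp add: test ennreal_mult_eq_top_iff)
      from 1 2 3 show ?thesis by simp
    qed
  qed
  then show "lp_norm M (conj_exp p) (lp_test M p \<theta> B f) \<le> 1"
    "ennreal \<theta> * lp_norm M p f \<le> (\<integral>\<^sup>+ t. lp_test M p \<theta> B f t * f t \<partial>M)"
    "t \<in> space M \<Longrightarrow> lp_test M p \<theta> B f t < top"
    by (auto simp: S_def)
qed

section \<open>Mixed norms on finite powers of a measure\<close>

text \<open>The essential supremum needs an argument: it is at most c exactly when the set where
  \<open>F x\<close> exceeds c is null, and the measure of that set depends measurably on x because
  \<open>M\<close> is sigma-finite.\<close>

lemma measurable_lp_norm:
  assumes "sigma_finite_measure M" "1 \<le> p" and [measurable]: "case_prod F \<in> borel_measurable (N \<Otimes>\<^sub>M M)"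
  shows "(\<lambda>x. lp_norm M p (F x)) \<in> borel_measurable N"
proof -
  interpret sigma_finite_measure M by fact
  show ?thesis
    using assms(2)
  proof (cases rule: exponent_cases)
    case infinite
    show ?thesis
    proof (rule borel_measurableI_le)
      fix c
      have "{x \<in> space N. lp_norm M p (F x) \<le> c} =
          {x \<in> space N. (\<integral>\<^sup>+ t. (if F x t \<le> c then 0 else 1) \<partial>M) = 0}"
        by (intro Collect_cong conj_cong refl)
          (auto simp: infinite lp_norm_infinite ess_sup_enn_le_iff nn_integral_0_iff_AE split: if_splits elim!: eventually_mono)
      also have "\<dots> \<in> sets N" by measurable
      finally show "{x \<in> space N. lp_norm M p (F x) \<le> c} \<in> sets N" .
    qed
  next
    case (real r)
    then show ?thesis by (simp add: lp_norm_real)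
  qed
qed

lemma lp_norm_indicator_finite:
  assumes "1 \<le> p" "B \<in> sets M" "emeasure M B < top"
  shows "lp_norm M p (indicator B) < top"
  using assms(1)
proof (cases rule: exponent_cases)
  case infinite
  have "ess_sup_enn M (indicator B) \<le> 1"
    by (auto simp: ess_sup_enn_le_iff indicator_def)
  with infinite show ?thesis by (auto simp: lp_norm_infinite intro: le_less_trans)
next
  case (real r)
  have "enn_pow (indicator B t) r = indicator B t" for t
    by (auto simp: indicator_def enn_pow_def)
  with real assms show ?thesis by (simp add: lp_norm_real flip: less_top)
qed

text \<open>Each \<open>lp_step\<close> overwrites the coordinate in which it takes the norm. Hence
  factors built from inner norms are constant in the earlier coordinates, and the entries below n of
  the point at which \<open>mixed_norm\<close> is evaluated are immaterial.\<close>

lemma mixed_norm_aux_depends: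
  "(\<And>i. k \<le> i \<Longrightarrow> x i = y i) \<Longrightarrow> mixed_norm_aux M p k F x = mixed_norm_aux M p k F y"
proof (induction k arbitrary: x y)
  case 0
  then have "x = y" by auto
  then show ?case by simp
next
  case (Suc k)
  have "mixed_norm_aux M p k F (x(k := t)) = mixed_norm_aux M p k F (y(k := t))" for t
    using Suc.prems by (intro Suc.IH) auto
  then show ?case by (simp add: lp_step_eq)
qed

text \<open>\<open>x(k := t)\<close> has to stay in the product space for every t, hence the full
  carrier. The two instances are Lebesgue measure on the reals, for the norms inside a cube, and
  counting measure on the integers, for the norm over the cubes.\<close>

locale full_sigma_finite = sigma_finite_measure M for M :: "'a measure" +
  assumes space_eq_UNIV [simp]: "space M = UNIV"

sublocale full_sigma_finite \<subseteq> prod: product_sigma_finite "\<lambda>_::nat. M"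
  by unfold_locales

context full_sigma_finite
begin

abbreviation prod_power :: "nat \<Rightarrow> (nat \<Rightarrow> 'a) measure" where
  "prod_power n \<equiv> PiM {..<n} (\<lambda>_. M)"

lemma space_upd: "x \<in> space (prod_power n) \<Longrightarrow> k < n \<Longrightarrow> x(k := t) \<in> space (prod_power n)"
  by (auto simp: space_PiM PiE_def extensional_def)

lemma measurable_upd_pair [measurable (raw)]:
  assumes F: "F \<in> borel_measurable (prod_power n)" and "k < n"
  shows "(\<lambda>(x, t). F (x(k := t))) \<in> borel_measurable (prod_power n \<Otimes>\<^sub>M M)"
proof -
  have "(\<lambda>(x, t). x(k := t)) \<in> prod_power n \<Otimes>\<^sub>M M \<rightarrow>\<^sub>M PiM (insert k {..<n}) (\<lambda>_. M)"
    by measurable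
  also have "insert k {..<n} = {..<n}" using \<open>k < n\<close> by auto
  finally have "(\<lambda>w. F ((\<lambda>(x, t). x(k := t)) w)) \<in> borel_measurable (prod_power n \<Otimes>\<^sub>M M)"
    by (rule measurable_compose[OF _ F])
  then show ?thesis by (simp add: case_prod_unfold fun_upd_def)
qed

lemma measurable_upd:
  assumes "F \<in> borel_measurable (prod_power n)" "k < n" "x \<in> space (prod_power n)"
  shows "(\<lambda>t. F (x(k := t))) \<in> borel_measurable M"
  using measurable_compose[OF measurable_Pair1'[OF assms(3)] measurable_upd_pair[OF assms(1,2)]] by simp

lemma undefined_in_space: "(\<lambda>_. undefined) \<in> space (prod_power n)"
  by (auto simp: space_PiM PiE_def extensional_def)

lemma measurable_mixed_norm_aux:
  assumes p: "\<And>i. i < n \<Longrightarrow> 1 \<le> p i" and F: "F \<in> borel_measurable (prod_power n)" and "k \<le> n"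
  shows "mixed_norm_aux M p k F \<in> borel_measurable (prod_power n)"
  using \<open>k \<le> n\<close>
proof (induction k)
  case (Suc k)
  then have "(\<lambda>x. lp_norm M (p k) (\<lambda>t. mixed_norm_aux M p k F (x(k := t)))) \<in> borel_measurable (prod_power n)"
    by (intro measurable_lp_norm p measurable_upd_pair) (auto intro: sigma_finite_measure_axioms)
  then show ?case by (simp add: lp_step_eq[abs_def])
qed (simp add: F)

lemma measurable_mixed_norm_aux_upd:
  assumes "\<And>i. i < n \<Longrightarrow> 1 \<le> p i" "F \<in> borel_measurable (prod_power n)" "k < n" "x \<in> space (prod_power n)"
  shows "(\<lambda>t. mixed_norm_aux M p k F (x(k := t))) \<in> borel_measurable M"
  using assms by (intro measurable_upd measurable_mixed_norm_aux) auto

lemma mixed_norm_aux_mono: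
  assumes p: "\<And>i. i < n \<Longrightarrow> 1 \<le> p i" and le: "\<And>x. x \<in> space (prod_power n) \<Longrightarrow> F x \<le> G x"
    and "k \<le> n" "x \<in> space (prod_power n)"
  shows "mixed_norm_aux M p k F x \<le> mixed_norm_aux M p k G x"
  using \<open>k \<le> n\<close> \<open>x \<in> _\<close>
proof (induction k arbitrary: x)
  case (Suc k)
  then show ?case by (auto simp: lp_step_eq Suc_le_eq intro!: lp_norm_mono p space_upd)
qed (simp add: le)

lemma mixed_norm_mono:
  assumes "\<And>i. i < n \<Longrightarrow> 1 \<le> p i" "\<And>x. x \<in> space (prod_power n) \<Longrightarrow> F x \<le> G x"
  shows "mixed_norm M n p F \<le> mixed_norm M n p G"
  unfolding mixed_norm_def by (intro mixed_norm_aux_mono[where n = n] assms undefined_in_space) auto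

lemma mixed_norm_cong:
  assumes "\<And>i. i < n \<Longrightarrow> 1 \<le> p i" "\<And>x. x \<in> space (prod_power n) \<Longrightarrow> F x = G x"
  shows "mixed_norm M n p F = mixed_norm M n p G"
  using assms by (intro antisym mixed_norm_mono) auto

text \<open>The factor is a function: as it depends on the coordinates from k on alone, the norms in
  the coordinates below k treat it as a constant. The factors of the test functions are extracted in
  this way.\<close>

lemma mixed_norm_aux_cmult:
  assumes p: "\<And>i. i < n \<Longrightarrow> 1 \<le> p i" and F: "F \<in> borel_measurable (prod_power n)"
    and c: "\<And>x. x \<in> space (prod_power n) \<Longrightarrow> c x < top"
      "\<And>x y. (\<And>i. k \<le> i \<Longrightarrow> x i = y i) \<Longrightarrow> c x = c y"
    and "k \<le> n" "x \<in> space (prod_power n)"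
  shows "mixed_norm_aux M p k (\<lambda>x. c x * F x) x = c x * mixed_norm_aux M p k F x"
  using \<open>k \<le> n\<close> \<open>x \<in> _\<close> c
proof (induction k arbitrary: x)
  case 0
  show ?case by simp
next
  case (Suc k)
  have "mixed_norm_aux M p k (\<lambda>x. c x * F x) (x(k := t)) = c x * mixed_norm_aux M p k F (x(k := t))" for t
  proof -
    have "c (x(k := t)) = c x"
      by (rule Suc.prems(4)) auto
    moreover have "mixed_norm_aux M p k (\<lambda>x. c x * F x) (x(k := t)) = c (x(k := t)) * mixed_norm_aux M p k F (x(k := t))"
    proof (rule Suc.IH)
      show "c x = c y" if "\<And>i. k \<le> i \<Longrightarrow> x i = y i" for x y
        using that by (intro Suc.prems(4)) auto
      show "x(k := t) \<in> space (prod_power n)"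
        using Suc.prems(1,2) by (intro space_upd) auto
    qed (use Suc.prems(1,3) in auto)
    ultimately show ?thesis by simp
  qed
  then show ?case
    using Suc.prems(1,2) Suc.prems(3)[of x] by (simp add: lp_step_eq) (intro lp_norm_cmult p measurable_mixed_norm_aux_upd[where n = n] F, auto simp: Suc_le_eq)
qed

lemma mixed_norm_cmult:
  assumes "\<And>i. i < n \<Longrightarrow> 1 \<le> p i" "F \<in> borel_measurable (prod_power n)" "c < top"
  shows "mixed_norm M n p (\<lambda>x. c * F x) = c * mixed_norm M n p F"
  unfolding mixed_norm_def using assms
  by (intro mixed_norm_aux_cmult[where n = n and c = "\<lambda>_. c"] undefined_in_space) auto

text \<open>Tonelli, one coordinate at a time: with exponent 1 each step is an integral, and the
  coordinates from k on stay parameters taken from x.\<close>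

lemma mixed_norm_aux_one:
  assumes F: "F \<in> borel_measurable (prod_power n)" and "k \<le> n" "x \<in> space (prod_power n)"
  shows "mixed_norm_aux M (\<lambda>_. 1) k F x = (\<integral>\<^sup>+ y. F (\<lambda>i. if i < k then y i else x i) \<partial>prod_power k)"
  using \<open>k \<le> n\<close> \<open>x \<in> _\<close>
proof (induction k arbitrary: x)
  case 0
  then show ?case by (simp add: PiM_empty nn_integral_count_space_finite)
next
  case (Suc k)
  have meas: "(\<lambda>y. F (\<lambda>i. if i < Suc k then y i else x i)) \<in> borel_measurable (PiM (insert k {..<k}) (\<lambda>_. M))"
  proof (rule measurable_compose[OF _ F], rule measurable_PiM_single')
    show "(\<lambda>y. if i < Suc k then y i else x i) \<in> PiM (insert k {..<k}) (\<lambda>_. M) \<rightarrow>\<^sub>M M" if "i \<in> {..<n}" for i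
      by (cases "i < Suc k") (auto intro!: measurable_component_singleton)
  qed (use Suc.prems in \<open>auto simp: space_PiM PiE_def extensional_def\<close>)
  have "mixed_norm_aux M (\<lambda>_. 1) (Suc k) F x
      = (\<integral>\<^sup>+ t. (\<integral>\<^sup>+ y. F (\<lambda>i. if i < k then y i else (x(k := t)) i) \<partial>prod_power k) \<partial>M)"
    using Suc by (auto simp: lp_step_eq lp_norm_one space_upd Suc_le_eq)
  also have "\<dots> = (\<integral>\<^sup>+ t. (\<integral>\<^sup>+ y. F (\<lambda>i. if i < Suc k then (y(k := t)) i else x i) \<partial>prod_power k) \<partial>M)"
    by (intro nn_integral_cong arg_cong[where f = F]) auto
  also have "\<dots> = (\<integral>\<^sup>+ y. F (\<lambda>i. if i < Suc k then y i else x i) \<partial>PiM (insert k {..<k}) (\<lambda>_. M))"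
    using meas by (subst prod.product_nn_integral_insert_rev) auto
  finally show ?case by (simp add: lessThan_Suc)
qed

lemma mixed_norm_one:
  assumes F: "F \<in> borel_measurable (prod_power n)"
  shows "mixed_norm M n (\<lambda>_. 1) F = (\<integral>\<^sup>+ y. F y \<partial>prod_power n)"
  unfolding mixed_norm_def mixed_norm_aux_one[OF F order_refl undefined_in_space]
  by (intro nn_integral_cong arg_cong[where f = F]) (auto simp: space_PiM PiE_def extensional_def)

text \<open>The integral over the first k coordinates is written as a mixed norm with exponents 1,
  so that both sides unfold in step and the one-variable inequality closes the induction.\<close>

lemma mixed_norm_aux_Holder:
  assumes p: "\<And>i. i < n \<Longrightarrow> 1 \<le> p i"
    and F: "F \<in> borel_measurable (prod_power n)" and G: "G \<in> borel_measurable (prod_power n)"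
    and "k \<le> n" "x \<in> space (prod_power n)"
  shows "mixed_norm_aux M (\<lambda>_. 1) k (\<lambda>x. F x * G x) x
    \<le> mixed_norm_aux M p k F x * mixed_norm_aux M (\<lambda>i. conj_exp (p i)) k G x"
  using \<open>k \<le> n\<close> \<open>x \<in> _\<close>
proof (induction k arbitrary: x)
  case (Suc k)
  have "mixed_norm_aux M (\<lambda>_. 1) (Suc k) (\<lambda>x. F x * G x) x
      = (\<integral>\<^sup>+ t. mixed_norm_aux M (\<lambda>_. 1) k (\<lambda>x. F x * G x) (x(k := t)) \<partial>M)"
    by (simp add: lp_step_eq lp_norm_one)
  also have "\<dots> \<le> (\<integral>\<^sup>+ t. mixed_norm_aux M p k F (x(k := t)) * mixed_norm_aux M (\<lambda>i. conj_exp (p i)) k G (x(k := t)) \<partial>M)"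
    using Suc by (intro nn_integral_mono Suc.IH space_upd) (auto simp: Suc_le_eq)
  also have "\<dots> \<le> lp_norm M (p k) (\<lambda>t. mixed_norm_aux M p k F (x(k := t)))
      * lp_norm M (conj_exp (p k)) (\<lambda>t. mixed_norm_aux M (\<lambda>i. conj_exp (p i)) k G (x(k := t)))"
    using Suc.prems by (intro lp_norm_Holder p measurable_mixed_norm_aux_upd[where n = n] F G conj_exp_ge_1) (auto simp: Suc_le_eq)
  finally show ?case by (simp add: lp_step_eq)
qed simp

lemma mixed_norm_Holder:
  assumes "\<And>i. i < n \<Longrightarrow> 1 \<le> p i"
    and [measurable]: "F \<in> borel_measurable (prod_power n)" "G \<in> borel_measurable (prod_power n)"
  shows "(\<integral>\<^sup>+ x. F x * G x \<partial>prod_power n) \<le> mixed_norm M n p F * mixed_norm M n (\<lambda>i. conj_exp (p i)) G"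
  using mixed_norm_aux_Holder[OF assms order_refl undefined_in_space] mixed_norm_one[of "\<lambda>x. F x * G x" n]
  by (simp add: mixed_norm_def)

lemma mixed_norm_aux_SUP:
  assumes p: "\<And>i. i < n \<Longrightarrow> 1 \<le> p i" and F: "\<And>m::nat. F m \<in> borel_measurable (prod_power n)"
    and inc: "\<And>m x. x \<in> space (prod_power n) \<Longrightarrow> F m x \<le> F (Suc m) x"
    and "k \<le> n" "x \<in> space (prod_power n)"
  shows "mixed_norm_aux M p k (\<lambda>x. SUP m. F m x) x = (SUP m. mixed_norm_aux M p k (F m) x)"
  using \<open>k \<le> n\<close> \<open>x \<in> _\<close>
proof (induction k arbitrary: x)
  case (Suc k)
  then have "mixed_norm_aux M p (Suc k) (\<lambda>x. SUP m. F m x) x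
      = lp_norm M (p k) (\<lambda>t. SUP m. mixed_norm_aux M p k (F m) (x(k := t)))"
    by (auto simp: lp_step_eq space_upd Suc_le_eq)
  also have "\<dots> = (SUP m. lp_norm M (p k) (\<lambda>t. mixed_norm_aux M p k (F m) (x(k := t))))"
    using Suc.prems by (intro lp_norm_SUP p measurable_mixed_norm_aux_upd[where n = n] F mixed_norm_aux_mono[where n = n] inc space_upd) (auto simp: Suc_le_eq)
  finally show ?case by (simp add: lp_step_eq)
qed simp

lemma mixed_norm_SUP:
  assumes "\<And>i. i < n \<Longrightarrow> 1 \<le> p i" "\<And>m::nat. F m \<in> borel_measurable (prod_power n)"
    "\<And>m x. x \<in> space (prod_power n) \<Longrightarrow> F m x \<le> F (Suc m) x"
  shows "mixed_norm M n p (\<lambda>x. SUP m. F m x) = (SUP m. mixed_norm M n p (F m))"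
  unfolding mixed_norm_def by (rule mixed_norm_aux_SUP[where n = n]) (use assms undefined_in_space in auto)

text \<open>A step vanishes exactly when the inner norm vanishes almost everywhere, whatever the
  exponent. So the exponents may be replaced by 1, where the mixed norm is an integral.\<close>

lemma mixed_norm_aux_eq_0_iff:
  assumes p: "\<And>i. i < n \<Longrightarrow> 1 \<le> p i" and F: "F \<in> borel_measurable (prod_power n)"
    and "k \<le> n" "x \<in> space (prod_power n)"
  shows "mixed_norm_aux M p k F x = 0 \<longleftrightarrow> mixed_norm_aux M (\<lambda>_. 1) k F x = 0"
  using \<open>k \<le> n\<close> \<open>x \<in> _\<close>
proof (induction k arbitrary: x)
  case (Suc k)
  have "mixed_norm_aux M p (Suc k) F x = 0 \<longleftrightarrow> (AE t in M. mixed_norm_aux M p k F (x(k := t)) = 0)"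
    unfolding mixed_norm_aux.simps lp_step_eq
    using Suc.prems by (intro lp_norm_eq_0_iff p measurable_mixed_norm_aux_upd[where n = n] F) (auto simp: Suc_le_eq)
  also have "\<dots> \<longleftrightarrow> (AE t in M. mixed_norm_aux M (\<lambda>_. 1) k F (x(k := t)) = 0)"
    using Suc by (intro AE_cong) (auto simp: space_upd Suc_le_eq)
  also have "\<dots> \<longleftrightarrow> mixed_norm_aux M (\<lambda>_. 1) (Suc k) F x = 0"
    unfolding mixed_norm_aux.simps lp_step_eq
    using Suc.prems by (intro lp_norm_eq_0_iff[symmetric] measurable_mixed_norm_aux_upd[where n = n] F) (auto simp: Suc_le_eq)
  finally show ?case .
qed simp

lemma mixed_norm_eq_0_iff:
  assumes "\<And>i. i < n \<Longrightarrow> 1 \<le> p i" and [measurable]: "F \<in> borel_measurable (prod_power n)"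
  shows "mixed_norm M n p F = 0 \<longleftrightarrow> (AE x in prod_power n. F x = 0)"
  using mixed_norm_aux_eq_0_iff[OF assms order_refl undefined_in_space]
  by (simp add: mixed_norm_def[symmetric] mixed_norm_one nn_integral_0_iff_AE)

text \<open>The inner norm of \<open>H\<close> is the majorant for the next coordinate. It may be
  infinite at some parameters, which \<open>lp_norm_dominated\<close> tolerates.\<close>

lemma mixed_norm_aux_dominated:
  assumes p: "\<And>i. i < n \<Longrightarrow> 1 \<le> p i" "\<And>i. i < n \<Longrightarrow> p i \<noteq> \<infinity>"
    and F: "\<And>m::nat. F m \<in> borel_measurable (prod_power n)" and H: "H \<in> borel_measurable (prod_power n)"
    and le: "\<And>m x. x \<in> space (prod_power n) \<Longrightarrow> F m x \<le> H x"
    and lim: "\<And>x. x \<in> space (prod_power n) \<Longrightarrow> H x < top \<Longrightarrow> (\<lambda>m. F m x) \<longlonglongrightarrow> 0"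
    and "k \<le> n" "x \<in> space (prod_power n)" "mixed_norm_aux M p k H x < top"
  shows "(\<lambda>m. mixed_norm_aux M p k (F m) x) \<longlonglongrightarrow> 0"
  using \<open>k \<le> n\<close> \<open>x \<in> _\<close> \<open>mixed_norm_aux M p k H x < top\<close>
proof (induction k arbitrary: x)
  case (Suc k)
  have "(\<lambda>m. lp_norm M (p k) (\<lambda>t. mixed_norm_aux M p k (F m) (x(k := t)))) \<longlonglongrightarrow> 0"
  proof (rule lp_norm_dominated[where h = "\<lambda>t. mixed_norm_aux M p k H (x(k := t))"])
    show "lp_norm M (p k) (\<lambda>t. mixed_norm_aux M p k H (x(k := t))) < top"
      using Suc.prems(3) by (simp add: lp_step_eq)
  qed (use Suc in \<open>auto intro!: p measurable_mixed_norm_aux_upd[where n = n] F H mixed_norm_aux_mono[where n = n] le space_upd simp: Suc_le_eq\<close>)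
  then show ?case by (simp add: lp_step_eq)
qed (use lim in simp)

lemma mixed_norm_dominated:
  assumes "\<And>i. i < n \<Longrightarrow> 1 \<le> p i" "\<And>i. i < n \<Longrightarrow> p i \<noteq> \<infinity>"
    and "\<And>m::nat. F m \<in> borel_measurable (prod_power n)" "H \<in> borel_measurable (prod_power n)"
    and "\<And>m x. x \<in> space (prod_power n) \<Longrightarrow> F m x \<le> H x"
    and "\<And>x. x \<in> space (prod_power n) \<Longrightarrow> H x < top \<Longrightarrow> (\<lambda>m. F m x) \<longlonglongrightarrow> 0"
    and "mixed_norm M n p H < top"
  shows "(\<lambda>m. mixed_norm M n p (F m)) \<longlonglongrightarrow> 0"
  unfolding mixed_norm_def
  by (rule mixed_norm_aux_dominated[where n = n and H = H])
    (use assms undefined_in_space in \<open>auto simp: mixed_norm_def\<close>)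

text \<open>Bound and support are carried along together: the next norm is finite because the inner
  one is at most c' times the indicator of \<open>B\<close>, and the support in the remaining
  coordinates survives the step.\<close>

lemma mixed_norm_aux_bounded_support:
  assumes p: "\<And>i. i < n \<Longrightarrow> 1 \<le> p i" and B: "B \<in> sets M" "emeasure M B < top"
    and G: "\<And>x. x \<in> space (prod_power n) \<Longrightarrow> G x \<le> c" "c < top"
      "\<And>x i. x \<in> space (prod_power n) \<Longrightarrow> i < n \<Longrightarrow> x i \<notin> B \<Longrightarrow> G x = 0"
    and "k \<le> n"
  shows "\<exists>c'<top. \<forall>x\<in>space (prod_power n). mixed_norm_aux M p k G x \<le> c' \<and>
    (\<forall>i<n. k \<le> i \<longrightarrow> x i \<notin> B \<longrightarrow> mixed_norm_aux M p k G x = 0)"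
  using \<open>k \<le> n\<close>
proof (induction k)
  case 0
  then show ?case using G by auto
next
  case (Suc k)
  then obtain c' where c': "c' < top"
    and le: "\<And>x. x \<in> space (prod_power n) \<Longrightarrow> mixed_norm_aux M p k G x \<le> c'"
    and supp: "\<And>x i. x \<in> space (prod_power n) \<Longrightarrow> i < n \<Longrightarrow> k \<le> i \<Longrightarrow> x i \<notin> B \<Longrightarrow> mixed_norm_aux M p k G x = 0"
    by (metis Suc_leD)
  have pk: "1 \<le> p k" using p Suc.prems by simp
  have "mixed_norm_aux M p (Suc k) G x \<le> c' * lp_norm M (p k) (indicator B)" if x: "x \<in> space (prod_power n)" for x
  proof -
    have "lp_norm M (p k) (\<lambda>t. mixed_norm_aux M p k G (x(k := t))) \<le> lp_norm M (p k) (\<lambda>t. c' * indicator B t)"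
    proof (intro lp_norm_mono pk)
      fix t
      show "mixed_norm_aux M p k G (x(k := t)) \<le> c' * indicator B t"
        using le[of "x(k := t)"] supp[of "x(k := t)" k] x Suc.prems by (cases "t \<in> B") (auto simp: space_upd Suc_le_eq)
    qed
    also have "\<dots> \<le> c' * lp_norm M (p k) (indicator B)"
      using c' B by (intro lp_norm_cmult_le pk) auto
    finally show ?thesis by (simp add: lp_step_eq)
  qed
  moreover have "mixed_norm_aux M p (Suc k) G x = 0"
    if x: "x \<in> space (prod_power n)" and i: "i < n" "Suc k \<le> i" "x i \<notin> B" for x i
  proof -
    have "mixed_norm_aux M p k G (x(k := t)) = 0" for t
      using i x Suc.prems by (intro supp[of _ i] space_upd) (auto simp: Suc_le_eq)
    then show ?thesis using pk by (simp add: lp_step_eq lp_norm_eq_0_iff)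
  qed
  moreover have "c' * lp_norm M (p k) (indicator B) < top"
    using c' lp_norm_indicator_finite[OF pk B] by (simp add: ennreal_mult_less_top)
  ultimately show ?case by blast
qed

lemma mixed_norm_bounded_support:
  assumes "\<And>i. i < n \<Longrightarrow> 1 \<le> p i" "B \<in> sets M" "emeasure M B < top"
    and "\<And>x. x \<in> space (prod_power n) \<Longrightarrow> G x \<le> c" "c < top"
      "\<And>x i. x \<in> space (prod_power n) \<Longrightarrow> i < n \<Longrightarrow> x i \<notin> B \<Longrightarrow> G x = 0"
  shows "mixed_norm M n p G < top"
proof -
  have "\<exists>c'<top. \<forall>x\<in>space (prod_power n). mixed_norm_aux M p n G x \<le> c' \<and>
    (\<forall>i<n. n \<le> i \<longrightarrow> x i \<notin> B \<longrightarrow> mixed_norm_aux M p n G x = 0)"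
    by (rule mixed_norm_aux_bounded_support[of n p B G c n]) (use assms in auto)
  then obtain c' where "c' < top" "mixed_norm M n p G \<le> c'"
    using undefined_in_space[of n] unfolding mixed_norm_def by blast
  then show ?thesis by (rule le_less_trans[rotated])
qed


text \<open>If \<open>F\<close> tests the first k coordinates, then \<open>T x * F x\<close> tests k
  + 1 of them, where \<open>T\<close> is the one-variable test function for the inner norm of
  \<open>G\<close> along coordinate k. As \<open>T\<close> depends on the coordinates from k on
  alone, it leaves the inner norms; the estimates for \<open>F\<close> then reduce both claims to
  those of \<open>lp_test\<close>.\<close>

lemma mixed_norm_aux_test_function:
  assumes p: "\<And>i. i < n \<Longrightarrow> 1 < p i" and B: "B \<in> sets M" "emeasure M B < top"
    and meas: "G \<in> borel_measurable (prod_power n)"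
    and G: "\<And>x. x \<in> space (prod_power n) \<Longrightarrow> G x \<le> c" "c < top"
      "\<And>x i. x \<in> space (prod_power n) \<Longrightarrow> i < n \<Longrightarrow> x i \<notin> B \<Longrightarrow> G x = 0"
    and \<theta>: "0 < \<theta>" "\<theta> < 1" and "k \<le> n"
  shows "\<exists>F\<in>borel_measurable (prod_power n). \<forall>x\<in>space (prod_power n).
    mixed_norm_aux M (\<lambda>i. conj_exp (p i)) k F x \<le> 1 \<and>
    ennreal (\<theta> ^ k) * mixed_norm_aux M p k G x \<le> mixed_norm_aux M (\<lambda>_. 1) k (\<lambda>x. F x * G x) x"
  using \<open>k \<le> n\<close>
proof (induction k)
  case 0
  show ?case by (intro bexI[of _ "\<lambda>_. 1"]) auto
next
  case (Suc k)
  have p1: "\<And>i. i < n \<Longrightarrow> 1 \<le> p i" using p by (simp add: less_imp_le)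
  have k: "k < n" "k \<le> n" using Suc.prems by auto
  from Suc.IH[OF k(2)] obtain F where F: "F \<in> borel_measurable (prod_power n)"
    and F1: "\<And>x. x \<in> space (prod_power n) \<Longrightarrow> mixed_norm_aux M (\<lambda>i. conj_exp (p i)) k F x \<le> 1"
    and FG: "\<And>x. x \<in> space (prod_power n) \<Longrightarrow>
      ennreal (\<theta> ^ k) * mixed_norm_aux M p k G x \<le> mixed_norm_aux M (\<lambda>_. 1) k (\<lambda>x. F x * G x) x"
    by auto
  have "\<exists>c'<top. \<forall>x\<in>space (prod_power n). mixed_norm_aux M p k G x \<le> c' \<and>
      (\<forall>i<n. k \<le> i \<longrightarrow> x i \<notin> B \<longrightarrow> mixed_norm_aux M p k G x = 0)"
    by (rule mixed_norm_aux_bounded_support[of n p B G c k]) (use p1 B G k in auto)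
  then have fin: "mixed_norm_aux M p k G x < top"
    and supp: "x k \<notin> B \<Longrightarrow> mixed_norm_aux M p k G x = 0" if "x \<in> space (prod_power n)" for x
    using that k by (auto intro: le_less_trans)
  have "\<exists>c'<top. \<forall>x\<in>space (prod_power n). mixed_norm_aux M p (Suc k) G x \<le> c' \<and>
      (\<forall>i<n. Suc k \<le> i \<longrightarrow> x i \<notin> B \<longrightarrow> mixed_norm_aux M p (Suc k) G x = 0)"
    by (rule mixed_norm_aux_bounded_support[of n p B G c "Suc k"]) (use p1 B G k in auto)
  then have finS: "lp_norm M (p k) (\<lambda>t. mixed_norm_aux M p k G (x(k := t))) < top"
    if "x \<in> space (prod_power n)" for x
    using that k by (auto intro: le_less_trans simp: lp_step_eq)
  \<comment> \<open>\<open>g x\<close> overwrites coordinate k, so it is the slice through x in that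
    direction; \<open>T\<close> evaluates the test function of this slice at the entry
    \<open>x k\<close>.\<close>
  define g where "g x = (\<lambda>t. mixed_norm_aux M p k G (x(k := t)))" for x
  define T where "T x = lp_test M (p k) \<theta> B (g x) (x k)" for x
  have gm[measurable]: "(\<lambda>(x, t). g x t) \<in> borel_measurable (prod_power n \<Otimes>\<^sub>M M)"
    unfolding g_def using k by (intro measurable_upd_pair measurable_mixed_norm_aux p1 meas) auto
  have Sm[measurable]: "(\<lambda>x. lp_norm M (p k) (g x)) \<in> borel_measurable (prod_power n)"
    using k by (intro measurable_lp_norm p1) (auto intro: sigma_finite_measure_axioms)
  have [measurable]: "(\<lambda>x. x k) \<in> prod_power n \<rightarrow>\<^sub>M M"
    using k by (intro measurable_component_singleton) auto
  have gk[measurable]: "(\<lambda>x. g x (x k)) \<in> borel_measurable (prod_power n)"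
    by measurable
  note B(1)[measurable]
  have T[measurable]: "T \<in> borel_measurable (prod_power n)"
    unfolding T_def[abs_def] lp_test_def by measurable
  have gx: "g x \<in> borel_measurable M" if "x \<in> space (prod_power n)" for x
    unfolding g_def by (rule measurable_mixed_norm_aux_upd[OF p1 meas k(1) that])
  have upd: "x(k := t) \<in> space (prod_power n)" if "x \<in> space (prod_power n)" for x t
    using that k(1) by (rule space_upd)
  have Tupd: "T (x(k := t)) = lp_test M (p k) \<theta> B (g x) t" for x t
    by (simp add: T_def g_def)
  have test: "lp_norm M (conj_exp (p k)) (lp_test M (p k) \<theta> B (g x)) \<le> 1"
    "ennreal \<theta> * lp_norm M (p k) (g x) \<le> (\<integral>\<^sup>+ t. lp_test M (p k) \<theta> B (g x) t * g x t \<partial>M)"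
    "lp_test M (p k) \<theta> B (g x) t < top" if "x \<in> space (prod_power n)" for x t
    by (rule lp_test[OF p[OF k(1)] gx[OF that] B];
        use that finS fin supp upd \<theta> in \<open>auto simp: g_def\<close>)+
  have Tfin: "T x < top" if "x \<in> space (prod_power n)" for x
    unfolding T_def by (rule test that)+
  have Tdep: "T x = T y" if "\<And>i. k \<le> i \<Longrightarrow> x i = y i" for x y
  proof -
    have "g x = g y"
      using that unfolding g_def by (intro ext mixed_norm_aux_depends) auto
    then show ?thesis using that[of k] by (simp add: T_def)
  qed
  have q1: "\<And>i. i < n \<Longrightarrow> 1 \<le> conj_exp (p i)" by (intro conj_exp_ge_1 p1)
  have norm: "mixed_norm_aux M (\<lambda>i. conj_exp (p i)) (Suc k) (\<lambda>x. T x * F x) x \<le> 1"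
    if x: "x \<in> space (prod_power n)" for x
  proof -
    \<comment> \<open>The inner norm of the product is \<open>T\<close> times that of
      \<open>F\<close>, hence at most \<open>T\<close>, and along the slice \<open>T\<close> is the
      test function itself.\<close>
    have "mixed_norm_aux M (\<lambda>i. conj_exp (p i)) k (\<lambda>x. T x * F x) (x(k := t)) \<le> lp_test M (p k) \<theta> B (g x) t" for t
    proof -
      have "mixed_norm_aux M (\<lambda>i. conj_exp (p i)) k (\<lambda>x. T x * F x) (x(k := t))
        = T (x(k := t)) * mixed_norm_aux M (\<lambda>i. conj_exp (p i)) k F (x(k := t))"
        by (rule mixed_norm_aux_cmult[OF q1 F Tfin Tdep k(2) upd[OF x]])
      also have "\<dots> \<le> T (x(k := t)) * 1"
        by (intro mult_left_mono F1 upd x) auto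
      finally show ?thesis by (simp add: Tupd)
    qed
    then have "lp_norm M (conj_exp (p k)) (\<lambda>t. mixed_norm_aux M (\<lambda>i. conj_exp (p i)) k (\<lambda>x. T x * F x) (x(k := t)))
        \<le> lp_norm M (conj_exp (p k)) (lp_test M (p k) \<theta> B (g x))"
      by (intro lp_norm_mono q1 k)
    also note test(1)[OF x]
    finally show ?thesis by (simp add: lp_step_eq)
  qed
  have pair: "ennreal (\<theta> ^ Suc k) * mixed_norm_aux M p (Suc k) G x
      \<le> mixed_norm_aux M (\<lambda>_. 1) (Suc k) (\<lambda>x. T x * F x * G x) x"
    if x: "x \<in> space (prod_power n)" for x
  proof -
    have gx': "g x \<in> borel_measurable M" by (rule gx[OF x])
    have Tx: "(\<lambda>t. T (x(k := t))) \<in> borel_measurable M"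
      by (rule measurable_upd[OF T k(1) x])
    then have tx: "(\<lambda>t. lp_test M (p k) \<theta> B (g x) t) \<in> borel_measurable M"
      by (simp only: Tupd)
    have "ennreal (\<theta> ^ Suc k) * mixed_norm_aux M p (Suc k) G x
        = ennreal (\<theta> ^ k) * (ennreal \<theta> * lp_norm M (p k) (g x))"
      using \<theta> by (simp add: lp_step_eq g_def ennreal_mult mult_ac)
    also have "\<dots> \<le> ennreal (\<theta> ^ k) * (\<integral>\<^sup>+ t. lp_test M (p k) \<theta> B (g x) t * g x t \<partial>M)"
      by (intro mult_left_mono test x) auto
    also have "\<dots> = (\<integral>\<^sup>+ t. ennreal (\<theta> ^ k) * (lp_test M (p k) \<theta> B (g x) t * g x t) \<partial>M)"
      by (rule nn_integral_cmult[symmetric]) (intro borel_measurable_times_ennreal tx gx')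
    also have "\<dots> \<le> (\<integral>\<^sup>+ t. mixed_norm_aux M (\<lambda>_. 1) k (\<lambda>x. T x * F x * G x) (x(k := t)) \<partial>M)"
    proof (rule nn_integral_mono)
      fix t
      have "ennreal (\<theta> ^ k) * (lp_test M (p k) \<theta> B (g x) t * g x t)
          = T (x(k := t)) * (ennreal (\<theta> ^ k) * mixed_norm_aux M p k G (x(k := t)))"
        unfolding Tupd by (simp add: g_def mult_ac)
      also have "\<dots> \<le> T (x(k := t)) * mixed_norm_aux M (\<lambda>_. 1) k (\<lambda>x. F x * G x) (x(k := t))"
        by (intro mult_left_mono FG upd x) auto
      also have "\<dots> = mixed_norm_aux M (\<lambda>_. 1) k (\<lambda>x. T x * (F x * G x)) (x(k := t))"
        by (rule mixed_norm_aux_cmult[OF _ _ Tfin Tdep k(2) upd[OF x], symmetric]) (use F meas in auto)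
      finally show "ennreal (\<theta> ^ k) * (lp_test M (p k) \<theta> B (g x) t * g x t)
          \<le> mixed_norm_aux M (\<lambda>_. 1) k (\<lambda>x. T x * F x * G x) (x(k := t))"
        by (simp add: mult.assoc)
    qed
    finally show ?thesis by (simp add: lp_step_eq lp_norm_one)
  qed
  show ?case
    using norm pair F by (intro bexI[of _ "\<lambda>x. T x * F x"]) auto
qed

lemma mixed_norm_test_function:
  assumes "\<And>i. i < n \<Longrightarrow> 1 < p i" "B \<in> sets M" "emeasure M B < top"
    and meas: "G \<in> borel_measurable (prod_power n)"
    and "\<And>x. x \<in> space (prod_power n) \<Longrightarrow> G x \<le> c" "c < top"
      "\<And>x i. x \<in> space (prod_power n) \<Longrightarrow> i < n \<Longrightarrow> x i \<notin> B \<Longrightarrow> G x = 0"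
    and "0 < \<theta>" "\<theta> < 1"
  obtains F where "F \<in> borel_measurable (prod_power n)"
    "mixed_norm M n (\<lambda>i. conj_exp (p i)) F \<le> 1"
    "ennreal (\<theta> ^ n) * mixed_norm M n p G \<le> (\<integral>\<^sup>+ x. F x * G x \<partial>prod_power n)"
proof -
  obtain F where F: "F \<in> borel_measurable (prod_power n)"
    and *: "\<forall>x\<in>space (prod_power n). mixed_norm_aux M (\<lambda>i. conj_exp (p i)) n F x \<le> 1 \<and>
      ennreal (\<theta> ^ n) * mixed_norm_aux M p n G x \<le> mixed_norm_aux M (\<lambda>_. 1) n (\<lambda>x. F x * G x) x"
  proof -
    have "\<exists>F\<in>borel_measurable (prod_power n). \<forall>x\<in>space (prod_power n). mixed_norm_aux M (\<lambda>i. conj_exp (p i)) n F x \<le> 1 \<and>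
      ennreal (\<theta> ^ n) * mixed_norm_aux M p n G x \<le> mixed_norm_aux M (\<lambda>_. 1) n (\<lambda>x. F x * G x) x"
      by (rule mixed_norm_aux_test_function[where n = n and B = B and c = c]) (use assms in auto)
    with that show thesis by blast
  qed
  have FG: "(\<lambda>x. F x * G x) \<in> borel_measurable (prod_power n)"
    using F meas by simp
  show ?thesis
    using bspec[OF * undefined_in_space] F mixed_norm_one[OF FG]
    by (intro that[of F]) (simp_all add: mixed_norm_def)
qed

end

section \<open>Scaling of mixed norms\<close>

lemma lp_norm_lborel_scale:
  assumes "1 \<le> p" "0 < r" and [measurable]: "f \<in> borel_measurable borel"
  shows "lp_norm lborel p (\<lambda>t. f (t / r)) = ennreal (r powr recip p) * lp_norm lborel p f"
  using assms(1)
proof (cases rule: exponent_cases)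
  case infinite
  have "(AE t in lborel. f (t / r) \<le> c) \<longleftrightarrow> (AE t in lborel. f t \<le> c)" for c
  proof -
    \<comment> \<open>The set where f exceeds c is dilated, so its measure is multiplied by r;
      whether it is null does not change.\<close>
    have eq: "(\<integral>\<^sup>+ t. indicator {t. c < f t} (t / r) \<partial>lborel) = ennreal r * (\<integral>\<^sup>+ t. indicator {t. c < f t} t \<partial>lborel)"
      using assms(2) by (subst nn_integral_real_affine[where c = r and t = 0]) (auto simp: abs_of_pos)
    have "(AE t in lborel. f (t / r) \<le> c) \<longleftrightarrow> (\<integral>\<^sup>+ t. indicator {t. c < f t} (t / r) \<partial>lborel) = 0"
      by (subst nn_integral_0_iff_AE) (auto simp: indicator_def not_less intro!: AE_cong)
    also have "\<dots> \<longleftrightarrow> (\<integral>\<^sup>+ t. indicator {t. c < f t} t \<partial>lborel) = 0"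
      unfolding eq using assms(2) by (simp add: ennreal_eq_0_iff)
    also have "\<dots> \<longleftrightarrow> (AE t in lborel. f t \<le> c)"
      by (subst nn_integral_0_iff_AE) (auto simp: indicator_def not_less intro!: AE_cong)
    finally show ?thesis .
  qed
  with infinite assms(2) show ?thesis
    by (simp add: lp_norm_infinite ess_sup_enn_def recip_def)
next
  case (real a)
  have "(\<integral>\<^sup>+ t. enn_pow (f (t / r)) a \<partial>lborel) = ennreal r * (\<integral>\<^sup>+ t. enn_pow (f t) a \<partial>lborel)"
    using assms(2) by (subst nn_integral_real_affine[where c = r and t = 0]) (auto simp: abs_of_pos)
  with real assms(2) show ?thesis
    by (simp add: lp_norm_real enn_pow_mult enn_pow_ennreal recip_def)
qed

interpretation lborel: full_sigma_finite "lborel :: real measure"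
  by unfold_locales (auto simp: full_sigma_finite_axioms_def)

definition scale_point :: "nat \<Rightarrow> real \<Rightarrow> (nat \<Rightarrow> real) \<Rightarrow> nat \<Rightarrow> real" where
  "scale_point n r x = (\<lambda>i\<in>{..<n}. x i / r)"

lemma scale_point_space [simp]: "scale_point n r x \<in> space (Rn n)"
  by (auto simp: Rn_def space_PiM scale_point_def)

lemma measurable_scale_point [measurable]: "scale_point n r \<in> Rn n \<rightarrow>\<^sub>M Rn n"
  unfolding Rn_def scale_point_def[abs_def] by measurable

lemma mixed_norm_lborel_scale:
  assumes p: "\<And>i. i < n \<Longrightarrow> 1 \<le> p i" and r: "0 < r" and F: "F \<in> borel_measurable (Rn n)"
  shows "mixed_norm lborel n p (\<lambda>x. F (scale_point n r x))
    = ennreal (r powr (\<Sum>i<n. recip (p i))) * mixed_norm lborel n p F"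
proof -
  have F': "F \<in> borel_measurable (lborel.prod_power n)" using F by (simp add: Rn_def)
  have aux: "mixed_norm_aux lborel p k (\<lambda>x. F (scale_point n r x)) x
      = ennreal (r powr (\<Sum>i<k. recip (p i))) * mixed_norm_aux lborel p k F (scale_point n r x)"
    if "k \<le> n" "x \<in> space (lborel.prod_power n)" for k x
    using that
  proof (induction k arbitrary: x)
    case (Suc k)
    have k: "k < n" "k \<le> n" using Suc.prems by auto
    have x': "scale_point n r x \<in> space (lborel.prod_power n)"
      by (auto simp: space_PiM scale_point_def)
    have upd: "scale_point n r (x(k := t)) = (scale_point n r x)(k := t / r)" for t
      using k by (auto simp: scale_point_def restrict_def fun_eq_iff)
    have meas: "(\<lambda>t. mixed_norm_aux lborel p k F ((scale_point n r x)(k := t))) \<in> borel_measurable lborel"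
      by (rule lborel.measurable_mixed_norm_aux_upd[OF p F' k(1) x'])
    have meas': "(\<lambda>t. mixed_norm_aux lborel p k F ((scale_point n r x)(k := t / r))) \<in> borel_measurable lborel"
      using measurable_compose[of "\<lambda>t. t / r" borel borel, OF _ meas[simplified]] by simp
    have "mixed_norm_aux lborel p (Suc k) (\<lambda>x. F (scale_point n r x)) x
        = lp_norm lborel (p k) (\<lambda>t. ennreal (r powr (\<Sum>i<k. recip (p i))) *
            mixed_norm_aux lborel p k F ((scale_point n r x)(k := t / r)))"
      unfolding mixed_norm_aux.simps lp_step_eq
    proof (intro lp_norm_cong p k)
      fix t
      have "mixed_norm_aux lborel p k (\<lambda>x. F (scale_point n r x)) (x(k := t)) =
          ennreal (r powr (\<Sum>i<k. recip (p i))) * mixed_norm_aux lborel p k F (scale_point n r (x(k := t)))"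
        by (rule Suc.IH[OF k(2) lborel.space_upd[OF Suc.prems(2) k(1)]])
      then show "mixed_norm_aux lborel p k (\<lambda>x. F (scale_point n r x)) (x(k := t)) =
          ennreal (r powr (\<Sum>i<k. recip (p i))) * mixed_norm_aux lborel p k F ((scale_point n r x)(k := t / r))"
        by (simp only: upd)
    qed
    also have "\<dots> = ennreal (r powr (\<Sum>i<k. recip (p i))) *
            lp_norm lborel (p k) (\<lambda>t. mixed_norm_aux lborel p k F ((scale_point n r x)(k := t / r)))"
      by (intro lp_norm_cmult p k meas') auto
    also have "lp_norm lborel (p k) (\<lambda>t. mixed_norm_aux lborel p k F ((scale_point n r x)(k := t / r)))
        = ennreal (r powr recip (p k)) * lp_norm lborel (p k) (\<lambda>t. mixed_norm_aux lborel p k F ((scale_point n r x)(k := t)))"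
      by (rule lp_norm_lborel_scale[OF p[OF k(1)] r meas[simplified]])
    finally show ?case
      using r by (simp add: lp_step_eq powr_add ennreal_mult mult.assoc)
  qed (use r in simp)
  \<comment> \<open>\<open>scale_point\<close> does not fix the point at which
    \<open>mixed_norm\<close> is evaluated, but it alters only the entries below n, which no longer
    matter after n steps.\<close>
  have "scale_point n r (\<lambda>_. undefined) i = undefined" if "n \<le> i" for i
    using that by (simp add: scale_point_def)
  then have "mixed_norm_aux lborel p n F (scale_point n r (\<lambda>_. undefined)) = mixed_norm lborel n p F"
    unfolding mixed_norm_def by (intro mixed_norm_aux_depends) auto
  with aux[OF order_refl lborel.undefined_in_space] show ?thesis
    by (simp add: mixed_norm_def)
qed

text \<open>This is the mixed scaling law with all exponents 1, where the reciprocals add up to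
  n.\<close>

lemma nn_integral_scale:
  assumes r: "0 < r" and F[measurable]: "F \<in> borel_measurable (Rn n)"
  shows "(\<integral>\<^sup>+ x. F (scale_point n r x) \<partial>Rn n) = ennreal (r ^ n) * (\<integral>\<^sup>+ x. F x \<partial>Rn n)"
proof -
  have "(\<lambda>x. F (scale_point n r x)) \<in> borel_measurable (Rn n)" by measurable
  then show ?thesis
    using mixed_norm_lborel_scale[of n "\<lambda>_. 1" r F] lborel.mixed_norm_one[of F n]
      lborel.mixed_norm_one[of "\<lambda>x. F (scale_point n r x)" n] assms
    by (simp add: Rn_def recip_def powr_realpow)
qed

section \<open>Amalgam norms\<close>

interpretation ints: full_sigma_finite "count_space (UNIV :: int set)"
  by (rule full_sigma_finite.intro) (auto simp: full_sigma_finite_axioms_def intro: sigma_finite_measure_count_space)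

abbreviation cells :: "nat \<Rightarrow> (nat \<Rightarrow> int) set" where
  "cells n \<equiv> PiE {..<n} (\<lambda>_. UNIV)"

lemma countable_cells: "countable (cells n)"
  by (intro countable_PiE) auto

lemma ints_prod_power: "ints.prod_power n = count_space (cells n)"
  by (rule count_space_PiM_finite) auto

lemma measurable_ints_prod_power [simp]: "f \<in> borel_measurable (ints.prod_power n)"
  by (simp add: ints_prod_power)

lemma space_Rn: "space (Rn n) = PiE {..<n} (\<lambda>_. UNIV)"
  by (simp add: Rn_def space_PiM)

lemma measurable_Rn_component [measurable]: "i < n \<Longrightarrow> (\<lambda>x. x i) \<in> borel_measurable (Rn n)"
  unfolding Rn_def using measurable_component_singleton[of i "{..<n}" "\<lambda>_. lborel"] by simp

lemma pred_cube [measurable]: "Measurable.pred (Rn n) (\<lambda>x. x \<in> cube n r k)"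
proof -
  have "Measurable.pred (Rn n) (\<lambda>x. \<forall>i\<in>{..<n}. r * of_int (k i) \<le> x i \<and> x i < r * (of_int (k i) + 1))"
    by (intro pred_intros_finite) auto
  then show ?thesis by (simp add: cube_def Ball_def)
qed

lemma measurable_indicator_cube [measurable]:
  "(\<lambda>x. indicator (cube n r k) x :: ennreal) \<in> borel_measurable (Rn n)"
  unfolding indicator_def by measurable

definition cell :: "nat \<Rightarrow> (nat \<Rightarrow> real) \<Rightarrow> nat \<Rightarrow> int" where
  "cell n x = (\<lambda>i\<in>{..<n}. \<lfloor>x i\<rfloor>)"

lemma cell_in_cells [simp]: "cell n x \<in> cells n"
  by (simp add: cell_def)

text \<open>\<open>cube\<close> looks only at the entries of k below n. Over the extensional indices
  in \<open>cells n\<close> the unit cubes partition the space, and \<open>cell\<close> names the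
  one that contains x.\<close>

lemma mem_cube_iff: "k \<in> cells n \<Longrightarrow> x \<in> cube n 1 k \<longleftrightarrow> cell n x = k"
  by (auto simp: cube_def cell_def fun_eq_iff restrict_def floor_eq_iff PiE_def extensional_def) 

lemma measurable_cell: "cell n \<in> Rn n \<rightarrow>\<^sub>M count_space (cells n)"
proof -
  have "cell n -` {k} \<inter> space (Rn n) = {x \<in> space (Rn n). x \<in> cube n 1 k}" if "k \<in> cells n" for k
    using that by (auto simp: mem_cube_iff)
  then show ?thesis
    by (subst measurable_count_space_eq_countable) (auto simp: countable_cells)
qed

text \<open>A different function may be chosen on each cube because there are only countably many
  cubes.\<close>

lemma measurable_glue:
  assumes "\<And>k. k \<in> cells n \<Longrightarrow> H k \<in> Rn n \<rightarrow>\<^sub>M N"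
  shows "(\<lambda>x. H (cell n x) x) \<in> Rn n \<rightarrow>\<^sub>M N"
  by (rule measurable_compose_countable'[OF assms measurable_cell countable_cells])

text \<open>For fixed x the sum over the cubes has at most one nonzero term, that of
  \<open>cell n x\<close>; countability allows sum and integral to be exchanged.\<close>

lemma nn_integral_glue:
  assumes H: "\<And>k. k \<in> cells n \<Longrightarrow> H k \<in> borel_measurable (Rn n)"
  shows "(\<integral>\<^sup>+ x. H (cell n x) x \<partial>Rn n)
    = (\<integral>\<^sup>+ k. (\<integral>\<^sup>+ x. H k x * indicator (cube n 1 k) x \<partial>Rn n) \<partial>count_space (cells n))"
proof -
  have "(\<integral>\<^sup>+ k. H k x * indicator (cube n 1 k) x \<partial>count_space (cells n)) = H (cell n x) x" for x
  proof -
    have "(\<integral>\<^sup>+ k. H k x * indicator (cube n 1 k) x \<partial>count_space (cells n))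
        = (\<integral>\<^sup>+ k. H k x * indicator {cell n x} k \<partial>count_space (cells n))"
      by (intro nn_integral_cong) (auto simp: mem_cube_iff indicator_def)
    also have "\<dots> = H (cell n x) x"
      by (subst nn_integral_indicator_singleton) auto
    finally show ?thesis .
  qed
  then have "(\<integral>\<^sup>+ x. H (cell n x) x \<partial>Rn n)
      = (\<integral>\<^sup>+ x. (\<integral>\<^sup>+ k. H k x * indicator (cube n 1 k) x \<partial>count_space (cells n)) \<partial>Rn n)"
    by simp
  also have "\<dots> = (\<integral>\<^sup>+ k. (\<integral>\<^sup>+ x. H k x * indicator (cube n 1 k) x \<partial>Rn n) \<partial>count_space (cells n))"
    using H by (intro nn_integral_count_space_nn_integral countable_cells) auto
  finally show ?thesis .
qed

text \<open>The norm at scale 1, for functions with values in \<open>ennreal\<close>: moduli, test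
  functions and truncations are all of this type, and the other scales are reduced to this one by
  \<open>amalg_r_eq\<close>.\<close>

definition amalg_norm :: "nat \<Rightarrow> (nat \<Rightarrow> ereal) \<Rightarrow> (nat \<Rightarrow> ereal) \<Rightarrow> ((nat \<Rightarrow> real) \<Rightarrow> ennreal) \<Rightarrow> ennreal" where
  "amalg_norm n p s F = mixed_norm (count_space UNIV) n s
     (\<lambda>k. mixed_norm lborel n p (\<lambda>x. F x * indicator (cube n 1 k) x))"

lemma amalg_r_1_eq: "amalg_r n p s 1 f = amalg_norm n p s (\<lambda>x. ennreal (norm (f x)))"
proof -
  have "ennreal (norm (f x * of_real (indicator A x))) = ennreal (norm (f x)) * indicator A x" for A x
    by (auto simp: indicator_def)
  then show ?thesis
    by (simp add: amalg_r_def amalg_norm_def lmixed_norm_def Lmixed_norm_def)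
qed

lemma measurable_Rn_iff: "F \<in> borel_measurable (lborel.prod_power n) \<longleftrightarrow> F \<in> borel_measurable (Rn n)"
  by (simp add: Rn_def)

context
  fixes n :: nat and p s :: "nat \<Rightarrow> ereal"
  assumes p: "\<And>i. i < n \<Longrightarrow> 1 \<le> p i" and s: "\<And>i. i < n \<Longrightarrow> 1 \<le> s i"
begin

lemma amalg_norm_mono:
  assumes "\<And>x. x \<in> space (Rn n) \<Longrightarrow> F x \<le> G x"
  shows "amalg_norm n p s F \<le> amalg_norm n p s G"
  unfolding amalg_norm_def using assms
  by (intro ints.mixed_norm_mono lborel.mixed_norm_mono mult_right_mono p s) (auto simp: Rn_def)


lemma amalg_norm_cmult:
  assumes [measurable]: "F \<in> borel_measurable (Rn n)" and c: "c < top"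
  shows "amalg_norm n p s (\<lambda>x. c * F x) = c * amalg_norm n p s F"
proof -
  have "mixed_norm lborel n p (\<lambda>x. c * F x * indicator (cube n 1 k) x)
      = c * mixed_norm lborel n p (\<lambda>x. F x * indicator (cube n 1 k) x)" for k
    unfolding mult.assoc using p c by (intro lborel.mixed_norm_cmult) (simp_all add: measurable_Rn_iff)
  then show ?thesis
    unfolding amalg_norm_def using s c by (simp add: ints.mixed_norm_cmult)
qed

lemma amalg_norm_SUP:
  assumes [measurable]: "\<And>m::nat. F m \<in> borel_measurable (Rn n)"
    and inc: "\<And>m x. x \<in> space (Rn n) \<Longrightarrow> F m x \<le> F (Suc m) x"
  shows "amalg_norm n p s (\<lambda>x. SUP m. F m x) = (SUP m. amalg_norm n p s (F m))"
proof -
  have "mixed_norm lborel n p (\<lambda>x. (SUP m. F m x) * indicator (cube n 1 k) x)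
      = (SUP m. mixed_norm lborel n p (\<lambda>x. F m x * indicator (cube n 1 k) x))" for k
    unfolding SUP_mult_right_ennreal using p inc
    by (intro lborel.mixed_norm_SUP) (auto simp: measurable_Rn_iff Rn_def[symmetric] intro: mult_right_mono)
  moreover have "mixed_norm lborel n p (\<lambda>x. F m x * indicator (cube n 1 k) x)
      \<le> mixed_norm lborel n p (\<lambda>x. F (Suc m) x * indicator (cube n 1 k) x)" for m k
    using p inc by (intro lborel.mixed_norm_mono) (auto simp: Rn_def[symmetric] intro: mult_right_mono)
  ultimately show ?thesis
    unfolding amalg_norm_def using s by (simp add: ints.mixed_norm_SUP)
qed

lemma amalg_norm_eq_0_iff:
  assumes [measurable]: "F \<in> borel_measurable (Rn n)"
  shows "amalg_norm n p s F = 0 \<longleftrightarrow> (AE x in Rn n. F x = 0)"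
proof -
  have "amalg_norm n p s F = 0 \<longleftrightarrow> (\<forall>k\<in>cells n. AE x in Rn n. F x * indicator (cube n 1 k) x = 0)"
  proof -
    have "mixed_norm lborel n p (\<lambda>x. F x * indicator (cube n 1 k) x) = 0 \<longleftrightarrow>
        (AE x in Rn n. F x * indicator (cube n 1 k) x = 0)" for k
      unfolding Rn_def by (intro lborel.mixed_norm_eq_0_iff p) (simp_all add: measurable_Rn_iff)
    moreover have "amalg_norm n p s F = 0 \<longleftrightarrow>
        (AE k in ints.prod_power n. mixed_norm lborel n p (\<lambda>x. F x * indicator (cube n 1 k) x) = 0)"
      unfolding amalg_norm_def by (intro ints.mixed_norm_eq_0_iff s) simp_all
    ultimately show ?thesis
      by (simp only: ints_prod_power AE_count_space)
  qed
  also have "\<dots> \<longleftrightarrow> (AE x in Rn n. \<forall>k\<in>cells n. F x * indicator (cube n 1 k) x = 0)"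
    by (rule AE_ball_countable[symmetric, OF countable_cells])
  also have "\<dots> \<longleftrightarrow> (AE x in Rn n. F x = 0)"
  proof (intro AE_cong)
    fix x
    have "x \<in> cube n 1 (cell n x)"
      by (simp only: mem_cube_iff[OF cell_in_cells])
    then show "(\<forall>k\<in>cells n. F x * indicator (cube n 1 k) x = 0) \<longleftrightarrow> F x = 0"
      using bspec[of "cells n" "\<lambda>k. F x * indicator (cube n 1 k) x = 0" "cell n x", OF _ cell_in_cells]
      by auto
  qed
  finally show ?thesis .
qed

text \<open>Dominated convergence is applied twice: inside each cube on which \<open>H\<close> has
  finite norm, then to the sequence of norms over the cubes.\<close>

lemma amalg_norm_dominated:
  assumes fin: "\<And>i. i < n \<Longrightarrow> p i \<noteq> \<infinity>" "\<And>i. i < n \<Longrightarrow> s i \<noteq> \<infinity>"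
    and [measurable]: "\<And>m::nat. F m \<in> borel_measurable (Rn n)" "H \<in> borel_measurable (Rn n)"
    and le: "\<And>m x. x \<in> space (Rn n) \<Longrightarrow> F m x \<le> H x"
    and lim: "\<And>x. x \<in> space (Rn n) \<Longrightarrow> H x < top \<Longrightarrow> (\<lambda>m. F m x) \<longlonglongrightarrow> 0"
    and H: "amalg_norm n p s H < top"
  shows "(\<lambda>m. amalg_norm n p s (F m)) \<longlonglongrightarrow> 0"
  unfolding amalg_norm_def
proof (rule ints.mixed_norm_dominated[where H = "\<lambda>k. mixed_norm lborel n p (\<lambda>x. H x * indicator (cube n 1 k) x)"])
  fix k assume *: "mixed_norm lborel n p (\<lambda>x. H x * indicator (cube n 1 k) x) < top"
  show "(\<lambda>m. mixed_norm lborel n p (\<lambda>x. F m x * indicator (cube n 1 k) x)) \<longlonglongrightarrow> 0"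
  proof (rule lborel.mixed_norm_dominated[where H = "\<lambda>x. H x * indicator (cube n 1 k) x"])
    fix x assume x: "x \<in> space (lborel.prod_power n)" "H x * indicator (cube n 1 k) x < top"
    show "(\<lambda>m. F m x * indicator (cube n 1 k) x) \<longlonglongrightarrow> 0"
      using lim[of x] x by (cases "x \<in> cube n 1 k") (auto simp: Rn_def)
  qed (use p fin le * in \<open>auto simp: measurable_Rn_iff Rn_def[symmetric] intro: mult_right_mono\<close>)
next
  fix m k
  show "mixed_norm lborel n p (\<lambda>x. F m x * indicator (cube n 1 k) x)
      \<le> mixed_norm lborel n p (\<lambda>x. H x * indicator (cube n 1 k) x)"
    using p le by (intro lborel.mixed_norm_mono) (auto simp: Rn_def[symmetric] intro: mult_right_mono)
qed (use s fin H in \<open>auto simp: amalg_norm_def\<close>)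

lemma amalg_norm_bounded_support:
  assumes K: "\<And>x. x \<in> space (Rn n) \<Longrightarrow> F x \<le> ennreal K"
    "\<And>x i. x \<in> space (Rn n) \<Longrightarrow> i < n \<Longrightarrow> K < \<bar>x i\<bar> \<Longrightarrow> F x = 0"
  shows "amalg_norm n p s F < top"
proof -
  have C: "mixed_norm lborel n p F < top"
    using K by (intro lborel.mixed_norm_bounded_support[where B = "{-K..K}" and c = "ennreal K"] p)
      (auto simp: Rn_def[symmetric] abs_le_iff not_le emeasure_lborel_Icc_eq)
  show ?thesis
    unfolding amalg_norm_def
  proof (rule ints.mixed_norm_bounded_support[where B = "{- \<lceil>\<bar>K\<bar>\<rceil> - 1..\<lceil>\<bar>K\<bar>\<rceil>}"])
    fix k
    show "mixed_norm lborel n p (\<lambda>x. F x * indicator (cube n 1 k) x) \<le> mixed_norm lborel n p F"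
      by (intro lborel.mixed_norm_mono p) (auto simp: indicator_def)
    \<comment> \<open>\<open>cube n 1 k\<close> spans [k i, k i + 1) in direction i, so an index
      outside this finite interval places the whole cube where |x i| exceeds K and \<open>F\<close>
      vanishes.\<close>
    fix i assume i: "i < n" "k i \<notin> {- \<lceil>\<bar>K\<bar>\<rceil> - 1..\<lceil>\<bar>K\<bar>\<rceil>}"
    have "F x * indicator (cube n 1 k) x = 0" if x: "x \<in> space (Rn n)" for x
    proof (cases "x \<in> cube n 1 k")
      case True
      then have "of_int (k i) \<le> x i" "x i < of_int (k i) + 1"
        using i by (auto simp: cube_def)
      then have "K < \<bar>x i\<bar>"
        using i(2) by (auto simp: not_le) linarith+
      then show ?thesis using K(2)[OF x i(1)] by simp
    qed simp
    then have "mixed_norm lborel n p (\<lambda>x. F x * indicator (cube n 1 k) x) = mixed_norm lborel n p (\<lambda>x :: nat \<Rightarrow> real. 0)"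
      by (intro lborel.mixed_norm_cong p) (auto simp: Rn_def)
    also have "\<dots> = 0"
      by (subst lborel.mixed_norm_eq_0_iff) (auto intro: p)
    finally show "mixed_norm lborel n p (\<lambda>x. F x * indicator (cube n 1 k) x) = 0" .
  qed (use s C in \<open>auto simp: of_nat_less_top\<close>)
qed

lemma amalg_norm_Holder:
  assumes [measurable]: "F \<in> borel_measurable (Rn n)" "G \<in> borel_measurable (Rn n)"
  shows "(\<integral>\<^sup>+ x. F x * G x \<partial>Rn n)
    \<le> amalg_norm n p s F * amalg_norm n (\<lambda>i. conj_exp (p i)) (\<lambda>i. conj_exp (s i)) G"
proof -
  define a where "a k = mixed_norm lborel n p (\<lambda>x. F x * indicator (cube n 1 k) x)" for k
  define b where "b k = mixed_norm lborel n (\<lambda>i. conj_exp (p i)) (\<lambda>x. G x * indicator (cube n 1 k) x)" for k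
  have "(\<integral>\<^sup>+ x. F x * G x \<partial>Rn n)
      = (\<integral>\<^sup>+ k. (\<integral>\<^sup>+ x. F x * G x * indicator (cube n 1 k) x \<partial>Rn n) \<partial>count_space (cells n))"
    by (rule nn_integral_glue[of n "\<lambda>_ x. F x * G x"]) simp
  also have "\<dots> \<le> (\<integral>\<^sup>+ k. a k * b k \<partial>count_space (cells n))"
  proof (rule nn_integral_mono)
    fix k
    have "(\<integral>\<^sup>+ x. F x * G x * indicator (cube n 1 k) x \<partial>Rn n)
        = (\<integral>\<^sup>+ x. (F x * indicator (cube n 1 k) x) * (G x * indicator (cube n 1 k) x) \<partial>Rn n)"
      by (intro nn_integral_cong) (auto simp: indicator_def)
    also have "\<dots> \<le> a k * b k"
      unfolding a_def b_def Rn_def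
      by (intro lborel.mixed_norm_Holder p) (simp_all add: measurable_Rn_iff)
    finally show "(\<integral>\<^sup>+ x. F x * G x * indicator (cube n 1 k) x \<partial>Rn n) \<le> a k * b k" .
  qed
  also have "\<dots> \<le> mixed_norm (count_space UNIV) n s a * mixed_norm (count_space UNIV) n (\<lambda>i. conj_exp (s i)) b"
    using ints.mixed_norm_Holder[of n s a b] s by (simp add: ints_prod_power)
  finally show ?thesis
    unfolding amalg_norm_def a_def[abs_def] b_def[abs_def] .
qed

end

section \<open>Truncation and the duality formula for amalgam norms\<close>

definition truncate :: "nat \<Rightarrow> nat \<Rightarrow> ((nat \<Rightarrow> real) \<Rightarrow> ennreal) \<Rightarrow> (nat \<Rightarrow> real) \<Rightarrow> ennreal" where
  "truncate n m F x = (if \<forall>i\<in>{..<n}. \<bar>x i\<bar> \<le> real m then min (F x) (of_nat m) else 0)"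

lemma pred_box [measurable]: "Measurable.pred (Rn n) (\<lambda>x. \<forall>i\<in>{..<n}. \<bar>x i\<bar> \<le> R)"
  by (intro pred_intros_finite) auto

lemma measurable_truncate [measurable]:
  assumes [measurable]: "F \<in> borel_measurable (Rn n)"
  shows "truncate n m F \<in> borel_measurable (Rn n)"
  unfolding truncate_def[abs_def] by measurable

lemma truncate_le: "truncate n m F x \<le> F x"
  by (simp add: truncate_def)

lemma truncate_outside: "i < n \<Longrightarrow> real m < \<bar>x i\<bar> \<Longrightarrow> truncate n m F x = 0"
  by (force simp: truncate_def)

lemma truncate_mono:
  assumes "m \<le> m'"
  shows "truncate n m F x \<le> truncate n m' F x"
proof (cases "\<forall>i\<in>{..<n}. \<bar>x i\<bar> \<le> real m")
  case True
  with assms have "\<forall>i\<in>{..<n}. \<bar>x i\<bar> \<le> real m'" by force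
  with assms show ?thesis by (simp add: truncate_def min.coboundedI2)
next
  case False
  then have "truncate n m F x = 0" by (auto simp: truncate_def)
  then show ?thesis by simp
qed

lemma SUP_truncate: "(SUP m. truncate n m F x) = F x"
proof (rule antisym)
  show "(SUP m. truncate n m F x) \<le> F x"
    by (intro SUP_least truncate_le)
  obtain N :: nat where N: "\<And>i. i \<in> {..<n} \<Longrightarrow> \<bar>x i\<bar> \<le> real N"
  proof -
    obtain N where "(\<Sum>i<n. \<bar>x i\<bar>) \<le> real N" using real_arch_simple by blast
    moreover have "\<bar>x i\<bar> \<le> (\<Sum>i<n. \<bar>x i\<bar>)" if "i \<in> {..<n}" for i
      using that by (intro member_le_sum) auto
    ultimately show thesis by (intro that[of N]) force
  qed
  have "F x = min (F x) (SUP m. of_nat m)"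
    by (simp add: ennreal_SUP_of_nat_eq_top)
  also have "\<dots> = (SUP m. min (F x) (of_nat m))"
    by (simp add: inf_min[symmetric] inf_SUP)
  also have "\<dots> \<le> (SUP m. truncate n m F x)"
  proof (rule SUP_mono)
    fix m :: nat
    \<comment> \<open>The level m is raised to max m N, since the box of radius N is known to
      contain x.\<close>
    have "min (F x) (of_nat m) \<le> min (F x) (of_nat (max m N))"
      by (intro min.mono) auto
    also have "\<dots> = truncate n (max m N) F x"
      using N by (fastforce simp: truncate_def)
    finally show "\<exists>m'\<in>UNIV. min (F x) (of_nat m) \<le> truncate n m' F x" by blast
  qed
  finally show "F x \<le> (SUP m. truncate n m F x)" .
qed

text \<open>One constant bounds both height and support. Such functions have finite amalgam norm for
  all exponents at least 1 and can be integrated against every locally integrable function, so the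
  duality formula and the representation of functionals can share them as test class.\<close>

definition tame :: "nat \<Rightarrow> ((nat \<Rightarrow> real) \<Rightarrow> ennreal) \<Rightarrow> bool" where
  "tame n F \<longleftrightarrow> F \<in> borel_measurable (Rn n) \<and>
     (\<exists>K::real. \<forall>x\<in>space (Rn n). F x \<le> ennreal K \<and> (\<forall>i<n. K < \<bar>x i\<bar> \<longrightarrow> F x = 0))"

lemma tame_truncate: "F \<in> borel_measurable (Rn n) \<Longrightarrow> tame n (truncate n m F)"
  unfolding tame_def
  by (intro conjI measurable_truncate exI[of _ "real m"]) (auto simp: truncate_outside, auto simp: truncate_def ennreal_of_nat_eq_real_of_nat)

lemma amalg_norm_tame:
  assumes "\<And>i. i < n \<Longrightarrow> 1 \<le> p i" "\<And>i. i < n \<Longrightarrow> 1 \<le> s i" "tame n F"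
  shows "amalg_norm n p s F < top"
  using assms(3) unfolding tame_def by (auto intro: amalg_norm_bounded_support[OF assms(1,2)])

text \<open>Near-extremal functions \<open>F k\<close> on the single cubes are combined with a
  near-extremal sequence \<open>b\<close> for the norms \<open>a k\<close> over the cubes. On cube k
  the result is \<open>b k * F k\<close>, selected by \<open>cell\<close>; each of the two
  ingredients costs \<theta> ^ n.\<close>

lemma amalg_norm_near_extremal:
  assumes p: "\<And>i. i < n \<Longrightarrow> 1 < p i" and s: "\<And>i. i < n \<Longrightarrow> 1 < s i" and "tame n G"
    and \<theta>: "0 < \<theta>" "\<theta> < 1"
  obtains F where "F \<in> borel_measurable (Rn n)"
    "amalg_norm n (\<lambda>i. conj_exp (p i)) (\<lambda>i. conj_exp (s i)) F \<le> 1"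
    "ennreal (\<theta> ^ (2 * n)) * amalg_norm n p s G \<le> (\<integral>\<^sup>+ x. F x * G x \<partial>Rn n)"
proof -
  have p1: "\<And>i. i < n \<Longrightarrow> 1 \<le> p i" and s1: "\<And>i. i < n \<Longrightarrow> 1 \<le> s i"
    using p s by (auto intro: less_imp_le)
  have q1: "\<And>i. i < n \<Longrightarrow> 1 \<le> conj_exp (p i)" and t1: "\<And>i. i < n \<Longrightarrow> 1 \<le> conj_exp (s i)"
    by (auto intro!: conj_exp_ge_1 p1 s1)
  obtain K where G[measurable]: "G \<in> borel_measurable (Rn n)"
    and K: "\<And>x. x \<in> space (Rn n) \<Longrightarrow> G x \<le> ennreal K"
      "\<And>x i. x \<in> space (Rn n) \<Longrightarrow> i < n \<Longrightarrow> K < \<bar>x i\<bar> \<Longrightarrow> G x = 0"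
    using \<open>tame n G\<close> unfolding tame_def by auto
  define G' where "G' k = (\<lambda>x. G x * indicator (cube n 1 k) x)" for k
  define a where "a k = mixed_norm lborel n p (G' k)" for k
  have "\<exists>F. F \<in> borel_measurable (Rn n) \<and> mixed_norm lborel n (\<lambda>i. conj_exp (p i)) F \<le> 1 \<and>
      ennreal (\<theta> ^ n) * a k \<le> (\<integral>\<^sup>+ x. F x * G' k x \<partial>Rn n)" for k
  proof -
    have G': "G' k \<in> borel_measurable (lborel.prod_power n)"
      by (simp add: measurable_Rn_iff G'_def)
    have le: "G' k x \<le> ennreal K" if "x \<in> space (lborel.prod_power n)" for x
      using that K(1)[of x] by (auto simp: G'_def Rn_def[symmetric] indicator_def)
    have supp: "G' k x = 0" if "x \<in> space (lborel.prod_power n)" "i < n" "x i \<notin> {-K..K}" for x i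
    proof -
      have "K < \<bar>x i\<bar>" using that(3) by auto
      then show ?thesis using that K(2)[of x i] by (simp add: G'_def Rn_def)
    qed
    show ?thesis
    proof (rule lborel.mixed_norm_test_function[where n = n and p = p and B = "{-K..K}" and G = "G' k"
          and c = "ennreal K" and \<theta> = \<theta>])
      show "emeasure lborel {-K..K} < top"
        by (simp add: emeasure_lborel_Icc_eq)
      fix F
      assume "F \<in> borel_measurable (lborel.prod_power n)"
        "mixed_norm lborel n (\<lambda>i. conj_exp (p i)) F \<le> 1"
        "ennreal (\<theta> ^ n) * mixed_norm lborel n p (G' k) \<le> (\<integral>\<^sup>+ x. F x * G' k x \<partial>lborel.prod_power n)"
      then show ?thesis
        by (intro exI[of _ F]) (simp add: a_def Rn_def)
    qed (use p G' \<theta> le supp in \<open>simp_all only: sets_lborel atLeastAtMost_borel ennreal_less_top\<close>)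
  qed
  then obtain F where F[measurable]: "\<And>k. F k \<in> borel_measurable (Rn n)"
    and F1: "\<And>k. mixed_norm lborel n (\<lambda>i. conj_exp (p i)) (F k) \<le> 1"
    and FG: "\<And>k. ennreal (\<theta> ^ n) * a k \<le> (\<integral>\<^sup>+ x. F k x * G' k x \<partial>Rn n)"
    by metis
  have C: "mixed_norm lborel n p G < top"
    using K by (intro lborel.mixed_norm_bounded_support[where B = "{-K..K}" and c = "ennreal K"] p1)
      (auto simp: Rn_def[symmetric] abs_le_iff not_le emeasure_lborel_Icc_eq)
  have a_le: "a k \<le> mixed_norm lborel n p G" for k
    unfolding a_def G'_def by (intro lborel.mixed_norm_mono p1) (auto simp: indicator_def)
  have a_supp: "a k = 0" if i: "i < n" "k i \<notin> {- \<lceil>\<bar>K\<bar>\<rceil> - 1..\<lceil>\<bar>K\<bar>\<rceil>}" for k i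
  proof -
    have "G' k x = 0" if x: "x \<in> space (Rn n)" for x
    proof (cases "x \<in> cube n 1 k")
      case True
      then have "of_int (k i) \<le> x i" "x i < of_int (k i) + 1"
        using i by (auto simp: cube_def)
      then have "K < \<bar>x i\<bar>"
        using i(2) by (auto simp: not_le) linarith+
      then show ?thesis using K(2)[OF x i(1)] by (simp add: G'_def)
    qed (simp add: G'_def)
    then have "a k = mixed_norm lborel n p (\<lambda>x :: nat \<Rightarrow> real. 0)"
      unfolding a_def by (intro lborel.mixed_norm_cong p1) (auto simp: Rn_def)
    also have "\<dots> = 0"
      by (subst lborel.mixed_norm_eq_0_iff) (auto intro: p1)
    finally show ?thesis .
  qed
  obtain b where b1: "mixed_norm (count_space UNIV) n (\<lambda>i. conj_exp (s i)) b \<le> 1"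
    and ba: "ennreal (\<theta> ^ n) * mixed_norm (count_space UNIV) n s a \<le> (\<integral>\<^sup>+ k. b k * a k \<partial>ints.prod_power n)"
    by (rule ints.mixed_norm_test_function[of n s "{- \<lceil>\<bar>K\<bar>\<rceil> - 1..\<lceil>\<bar>K\<bar>\<rceil>}" a "mixed_norm lborel n p G" \<theta>])
      (use s C a_le a_supp \<theta> in \<open>auto simp: of_nat_less_top\<close>)
  define H where "H x = b (cell n x) * F (cell n x) x" for x
  have H[measurable]: "H \<in> borel_measurable (Rn n)"
    unfolding H_def[abs_def] by (rule measurable_glue[of n "\<lambda>k x. b k * F k x"]) simp
  have HF: "H x * indicator (cube n 1 k) x \<le> b k * F k x" if "k \<in> cells n" for k x
    using mem_cube_iff[OF that, of x] by (auto simp: H_def indicator_def)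
  have "mixed_norm lborel n (\<lambda>i. conj_exp (p i)) (\<lambda>x. H x * indicator (cube n 1 k) x) \<le> b k"
    if k: "k \<in> cells n" for k
  proof (cases "b k < top")
    \<comment> \<open>A scalar leaves the norm only when it is finite; where \<open>b k\<close> is
      infinite the bound is trivial.\<close>
    case True
    have "mixed_norm lborel n (\<lambda>i. conj_exp (p i)) (\<lambda>x. H x * indicator (cube n 1 k) x)
        \<le> mixed_norm lborel n (\<lambda>i. conj_exp (p i)) (\<lambda>x. b k * F k x)"
      by (intro lborel.mixed_norm_mono q1 HF k)
    also have "\<dots> = b k * mixed_norm lborel n (\<lambda>i. conj_exp (p i)) (F k)"
      using True by (intro lborel.mixed_norm_cmult q1) (auto simp: measurable_Rn_iff)
    also have "\<dots> \<le> b k * 1"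
      by (intro mult_left_mono F1) auto
    finally show ?thesis by simp
  qed (simp add: less_top[symmetric])
  then have "amalg_norm n (\<lambda>i. conj_exp (p i)) (\<lambda>i. conj_exp (s i)) H
      \<le> mixed_norm (count_space UNIV) n (\<lambda>i. conj_exp (s i)) b"
    unfolding amalg_norm_def by (intro ints.mixed_norm_mono t1) (auto simp: ints_prod_power)
  then have H1: "amalg_norm n (\<lambda>i. conj_exp (p i)) (\<lambda>i. conj_exp (s i)) H \<le> 1"
    using b1 by (rule order_trans)
  have "ennreal (\<theta> ^ (2 * n)) * amalg_norm n p s G
      = ennreal (\<theta> ^ n) * (ennreal (\<theta> ^ n) * mixed_norm (count_space UNIV) n s a)"
    using \<theta> by (simp add: amalg_norm_def a_def[abs_def] G'_def mult_2 power_add ennreal_mult mult.assoc)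
  also have "\<dots> \<le> ennreal (\<theta> ^ n) * (\<integral>\<^sup>+ k. b k * a k \<partial>count_space (cells n))"
    using ba by (intro mult_left_mono) (auto simp: ints_prod_power)
  also have "\<dots> = (\<integral>\<^sup>+ k. b k * (ennreal (\<theta> ^ n) * a k) \<partial>count_space (cells n))"
    by (subst nn_integral_cmult[symmetric]) (auto simp: mult_ac)
  also have "\<dots> \<le> (\<integral>\<^sup>+ k. b k * (\<integral>\<^sup>+ x. F k x * G' k x \<partial>Rn n) \<partial>count_space (cells n))"
    by (intro nn_integral_mono mult_left_mono FG) auto
  also have "\<dots> = (\<integral>\<^sup>+ k. (\<integral>\<^sup>+ x. b k * F k x * G x * indicator (cube n 1 k) x \<partial>Rn n) \<partial>count_space (cells n))"
    unfolding G'_def by (intro nn_integral_cong) (simp add: nn_integral_cmult[symmetric] mult.assoc)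
  also have "\<dots> = (\<integral>\<^sup>+ x. H x * G x \<partial>Rn n)"
    unfolding H_def by (rule nn_integral_glue[of n "\<lambda>k x. b k * F k x * G x", symmetric]) simp
  finally show ?thesis using H H1 by (intro that)
qed

lemma ennreal_le_of_near:
  assumes "\<And>\<theta>::real. 0 < \<theta> \<Longrightarrow> \<theta> < 1 \<Longrightarrow> ennreal (\<theta> ^ N) * S \<le> C" and "S < top"
  shows "S \<le> C"
proof (cases "C = top")
  case False
  obtain c where c: "C = ennreal c" "0 \<le> c" using False by (cases C rule: ennreal_cases) auto
  obtain x where x: "S = ennreal x" "0 \<le> x" using assms(2) by (cases S rule: ennreal_cases) auto
  \<comment> \<open>The values 1 - 1 / (j + 2) lie strictly between 0 and 1 and tend to 1.\<close>
  have le: "(1 - 1 / (real j + 2)) ^ N * x \<le> c" for j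
    using assms(1)[of "1 - 1 / (real j + 2)"] c x by (simp add: ennreal_mult[symmetric] field_simps)
  have "(\<lambda>j. (1 - 1 / (real j + 2)) ^ N * x) \<longlonglongrightarrow> (1 - 0) ^ N * x"
  proof (intro tendsto_intros)
    have "(\<lambda>j. inverse (real (Suc (j + 1)))) \<longlonglongrightarrow> 0"
      by (rule LIMSEQ_ignore_initial_segment[OF LIMSEQ_inverse_real_of_nat])
    then show "(\<lambda>j. 1 / (real j + 2)) \<longlonglongrightarrow> 0"
      by (simp add: inverse_eq_divide add.commute)
  qed
  then have "(1 - 0) ^ N * x \<le> c"
    using le by (intro LIMSEQ_le_const2) auto
  then show ?thesis using c x by (simp add: ennreal_leI)
qed simp

text \<open>Two truncations are involved: \<open>G\<close> is cut so that a near-extremal function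
  exists, and that function is cut in turn because the bound is assumed for tame functions. Both
  cuts are undone by monotone convergence.\<close>

lemma amalg_norm_le_by_duality:
  assumes p: "\<And>i. i < n \<Longrightarrow> 1 < p i" and s: "\<And>i. i < n \<Longrightarrow> 1 < s i"
    and G[measurable]: "G \<in> borel_measurable (Rn n)"
    and bound: "\<And>F. tame n F \<Longrightarrow> amalg_norm n (\<lambda>i. conj_exp (p i)) (\<lambda>i. conj_exp (s i)) F \<le> 1 \<Longrightarrow>
      (\<integral>\<^sup>+ x. F x * G x \<partial>Rn n) \<le> C"
  shows "amalg_norm n p s G \<le> C"
proof -
  have p1: "\<And>i. i < n \<Longrightarrow> 1 \<le> p i" and s1: "\<And>i. i < n \<Longrightarrow> 1 \<le> s i"
    using p s by (auto intro: less_imp_le)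
  have "amalg_norm n p s (truncate n m G) \<le> C" for m
  proof (rule ennreal_le_of_near)
    show "amalg_norm n p s (truncate n m G) < top"
      by (intro amalg_norm_tame p1 s1 tame_truncate G)
    fix \<theta> :: real assume \<theta>: "0 < \<theta>" "\<theta> < 1"
    obtain F where F[measurable]: "F \<in> borel_measurable (Rn n)"
      and F1: "amalg_norm n (\<lambda>i. conj_exp (p i)) (\<lambda>i. conj_exp (s i)) F \<le> 1"
      and FG: "ennreal (\<theta> ^ (2 * n)) * amalg_norm n p s (truncate n m G)
        \<le> (\<integral>\<^sup>+ x. F x * truncate n m G x \<partial>Rn n)"
      using amalg_norm_near_extremal[where n = n and p = p and s = s, OF _ _ tame_truncate[OF G] \<theta>] p s by metis
    note FG
    also have "(\<integral>\<^sup>+ x. F x * truncate n m G x \<partial>Rn n) \<le> (\<integral>\<^sup>+ x. (SUP j. truncate n j F x * G x) \<partial>Rn n)"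
      unfolding SUP_mult_right_ennreal[symmetric] SUP_truncate
      by (intro nn_integral_mono mult_left_mono truncate_le) auto
    also have "\<dots> = (SUP j. \<integral>\<^sup>+ x. truncate n j F x * G x \<partial>Rn n)"
      by (intro nn_integral_monotone_convergence_SUP)
        (auto simp: incseq_def le_fun_def intro!: mult_right_mono truncate_mono)
    also have "\<dots> \<le> C"
    proof (rule SUP_least)
      fix j
      have "amalg_norm n (\<lambda>i. conj_exp (p i)) (\<lambda>i. conj_exp (s i)) (truncate n j F) \<le> 1"
        by (rule order_trans[OF amalg_norm_mono F1]) (auto intro: conj_exp_ge_1 p1 s1 truncate_le)
      then show "(\<integral>\<^sup>+ x. truncate n j F x * G x \<partial>Rn n) \<le> C"
        by (intro bound tame_truncate F)
    qed
    finally show "ennreal (\<theta> ^ (2 * n)) * amalg_norm n p s (truncate n m G) \<le> C" .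
  qed
  moreover have "amalg_norm n p s G = (SUP m. amalg_norm n p s (truncate n m G))"
    by (subst amalg_norm_SUP[symmetric]) (auto simp: SUP_truncate p1 s1 intro: truncate_mono)
  ultimately show ?thesis by (simp add: SUP_least)
qed

lemma scale_point_inverse: "0 < r \<Longrightarrow> x \<in> space (Rn n) \<Longrightarrow> scale_point n (1 / r) (scale_point n r x) = x"
  by (auto simp: scale_point_def space_Rn PiE_def extensional_def fun_eq_iff)

text \<open>\<open>cube n r k\<close> is the r-fold dilate of \<open>cube n 1 k\<close>. The
  resulting factor, r to the sum of the 1 / p i, is the one that the weight in
  \<open>amalg_alpha_norm\<close> compensates.\<close>

lemma amalg_r_eq:
  assumes p: "\<And>i. i < n \<Longrightarrow> 1 \<le> p i" and s: "\<And>i. i < n \<Longrightarrow> 1 \<le> s i"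
    and r: "0 < r" and g[measurable]: "g \<in> borel_measurable (Rn n)"
  shows "amalg_r n p s r g = ennreal (r powr (\<Sum>i<n. recip (p i))) *
    amalg_norm n p s (\<lambda>x. ennreal (norm (g (scale_point n (1 / r) x))))"
proof -
  define G where "G k x = ennreal (norm (g (scale_point n (1 / r) x))) * indicator (cube n 1 k) x" for k x
  have G[measurable]: "G k \<in> borel_measurable (Rn n)" for k
    unfolding G_def[abs_def] by measurable
  have "Lmixed_norm n p (\<lambda>x. g x * of_real (indicator (cube n r k) x))
      = mixed_norm lborel n p (\<lambda>x. G k (scale_point n r x))" for k
    unfolding Lmixed_norm_def
  proof (intro lborel.mixed_norm_cong p)
    fix x assume "x \<in> space (lborel.prod_power n)"
    then have "scale_point n (1 / r) (scale_point n r x) = x"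
      using r by (intro scale_point_inverse) (simp_all add: Rn_def)
    moreover have "scale_point n r x \<in> cube n 1 k \<longleftrightarrow> x \<in> cube n r k"
      using r by (auto simp: cube_def scale_point_def field_simps)
    ultimately show "ennreal (norm (g x * of_real (indicator (cube n r k) x))) = G k (scale_point n r x)"
      by (auto simp: G_def indicator_def)
  qed
  also have "mixed_norm lborel n p (\<lambda>x. G k (scale_point n r x))
      = ennreal (r powr (\<Sum>i<n. recip (p i))) * mixed_norm lborel n p (G k)" for k
    by (rule mixed_norm_lborel_scale[OF p r G])
  finally show ?thesis
    unfolding amalg_r_def lmixed_norm_def using s
    by (simp add: ints.mixed_norm_cmult amalg_norm_def G_def[abs_def])
qed

section \<open>Pairing with block decompositions\<close>

abbreviation centred_box :: "nat \<Rightarrow> real \<Rightarrow> (nat \<Rightarrow> real) set" where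
  "centred_box n R \<equiv> {x. \<forall>i<n. \<bar>x i\<bar> \<le> R}"

lemma pred_centred_box [measurable]: "Measurable.pred (Rn n) (\<lambda>x. \<forall>i<n. \<bar>x i\<bar> \<le> R)"
  using pred_box[of n R] by (simp add: Ball_def)

lemma measurable_indicator_box [measurable]:
  "(\<lambda>x. indicator (centred_box n R) x :: ennreal) \<in> borel_measurable (Rn n)"
  unfolding indicator_def by measurable

lemma ex_nat_box: "\<exists>N. \<forall>m\<ge>N. x \<in> centred_box n (real m)"
proof -
  obtain N where N: "(\<Sum>i<n. \<bar>x i\<bar>) \<le> real N" using real_arch_simple by blast
  have "\<bar>x i\<bar> \<le> real m" if "i < n" "N \<le> m" for i m
  proof -
    have "\<bar>x i\<bar> \<le> (\<Sum>i<n. \<bar>x i\<bar>)"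
      using that by (intro member_le_sum) auto
    with N that show ?thesis by simp
  qed
  then show ?thesis by auto
qed

lemma loc_int_iff:
  "loc_int n f \<longleftrightarrow> f \<in> borel_measurable (Rn n) \<and>
    (\<forall>R. (\<integral>\<^sup>+ x. ennreal (norm (f x)) * indicator (centred_box n R) x \<partial>Rn n) < top)"
proof -
  define g where "g R x = indicator {x \<in> space (Rn n). \<forall>i<n. \<bar>x i\<bar> \<le> R} x *\<^sub>R f x" for R x
  have int: "(\<integral>\<^sup>+ x. ennreal (norm (g R x)) \<partial>Rn n) = (\<integral>\<^sup>+ x. ennreal (norm (f x)) * indicator (centred_box n R) x \<partial>Rn n)" for R
    by (intro nn_integral_cong) (auto simp: g_def indicator_def)
  have eq: "loc_int n f \<longleftrightarrow> (\<forall>R. integrable (Rn n) (g R))"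
    by (simp add: loc_int_def set_integrable_def g_def[abs_def])
  show ?thesis
  proof
    assume "loc_int n f"
    then have g: "integrable (Rn n) (g R)" for R by (simp add: eq)
    \<comment> \<open>\<open>loc_int\<close> speaks of restrictions to boxes; f is measurable as
      their pointwise limit.\<close>
    have "f \<in> borel_measurable (Rn n)"
    proof (rule borel_measurable_LIMSEQ_metric)
      show "g (real m) \<in> borel_measurable (Rn n)" for m
        by (rule borel_measurable_integrable[OF g])
      fix x assume x: "x \<in> space (Rn n)"
      obtain N where "\<forall>m\<ge>N. x \<in> centred_box n (real m)" using ex_nat_box by blast
      then have "eventually (\<lambda>m. g (real m) x = f x) sequentially"
        using x unfolding eventually_sequentially by (intro exI[of _ N]) (auto simp: g_def)
      then show "(\<lambda>m. g (real m) x) \<longlonglongrightarrow> f x" by (rule tendsto_eventually)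
    qed
    with g show "f \<in> borel_measurable (Rn n) \<and>
      (\<forall>R. (\<integral>\<^sup>+ x. ennreal (norm (f x)) * indicator (centred_box n R) x \<partial>Rn n) < top)"
      by (auto simp: integrable_iff_bounded int)
  next
    assume *: "f \<in> borel_measurable (Rn n) \<and>
      (\<forall>R. (\<integral>\<^sup>+ x. ennreal (norm (f x)) * indicator (centred_box n R) x \<partial>Rn n) < top)"
    then have [measurable]: "f \<in> borel_measurable (Rn n)" by simp
    have "g R \<in> borel_measurable (Rn n)" for R
      unfolding g_def[abs_def] by measurable
    with * show "loc_int n f" by (simp add: eq integrable_iff_bounded int)
  qed
qed

lemma loc_int_measurable: "loc_int n f \<Longrightarrow> f \<in> borel_measurable (Rn n)"
  by (simp add: loc_int_iff)

lemma loc_int_cmult: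
  assumes "loc_int n f"
  shows "loc_int n (\<lambda>x. c * f x)"
  using assms loc_int_measurable[OF assms]
  by (simp add: loc_int_iff norm_mult ennreal_mult mult.assoc nn_integral_cmult ennreal_mult_less_top)

lemma loc_int_add:
  assumes "loc_int n f" "loc_int n g"
  shows "loc_int n (\<lambda>x. f x + g x)"
proof -
  have [measurable]: "f \<in> borel_measurable (Rn n)" "g \<in> borel_measurable (Rn n)"
    using assms by (auto intro: loc_int_measurable)
  have "(\<integral>\<^sup>+ x. ennreal (norm (f x + g x)) * indicator (centred_box n R) x \<partial>Rn n)
      \<le> (\<integral>\<^sup>+ x. ennreal (norm (f x)) * indicator (centred_box n R) x + ennreal (norm (g x)) * indicator (centred_box n R) x \<partial>Rn n)" for R
    by (intro nn_integral_mono) (auto simp: indicator_def norm_triangle_ineq simp flip: ennreal_plus)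
  also have "\<dots> R < top" for R
    using assms by (subst nn_integral_add) (auto simp: loc_int_iff)
  finally show ?thesis by (simp add: loc_int_iff)
qed

text \<open>Local integrability follows from the finite norm, by Hoelder's inequality against the
  indicator of a box, which has finite norm for the conjugate exponents.\<close>

lemma amalg_spaceI:
  assumes p: "\<And>i. i < n \<Longrightarrow> 1 \<le> p i" and s: "\<And>i. i < n \<Longrightarrow> 1 \<le> s i"
    and f[measurable]: "f \<in> borel_measurable (Rn n)" and fin: "amalg_norm n p s (\<lambda>x. ennreal (norm (f x))) < top"
  shows "f \<in> amalg_space n p s"
proof -
  have "(\<integral>\<^sup>+ x. ennreal (norm (f x)) * indicator (centred_box n R) x \<partial>Rn n) < top" for R
  proof -
    have "tame n (indicator (centred_box n R))"
      \<comment> \<open>The constant has to bound the height 1 of the indicator as well as the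
        radius R.\<close>
      unfolding tame_def by (intro conjI exI[of _ "max 1 R"] measurable_indicator_box)
        (auto simp: indicator_def max_def split: if_splits)
    then have "amalg_norm n (\<lambda>i. conj_exp (p i)) (\<lambda>i. conj_exp (s i)) (indicator (centred_box n R)) < top"
      using p s by (intro amalg_norm_tame conj_exp_ge_1)
    with fin have "amalg_norm n p s (\<lambda>x. ennreal (norm (f x))) *
        amalg_norm n (\<lambda>i. conj_exp (p i)) (\<lambda>i. conj_exp (s i)) (indicator (centred_box n R)) < top"
      by (simp add: ennreal_mult_less_top)
    moreover have "(\<integral>\<^sup>+ x. ennreal (norm (f x)) * indicator (centred_box n R) x \<partial>Rn n)
      \<le> amalg_norm n p s (\<lambda>x. ennreal (norm (f x))) *
        amalg_norm n (\<lambda>i. conj_exp (p i)) (\<lambda>i. conj_exp (s i)) (indicator (centred_box n R))"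
      by (intro amalg_norm_Holder p s) simp_all
    ultimately show ?thesis by (rule le_less_trans[rotated])
  qed
  with fin show ?thesis by (simp add: amalg_space_def loc_int_iff amalg_r_1_eq)
qed

section \<open>Dilations of functions\<close>

lemma dilate_eq: "dilate n \<beta> r f x = of_real (r powr (- real n * recip \<beta>)) * f (scale_point n r x)"
  by (simp add: dilate_def scale_point_def)

lemma measurable_dilate [measurable]:
  assumes [measurable]: "f \<in> borel_measurable (Rn n)"
  shows "dilate n \<beta> r f \<in> borel_measurable (Rn n)"
  unfolding dilate_eq[abs_def] by measurable

text \<open>The substitution produces r^n, which meets r^(-n / \<beta>) from the normalisation of
  the dilate; the dilation itself passes, inverted, to \<open>G\<close>.\<close>

lemma nn_integral_dilate:
  assumes r: "0 < r" and [measurable]: "f \<in> borel_measurable (Rn n)" "G \<in> borel_measurable (Rn n)"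
  shows "(\<integral>\<^sup>+ x. ennreal (norm (dilate n \<beta> r f x)) * G x \<partial>Rn n)
    = ennreal (r powr (real n * (1 - recip \<beta>))) * (\<integral>\<^sup>+ x. ennreal (norm (f x)) * G (scale_point n (1 / r) x) \<partial>Rn n)"
proof -
  define H where "H x = ennreal (norm (f x)) * G (scale_point n (1 / r) x)" for x
  have [measurable]: "H \<in> borel_measurable (Rn n)" unfolding H_def[abs_def] by measurable
  have "(\<integral>\<^sup>+ x. ennreal (norm (dilate n \<beta> r f x)) * G x \<partial>Rn n)
      = (\<integral>\<^sup>+ x. ennreal (r powr (- real n * recip \<beta>)) * H (scale_point n r x) \<partial>Rn n)"
    using r by (intro nn_integral_cong)
      (simp add: dilate_eq H_def scale_point_inverse norm_mult ennreal_mult mult.assoc)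
  also have "\<dots> = ennreal (r powr (- real n * recip \<beta>)) * (ennreal (r ^ n) * (\<integral>\<^sup>+ x. H x \<partial>Rn n))"
    using r by (simp add: nn_integral_cmult nn_integral_scale)
  also have "ennreal (r powr (- real n * recip \<beta>)) * (ennreal (r ^ n) * (\<integral>\<^sup>+ x. H x \<partial>Rn n))
      = ennreal (r powr (- real n * recip \<beta>) * r powr real n) * (\<integral>\<^sup>+ x. H x \<partial>Rn n)"
    using r by (simp add: ennreal_mult mult.assoc powr_realpow)
  also have "r powr (- real n * recip \<beta>) * r powr real n = r powr (real n * (1 - recip \<beta>))"
    by (simp add: powr_add[symmetric] algebra_simps)
  finally show ?thesis by (simp add: H_def)
qed

lemma loc_int_dilate:
  assumes "loc_int n f" and r: "0 < r"
  shows "loc_int n (dilate n \<beta> r f)"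
proof -
  have [measurable]: "f \<in> borel_measurable (Rn n)" using assms(1) by (rule loc_int_measurable)
  have "(\<integral>\<^sup>+ x. ennreal (norm (dilate n \<beta> r f x)) * indicator (centred_box n R) x \<partial>Rn n) < top" for R
  proof -
    have "indicator (centred_box n R) (scale_point n (1 / r) x) = (indicator (centred_box n (R / r)) x :: ennreal)" for x
      using r by (auto simp: indicator_def scale_point_def field_simps abs_mult)
    then show ?thesis
      using assms(1) by (simp add: nn_integral_dilate[OF r] loc_int_iff ennreal_mult_less_top)
  qed
  then show ?thesis by (simp add: loc_int_iff)
qed

lemma dilate_cmult: "dilate n \<beta> r (\<lambda>x. c * f x) x = c * dilate n \<beta> r f x"
  by (simp add: dilate_eq)


text \<open>On every box, \<open>(|f| - G)\<^sup>+\<close> is at most \<open>|f - S\<^sub>N|\<close> when \<open>G\<close> dominates all partial sums \<open>S\<^sub>N\<close>.\<close>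
lemma conv_L1loc_dominated:
  assumes conv: "conv_L1loc n S f"
    and [measurable]: "f \<in> borel_measurable (Rn n)" "\<And>N. S N \<in> borel_measurable (Rn n)" "G \<in> borel_measurable (Rn n)"
    and G: "\<And>N x. ennreal (norm (S N x)) \<le> G x"
  shows "AE x in Rn n. ennreal (norm (f x)) \<le> G x"
proof -
  have "AE x in Rn n. (ennreal (norm (f x)) - G x) * indicator (centred_box n (real m)) x = 0" for m
  proof -
    have "(\<integral>\<^sup>+ x. (ennreal (norm (f x)) - G x) * indicator (centred_box n (real m)) x \<partial>Rn n) \<le> 0"
    proof (rule LIMSEQ_le_const)
      show "(\<lambda>N. \<integral>\<^sup>+ x. ennreal (norm (f x - S N x)) * indicator (centred_box n (real m)) x \<partial>Rn n) \<longlonglongrightarrow> 0"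
        using conv by (simp add: conv_L1loc_def)
      have "ennreal (norm (f x)) - G x \<le> ennreal (norm (f x - S N x))" for N x
      proof -
        have "ennreal (norm (f x)) \<le> ennreal (norm (S N x) + norm (f x - S N x))"
          by (intro ennreal_leI) (metis add.commute diff_add_cancel norm_triangle_ineq)
        also have "\<dots> \<le> G x + ennreal (norm (f x - S N x))"
          using G[of N x] by (simp add: add_right_mono)
        finally show ?thesis by (simp add: ennreal_minus_le_iff)
      qed
      then show "\<exists>N. \<forall>k\<ge>N. (\<integral>\<^sup>+ x. (ennreal (norm (f x)) - G x) * indicator (centred_box n (real m)) x \<partial>Rn n)
          \<le> (\<integral>\<^sup>+ x. ennreal (norm (f x - S k x)) * indicator (centred_box n (real m)) x \<partial>Rn n)"
        by (auto intro!: nn_integral_mono mult_right_mono)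
    qed
    then show ?thesis by (simp add: nn_integral_0_iff_AE)
  qed
  then have "AE x in Rn n. \<forall>m. (ennreal (norm (f x)) - G x) * indicator (centred_box n (real m)) x = 0"
    by (subst AE_all_countable) blast
  then show ?thesis
  proof eventually_elim
    case (elim x)
    obtain N where "x \<in> centred_box n (real N)" using ex_nat_box[of x n] by blast
    with elim[rule_format, of N] show ?case
      by (cases "G x = top") (auto simp: diff_eq_0_iff_ennreal)
  qed
qed

section \<open>Upper bound for the pairing and elementary blocks\<close>

lemma recip_le_one: "1 \<le> p \<Longrightarrow> recip p \<le> 1"
  by (cases p) (auto simp: recip_def field_simps)

text \<open>The bound \<open>1 \<le> \<alpha>\<close> makes \<beta> a genuine conjugate exponent,
  with 1 / \<beta> = 1 - 1 / \<alpha>; \<open>one_le_exponent\<close> supplies it in the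
  theorem.\<close>

locale amalgam_exponents =
  fixes n :: nat and p s :: "nat \<Rightarrow> ereal" and \<alpha> :: ereal
  assumes p: "\<And>i. i < n \<Longrightarrow> 1 \<le> p i" and s: "\<And>i. i < n \<Longrightarrow> 1 \<le> s i" and \<alpha>: "1 \<le> \<alpha>"
begin

abbreviation "q \<equiv> \<lambda>i. conj_exp (p i)"
abbreviation "t \<equiv> \<lambda>i. conj_exp (s i)"
abbreviation "\<beta> \<equiv> conj_exp \<alpha>"

lemma q: "i < n \<Longrightarrow> 1 \<le> q i" and t: "i < n \<Longrightarrow> 1 \<le> t i"
  by (auto intro: conj_exp_ge_1 p s)

text \<open>The part of the weight that involves the p i cancels against the scale factor in
  \<open>amalg_r_eq\<close>. What is left, r^(n / \<alpha>), is exactly the factor in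
  \<open>nn_integral_dilate'\<close>.\<close>

lemma amalg_alpha_norm_eq:
  assumes g: "g \<in> borel_measurable (Rn n)"
  shows "amalg_alpha_norm n p s \<alpha> g = (SUP r\<in>{0<..}. ennreal (r powr (real n * recip \<alpha>)) *
    amalg_norm n p s (\<lambda>x. ennreal (norm (g (scale_point n (1 / r) x)))))"
  unfolding amalg_alpha_norm_def
proof (intro SUP_cong refl)
  fix r :: real assume "r \<in> {0<..}"
  then have r: "0 < r" by simp
  have "r powr (real n * recip \<alpha>) = r powr (real n * recip \<alpha> - (\<Sum>i<n. recip (p i))) * r powr (\<Sum>i<n. recip (p i))"
    by (simp add: powr_add[symmetric])
  then show "ennreal (r powr (real n * recip \<alpha> - (\<Sum>i<n. recip (p i)))) * amalg_r n p s r g =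
      ennreal (r powr (real n * recip \<alpha>)) * amalg_norm n p s (\<lambda>x. ennreal (norm (g (scale_point n (1 / r) x))))"
    using amalg_r_eq[OF p s r g] by (simp add: ennreal_mult mult.assoc)
qed

lemma nn_integral_dilate':
  assumes "0 < r" "f \<in> borel_measurable (Rn n)" "G \<in> borel_measurable (Rn n)"
  shows "(\<integral>\<^sup>+ x. ennreal (norm (dilate n \<beta> r f x)) * G x \<partial>Rn n)
    = ennreal (r powr (real n * recip \<alpha>)) * (\<integral>\<^sup>+ x. ennreal (norm (f x)) * G (scale_point n (1 / r) x) \<partial>Rn n)"
  using nn_integral_dilate[OF assms, of \<beta>] recip_conj_exp[OF \<alpha>] by simp

lemma dilate_pairing_le:
  assumes r: "0 < r" and [measurable]: "f \<in> borel_measurable (Rn n)" "g \<in> borel_measurable (Rn n)"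
  shows "(\<integral>\<^sup>+ x. ennreal (norm (dilate n \<beta> r f x)) * ennreal (norm (g x)) \<partial>Rn n)
    \<le> amalg_alpha_norm n p s \<alpha> g * amalg_r n q t 1 f"
proof -
  define G where "G x = ennreal (norm (g (scale_point n (1 / r) x)))" for x
  have [measurable]: "G \<in> borel_measurable (Rn n)" unfolding G_def[abs_def] by measurable
  have "(\<integral>\<^sup>+ x. ennreal (norm (dilate n \<beta> r f x)) * ennreal (norm (g x)) \<partial>Rn n)
      = ennreal (r powr (real n * recip \<alpha>)) * (\<integral>\<^sup>+ x. G x * ennreal (norm (f x)) \<partial>Rn n)"
    by (subst nn_integral_dilate'[OF r]) (simp_all add: G_def mult.commute)
  also have "\<dots> \<le> ennreal (r powr (real n * recip \<alpha>)) * (amalg_norm n p s G * amalg_r n q t 1 f)"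
    unfolding amalg_r_1_eq by (intro mult_left_mono amalg_norm_Holder p s) simp_all
  also have "\<dots> \<le> amalg_alpha_norm n p s \<alpha> g * amalg_r n q t 1 f"
    unfolding mult.assoc[symmetric]
  proof (rule mult_right_mono)
    show "ennreal (r powr (real n * recip \<alpha>)) * amalg_norm n p s G \<le> amalg_alpha_norm n p s \<alpha> g"
      using r by (subst amalg_alpha_norm_eq) (auto simp: G_def[abs_def] intro!: SUP_upper2[of r])
  qed simp
  finally show ?thesis .
qed

lemma block_decomp_pairing_le:
  assumes dec: "block_decomp n q t \<beta> f c r fs" and [measurable]: "f \<in> borel_measurable (Rn n)" "g \<in> borel_measurable (Rn n)"
  shows "(\<integral>\<^sup>+ x. ennreal (norm (f x * g x)) \<partial>Rn n) \<le> amalg_alpha_norm n p s \<alpha> g * ennreal (\<Sum>j. norm (c j))"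
proof -
  have r: "\<And>j. 0 < r j" and fs1: "\<And>j. amalg_r n q t 1 (fs j) \<le> 1" and sum: "summable (\<lambda>j. norm (c j))"
    and conv: "conv_L1loc n (\<lambda>N x. \<Sum>j<N. c j * dilate n \<beta> (r j) (fs j) x) f"
    and fs[measurable]: "\<And>j. fs j \<in> borel_measurable (Rn n)"
    using dec by (auto simp: block_decomp_def amalg_space_def intro: loc_int_measurable)
  \<comment> \<open>As a series in \<open>ennreal\<close> this is defined everywhere, before
    anything is known about pointwise convergence, and it dominates the moduli of all partial
    sums.\<close>
  define G where "G x = (\<Sum>j. ennreal (norm (c j)) * ennreal (norm (dilate n \<beta> (r j) (fs j) x)))" for x
  have [measurable]: "G \<in> borel_measurable (Rn n)" unfolding G_def[abs_def] by measurable
  have "AE x in Rn n. ennreal (norm (f x)) \<le> G x"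
  proof (rule conv_L1loc_dominated[OF conv])
    fix N x
    have "norm (\<Sum>j<N. c j * dilate n \<beta> (r j) (fs j) x) \<le> (\<Sum>j<N. norm (c j) * norm (dilate n \<beta> (r j) (fs j) x))"
      unfolding norm_mult[symmetric] by (rule norm_sum)
    then have "ennreal (norm (\<Sum>j<N. c j * dilate n \<beta> (r j) (fs j) x))
        \<le> (\<Sum>j<N. ennreal (norm (c j)) * ennreal (norm (dilate n \<beta> (r j) (fs j) x)))"
      by (simp add: ennreal_leI sum_ennreal flip: ennreal_mult)
    also have "\<dots> \<le> G x"
      unfolding G_def by (intro sum_le_suminf) auto
    finally show "ennreal (norm (\<Sum>j<N. c j * dilate n \<beta> (r j) (fs j) x)) \<le> G x" .
  qed simp_all
  then have "(\<integral>\<^sup>+ x. ennreal (norm (f x * g x)) \<partial>Rn n) \<le> (\<integral>\<^sup>+ x. G x * ennreal (norm (g x)) \<partial>Rn n)"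
    by (intro nn_integral_mono_AE) (auto elim!: eventually_mono simp: norm_mult ennreal_mult intro: mult_right_mono)
  also have "\<dots> = (\<integral>\<^sup>+ x. (\<Sum>j. ennreal (norm (c j)) * (ennreal (norm (dilate n \<beta> (r j) (fs j) x)) * ennreal (norm (g x)))) \<partial>Rn n)"
    unfolding G_def ennreal_suminf_multc[symmetric] by (simp only: mult.assoc)
  also have "\<dots> = (\<Sum>j. ennreal (norm (c j)) * (\<integral>\<^sup>+ x. ennreal (norm (dilate n \<beta> (r j) (fs j) x)) * ennreal (norm (g x)) \<partial>Rn n))"
    by (simp add: nn_integral_suminf nn_integral_cmult)
  also have "\<dots> \<le> (\<Sum>j. ennreal (norm (c j)) * amalg_alpha_norm n p s \<alpha> g)"
  proof (intro suminf_le mult_left_mono)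
    fix j
    have "(\<integral>\<^sup>+ x. ennreal (norm (dilate n \<beta> (r j) (fs j) x)) * ennreal (norm (g x)) \<partial>Rn n)
        \<le> amalg_alpha_norm n p s \<alpha> g * amalg_r n q t 1 (fs j)"
      by (intro dilate_pairing_le r) simp_all
    also have "\<dots> \<le> amalg_alpha_norm n p s \<alpha> g * 1"
      by (intro mult_left_mono fs1) simp
    finally show "(\<integral>\<^sup>+ x. ennreal (norm (dilate n \<beta> (r j) (fs j) x)) * ennreal (norm (g x)) \<partial>Rn n)
        \<le> amalg_alpha_norm n p s \<alpha> g" by simp
  qed simp_all
  also have "\<dots> = amalg_alpha_norm n p s \<alpha> g * ennreal (\<Sum>j. norm (c j))"
    unfolding ennreal_suminf_multc suminf_ennreal2[OF norm_ge_zero sum] by (rule mult.commute)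
  finally show ?thesis .
qed

lemma block_norm_lower:
  assumes "block_decomp n q t \<beta> f c r fs"
  shows "block_norm n q t \<beta> f \<le> (\<Sum>j. norm (c j))"
  unfolding block_norm_def
proof (rule cInf_lower)
  show "bdd_below {(\<Sum>j. norm (c j)) |c r fs. block_decomp n q t \<beta> f c r fs}"
    by (intro bdd_belowI[of _ 0]) (auto simp: block_decomp_def intro: suminf_nonneg)
qed (use assms in blast)

lemma block_norm_greatest:
  assumes "f \<in> block_space n q t \<beta>"
    and "\<And>c r fs. block_decomp n q t \<beta> f c r fs \<Longrightarrow> A \<le> (\<Sum>j. norm (c j))"
  shows "A \<le> block_norm n q t \<beta> f"
  unfolding block_norm_def using assms by (intro cInf_greatest) (auto simp: block_space_def)

lemma block_norm_nonneg: "f \<in> block_space n q t \<beta> \<Longrightarrow> 0 \<le> block_norm n q t \<beta> f"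
  by (rule block_norm_greatest) (auto simp: block_decomp_def intro: suminf_nonneg)

lemma block_pairing:
  assumes g: "g \<in> amalg_alpha_space n p s \<alpha>" and f: "f \<in> block_space n q t \<beta>"
  shows "integrable (Rn n) (\<lambda>x. f x * g x)"
    and "norm (pairing n g f) \<le> enn2real (amalg_alpha_norm n p s \<alpha> g) * block_norm n q t \<beta> f"
proof -
  have [measurable]: "f \<in> borel_measurable (Rn n)" "g \<in> borel_measurable (Rn n)"
    using assms by (auto simp: amalg_alpha_space_def block_space_def intro: loc_int_measurable)
  define A where "A = enn2real (amalg_alpha_norm n p s \<alpha> g)"
  have A: "amalg_alpha_norm n p s \<alpha> g = ennreal A" "0 \<le> A"
    using g by (auto simp: A_def amalg_alpha_space_def)
  have le: "(\<integral>\<^sup>+ x. ennreal (norm (f x * g x)) \<partial>Rn n) \<le> ennreal (A * (\<Sum>j. norm (c j)))"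
    if "block_decomp n q t \<beta> f c r fs" for c r fs
  proof -
    have "0 \<le> (\<Sum>j. norm (c j))" using that by (auto simp: block_decomp_def intro: suminf_nonneg)
    then show ?thesis using block_decomp_pairing_le[OF that, of g] A by (simp add: ennreal_mult)
  qed
  obtain c r fs where "block_decomp n q t \<beta> f c r fs"
    using f by (auto simp: block_space_def)
  from le[OF this] show int: "integrable (Rn n) (\<lambda>x. f x * g x)"
    unfolding integrable_iff_bounded by (auto intro: le_less_trans)
  have le': "norm (pairing n g f) \<le> A * (\<Sum>j. norm (c j))" if "block_decomp n q t \<beta> f c r fs" for c r fs
  proof -
    have "0 \<le> (\<Sum>j. norm (c j))" using that by (auto simp: block_decomp_def intro: suminf_nonneg)
    moreover have "ennreal (norm (pairing n g f)) \<le> ennreal (A * (\<Sum>j. norm (c j)))"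
      unfolding pairing_def using integral_norm_bound_ennreal[OF int] le[OF that] by (rule order_trans)
    ultimately show ?thesis using A(2) by (simp add: ennreal_le_iff)
  qed
  have "norm (pairing n g f) \<le> A * block_norm n q t \<beta> f"
  proof (cases "A = 0")
    case True
    then show ?thesis using le' f by (auto simp: block_space_def)
  next
    \<comment> \<open>Dividing by A isolates the coefficient sum, so that the infimum over all
      decompositions can be taken.\<close>
    case False
    with A(2) have A0: "0 < A" by simp
    have "norm (pairing n g f) / A \<le> block_norm n q t \<beta> f"
    proof (rule block_norm_greatest[OF f])
      fix c r fs assume "block_decomp n q t \<beta> f c r fs"
      from le'[OF this] show "norm (pairing n g f) / A \<le> (\<Sum>j. norm (c j))"
        using A0 by (simp add: pos_divide_le_eq mult.commute)
    qed
    then show ?thesis using A0 by (simp add: pos_divide_le_eq mult.commute)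
  qed
  then show "norm (pairing n g f) \<le> enn2real (amalg_alpha_norm n p s \<alpha> g) * block_norm n q t \<beta> f"
    by (simp add: A_def)
qed

lemma block_pairing_ennreal:
  assumes g: "g \<in> amalg_alpha_space n p s \<alpha>" and f: "f \<in> block_space n q t \<beta>"
  shows "ennreal (norm (\<integral>x. f x * g x \<partial>Rn n)) \<le> amalg_alpha_norm n p s \<alpha> g * ennreal (block_norm n q t \<beta> f)"
proof -
  have "amalg_alpha_norm n p s \<alpha> g = ennreal (enn2real (amalg_alpha_norm n p s \<alpha> g))"
    using g by (simp add: amalg_alpha_space_def)
  then show ?thesis
    using ennreal_leI[OF block_pairing(2)[OF assms]] block_norm_nonneg[OF f]
    by (simp add: pairing_def ennreal_mult)
qed

text \<open>A decomposition with the single nonzero coefficient c and the block f / c. Allowing any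
  bound c > 0, instead of the norm of f, covers functions of norm zero: for them c can be made
  arbitrarily small.\<close>

lemma dilate_block:
  assumes f: "f \<in> amalg_space n q t" and r: "0 < r" and c: "0 < c" "amalg_r n q t 1 f \<le> ennreal c"
  shows "dilate n \<beta> r f \<in> block_space n q t \<beta>" "block_norm n q t \<beta> (dilate n \<beta> r f) \<le> c"
proof -
  have [measurable]: "f \<in> borel_measurable (Rn n)" and loc: "loc_int n f"
    using f by (auto simp: amalg_space_def intro: loc_int_measurable)
  define f' where "f' x = of_real (1 / c) * f x" for x
  have "ennreal (norm (f' x)) = ennreal (1 / c) * ennreal (norm (f x))" for x
    using c by (simp add: f'_def norm_divide flip: ennreal_mult)
  then have "amalg_r n q t 1 f' = ennreal (1 / c) * amalg_r n q t 1 f"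
    unfolding amalg_r_1_eq by (subst amalg_norm_cmult[OF q t, symmetric]) auto
  also have "\<dots> \<le> ennreal (1 / c) * ennreal c"
    by (intro mult_left_mono c) simp
  also have "\<dots> = 1" using c by (simp flip: ennreal_mult)
  finally have f'1: "amalg_r n q t 1 f' \<le> 1" .
  moreover have "loc_int n f'"
    unfolding f'_def[abs_def] using loc by (rule loc_int_cmult)
  ultimately have f': "f' \<in> amalg_space n q t"
    by (auto simp: amalg_space_def intro: le_less_trans)
  define cs where "cs j = (if j = 0 then of_real c else 0 :: complex)" for j :: nat
  have dec: "block_decomp n q t \<beta> (dilate n \<beta> r f) cs (\<lambda>_. r) (\<lambda>_. f')"
    unfolding block_decomp_def
  proof (intro conjI allI)
    show "summable (\<lambda>j. norm (cs j))"
      by (rule summable_finite[of "{0}"]) (auto simp: cs_def)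
    have "(\<Sum>j<N. cs j * dilate n \<beta> r f' x) = dilate n \<beta> r f x" if "0 < N" for N x
    proof -
      have "(\<Sum>j<N. cs j * dilate n \<beta> r f' x) = (\<Sum>j\<in>{0}. cs j * dilate n \<beta> r f' x)"
        using that by (intro sum.mono_neutral_right) (auto simp: cs_def)
      then show ?thesis using c by (simp add: cs_def dilate_eq f'_def)
    qed
    then show "conv_L1loc n (\<lambda>N x. \<Sum>j<N. cs j * dilate n \<beta> r f' x) (dilate n \<beta> r f)"
      unfolding conv_L1loc_def
      by (intro allI tendsto_eventually eventually_mono[OF eventually_gt_at_top[of 0]]) simp
  qed (use r f' f'1 in auto)
  then show "dilate n \<beta> r f \<in> block_space n q t \<beta>"
    using loc_int_dilate[OF loc r] by (auto simp: block_space_def)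
  have "(\<Sum>j. norm (cs j)) = (\<Sum>j\<in>{0}. norm (cs j))"
    by (rule suminf_finite) (auto simp: cs_def)
  with block_norm_lower[OF dec] c show "block_norm n q t \<beta> (dilate n \<beta> r f) \<le> c"
    by (simp add: cs_def)
qed

end

section \<open>Radon-Nikodym for real set functions\<close>

text \<open>Jordan decomposition: the supremum of \<open>\<nu>\<close> over subsets is the positive part of \<open>\<nu>\<close>.\<close>
lemma positive_part_set_function:
  fixes \<nu> :: "'a set \<Rightarrow> real"
  assumes "sigma_finite_measure M"
    and sums: "\<And>A. range A \<subseteq> sets M \<Longrightarrow> disjoint_family A \<Longrightarrow> (\<lambda>i::nat. \<nu> (A i)) sums \<nu> (\<Union>i. A i)"
    and null: "\<And>A. A \<in> null_sets M \<Longrightarrow> \<nu> A = 0"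
    and bdd: "\<And>A. A \<in> sets M \<Longrightarrow> \<nu> A \<le> K"
  obtains f where "integrable M f" "\<And>A. A \<in> sets M \<Longrightarrow>
    (\<integral>x. indicator A x * f x \<partial>M) = (SUP B\<in>{B\<in>sets M. B \<subseteq> A}. \<nu> B)"
proof -
  interpret sigma_finite_measure M by fact
  define P where "P A = (SUP B\<in>{B\<in>sets M. B \<subseteq> A}. \<nu> B)" for A
  have bdd': "bdd_above (\<nu> ` {B\<in>sets M. B \<subseteq> A})" for A
    using bdd by (auto intro!: bdd_aboveI[of _ K])
  have P_upper: "\<nu> B \<le> P A" if "B \<in> sets M" "B \<subseteq> A" for A B
    unfolding P_def using that by (intro cSUP_upper bdd') auto
  have P_least: "P A \<le> c" if "\<And>B. B \<in> sets M \<Longrightarrow> B \<subseteq> A \<Longrightarrow> \<nu> B \<le> c" for A c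
    unfolding P_def using that by (intro cSUP_least) auto
  have empty: "\<nu> {} = 0" by (rule null) simp
  have P_nonneg: "0 \<le> P A" for A using P_upper[of "{}" A] by (simp add: empty)
  have P_le: "P A \<le> K" for A by (rule P_least) (rule bdd)
  have add: "\<nu> (A \<union> B) = \<nu> A + \<nu> B" if "A \<in> sets M" "B \<in> sets M" "A \<inter> B = {}" for A B
  proof -
    have "(\<lambda>i. \<nu> (binaryset A B i)) sums \<nu> (\<Union>i. binaryset A B i)"
      using that by (intro sums) (auto simp: range_binaryset_eq disjoint_family_on_def binaryset_def)
    moreover have "(\<lambda>i. \<nu> (binaryset A B i)) sums (\<nu> A + \<nu> B)"
      using empty by (rule binaryset_sums)
    ultimately show ?thesis by (simp add: UN_binaryset_eq sums_unique2)
  qed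
  \<comment> \<open>Competitors for A and for B are disjoint and can be united. \<open>P\<close> is
    defined on arbitrary sets, so A and B need not be measurable.\<close>
  have superadd: "P A + P B \<le> P (A \<union> B)" if "A \<inter> B = {}" for A B
  proof -
    have "P B \<le> P (A \<union> B) - P A"
    proof (rule P_least)
      fix B' assume B': "B' \<in> sets M" "B' \<subseteq> B"
      have "P A \<le> P (A \<union> B) - \<nu> B'"
      proof (rule P_least)
        fix A' assume A': "A' \<in> sets M" "A' \<subseteq> A"
        have "\<nu> A' + \<nu> B' = \<nu> (A' \<union> B')" using A' B' that by (intro add[symmetric]) auto
        also have "\<dots> \<le> P (A \<union> B)" using A' B' by (intro P_upper) auto
        finally show "\<nu> A' \<le> P (A \<union> B) - \<nu> B'" by simp
      qed
      then show "\<nu> B' \<le> P (A \<union> B) - P A" by simp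
    qed
    then show ?thesis by simp
  qed
  have P_mono: "P A \<le> P B" if "A \<subseteq> B" for A B
    using that by (intro P_least P_upper) auto
  have fin: "(\<Sum>i<m. P (A i)) \<le> P (\<Union>i<m. A i)" if "disjoint_family A" for A :: "nat \<Rightarrow> 'a set" and m
  proof (induction m)
    case (Suc m)
    have "A i \<inter> A m = {}" if "i < m" for i
      using that \<open>disjoint_family A\<close> by (intro disjoint_family_onD[of A UNIV]) auto
    then have "(\<Union>i<m. A i) \<inter> A m = {}" by auto
    from superadd[OF this] Suc show ?case by (simp add: lessThan_Suc Un_commute)
  qed (simp add: P_nonneg)
  define N where "N = measure_of (space M) (sets M) (\<lambda>A. ennreal (P A))"
  have N: "emeasure N A = ennreal (P A)" if "A \<in> sets M" for A
  proof (rule emeasure_measure_of[OF N_def])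
    have "P {} \<le> 0" by (rule P_least) (simp add: empty)
    with P_nonneg[of "{}"] show "positive (sets N) (\<lambda>A. ennreal (P A))"
      by (simp add: positive_def ennreal_eq_0_iff)
    show "countably_additive (sets N) (\<lambda>A. ennreal (P A))"
    proof (rule countably_additiveI)
      fix A :: "nat \<Rightarrow> 'a set" assume A: "range A \<subseteq> sets N" "disjoint_family A"
      then have AM: "\<And>i. A i \<in> sets M" by (auto simp: N_def)
      have part: "(\<Sum>i<m. P (A i)) \<le> K" for m
        using fin[OF A(2), of m] P_le by (rule order_trans)
      have summ: "summable (\<lambda>i. P (A i))"
      proof (rule bounded_imp_summable)
        show "(\<Sum>i\<le>m. P (A i)) \<le> K" for m
          using part[of "Suc m"] by (simp add: lessThan_Suc_atMost)
      qed (rule P_nonneg)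
      have "(\<Sum>i. P (A i)) \<le> P (\<Union>i. A i)"
      proof (rule suminf_le_const[OF summ])
        show "(\<Sum>i<m. P (A i)) \<le> P (\<Union>i. A i)" for m
          using fin[OF A(2), of m] by (rule order_trans) (auto intro: P_mono)
      qed
      \<comment> \<open>Conversely, countable additivity of \<nu> splits a competitor B into the
        pieces B \<inter> A i, each of which is bounded by P (A i).\<close>
      moreover have "P (\<Union>i. A i) \<le> (\<Sum>i. P (A i))"
      proof (rule P_least)
        fix B assume B: "B \<in> sets M" "B \<subseteq> (\<Union>i. A i)"
        have "(\<lambda>i. \<nu> (B \<inter> A i)) sums \<nu> (\<Union>i. B \<inter> A i)"
        proof (rule sums)
          show "disjoint_family (\<lambda>i. B \<inter> A i)"
            using A(2) unfolding disjoint_family_on_def by blast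
        qed (use AM B in auto)
        also have "(\<Union>i. B \<inter> A i) = B" using B by auto
        finally have *: "(\<lambda>i. \<nu> (B \<inter> A i)) sums \<nu> B" .
        have "\<nu> B = (\<Sum>i. \<nu> (B \<inter> A i))" using * by (rule sums_unique)
        also have "\<dots> \<le> (\<Sum>i. P (A i))"
          using AM B by (intro suminf_le summ sums_summable[OF *] P_upper) auto
        finally show "\<nu> B \<le> (\<Sum>i. P (A i))" .
      qed
      ultimately have "(\<Sum>i. P (A i)) = P (\<Union>i. A i)" by (rule antisym)
      then show "(\<Sum>i. ennreal (P (A i))) = ennreal (P (\<Union>i. A i))"
        by (simp add: suminf_ennreal2[OF P_nonneg summ])
    qed
  qed (use that sets.space_closed in \<open>auto simp: N_def\<close>)
  have setsN: "sets N = sets M" by (simp add: N_def)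
  have ac: "absolutely_continuous M N"
    unfolding absolutely_continuous_def
  proof
    fix A assume A: "A \<in> null_sets M"
    have "P A \<le> 0"
    proof (rule P_least)
      fix B assume "B \<in> sets M" "B \<subseteq> A"
      then have "B \<in> null_sets M" using A null_sets_subset by blast
      then show "\<nu> B \<le> 0" using null by simp
    qed
    with P_nonneg[of A] A show "A \<in> null_sets N"
      by (auto simp: null_sets_def setsN N)
  qed
  obtain f where f[measurable]: "f \<in> borel_measurable M" and dens: "density M f = N"
    using Radon_Nikodym[OF ac setsN] by blast
  have int: "(\<integral>\<^sup>+ x. f x * indicator A x \<partial>M) = ennreal (P A)" if "A \<in> sets M" for A
    using N[OF that] that by (simp add: dens[symmetric] emeasure_density)
  have "AE x in M. f x \<noteq> \<infinity>"
  proof (rule nn_integral_PInf_AE)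
    have "(\<integral>\<^sup>+ x. f x \<partial>M) = (\<integral>\<^sup>+ x. f x * indicator (space M) x \<partial>M)"
      by (intro nn_integral_cong) auto
    then show "(\<integral>\<^sup>+ x. f x \<partial>M) \<noteq> \<infinity>" using int[of "space M"] by simp
  qed simp
  then have int': "(\<integral>\<^sup>+ x. ennreal (indicator A x * enn2real (f x)) \<partial>M) = ennreal (P A)" if "A \<in> sets M" for A
    unfolding int[OF that, symmetric]
    by (intro nn_integral_cong_AE) (auto elim!: eventually_mono simp: indicator_def less_top)
  show thesis
  proof (rule that[of "\<lambda>x. enn2real (f x)"])
    have "(\<integral>\<^sup>+ x. ennreal (norm (enn2real (f x))) \<partial>M) = (\<integral>\<^sup>+ x. ennreal (indicator (space M) x * enn2real (f x)) \<partial>M)"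
      by (intro nn_integral_cong) auto
    then show "integrable M (\<lambda>x. enn2real (f x))"
      using int'[of "space M"] by (simp add: integrable_iff_bounded)
    show "(\<integral>x. indicator A x * enn2real (f x) \<partial>M) = (SUP B\<in>{B\<in>sets M. B \<subseteq> A}. \<nu> B)" if A: "A \<in> sets M" for A
      using int'[OF A] A P_nonneg[of A] by (subst integral_eq_nn_integral) (auto simp: P_def[symmetric])
  qed
qed

text \<open>The densities of the positive parts of \<nu> and of - \<nu> are subtracted. The two
  suprema over subsets of A differ by \<nu> A, because replacing B by A - B turns \<nu> B into \<nu>
  A - \<nu> B.\<close>

lemma Radon_Nikodym_real:
  fixes \<nu> :: "'a set \<Rightarrow> real"
  assumes sf: "sigma_finite_measure M"
    and sums: "\<And>A. range A \<subseteq> sets M \<Longrightarrow> disjoint_family A \<Longrightarrow> (\<lambda>i::nat. \<nu> (A i)) sums \<nu> (\<Union>i. A i)"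
    and null: "\<And>A. A \<in> null_sets M \<Longrightarrow> \<nu> A = 0"
    and bdd: "\<And>A. A \<in> sets M \<Longrightarrow> \<bar>\<nu> A\<bar> \<le> K"
  obtains f where "integrable M f" "\<And>A. A \<in> sets M \<Longrightarrow> \<nu> A = (\<integral>x. indicator A x * f x \<partial>M)"
proof -
  have le: "\<nu> A \<le> K" "- \<nu> A \<le> K" if "A \<in> sets M" for A using bdd[OF that] by auto
  obtain f where f: "integrable M f" and fP: "\<And>A. A \<in> sets M \<Longrightarrow>
      (\<integral>x. indicator A x * f x \<partial>M) = (SUP B\<in>{B\<in>sets M. B \<subseteq> A}. \<nu> B)"
    by (rule positive_part_set_function[of M \<nu> K]) (use sf sums null le in auto)
  obtain g where g: "integrable M g" and gP: "\<And>A. A \<in> sets M \<Longrightarrow>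
      (\<integral>x. indicator A x * g x \<partial>M) = (SUP B\<in>{B\<in>sets M. B \<subseteq> A}. - \<nu> B)"
    by (rule positive_part_set_function[of M "\<lambda>A. - \<nu> A" K]) (use sf sums null le in \<open>auto intro: sums_minus\<close>)
  have compl: "\<nu> A = \<nu> B + \<nu> (A - B)" if "A \<in> sets M" "B \<in> sets M" "B \<subseteq> A" for A B
  proof -
    have "(\<lambda>i. \<nu> (binaryset B (A - B) i)) sums \<nu> (\<Union>i. binaryset B (A - B) i)"
      using that by (intro sums) (auto simp: range_binaryset_eq disjoint_family_on_def binaryset_def)
    moreover have "(\<lambda>i. \<nu> (binaryset B (A - B) i)) sums (\<nu> B + \<nu> (A - B))"
      by (rule binaryset_sums) (simp add: null)
    moreover have "B \<union> (A - B) = A" using that by auto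
    ultimately show ?thesis by (simp add: UN_binaryset_eq sums_unique2)
  qed
  have bdd1: "bdd_above (\<nu> ` {B\<in>sets M. B \<subseteq> A})" and bdd2: "bdd_above ((\<lambda>B. - \<nu> B) ` {B\<in>sets M. B \<subseteq> A})" for A
    using le by (auto intro!: bdd_aboveI[of _ K])
  show thesis
  proof (rule that[of "\<lambda>x. f x - g x"])
    show "integrable M (\<lambda>x. f x - g x)" using f g by (rule Bochner_Integration.integrable_diff)
    fix A assume A: "A \<in> sets M"
    have "(SUP B\<in>{B\<in>sets M. B \<subseteq> A}. \<nu> B) \<le> \<nu> A + (SUP B\<in>{B\<in>sets M. B \<subseteq> A}. - \<nu> B)"
    proof (rule cSUP_least)
      fix B assume B: "B \<in> {B\<in>sets M. B \<subseteq> A}"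
      have "- \<nu> (A - B) \<le> (SUP B\<in>{B\<in>sets M. B \<subseteq> A}. - \<nu> B)"
        using A B by (intro cSUP_upper bdd2) auto
      then show "\<nu> B \<le> \<nu> A + (SUP B\<in>{B\<in>sets M. B \<subseteq> A}. - \<nu> B)"
        using compl[OF A, of B] B by simp
    qed auto
    moreover have "(SUP B\<in>{B\<in>sets M. B \<subseteq> A}. - \<nu> B) \<le> (SUP B\<in>{B\<in>sets M. B \<subseteq> A}. \<nu> B) - \<nu> A"
    proof (rule cSUP_least)
      fix B assume B: "B \<in> {B\<in>sets M. B \<subseteq> A}"
      have "\<nu> (A - B) \<le> (SUP B\<in>{B\<in>sets M. B \<subseteq> A}. \<nu> B)"
        using A B by (intro cSUP_upper bdd1) auto
      then show "- \<nu> B \<le> (SUP B\<in>{B\<in>sets M. B \<subseteq> A}. \<nu> B) - \<nu> A"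
        using compl[OF A, of B] B by simp
    qed auto
    moreover have "(\<integral>x. indicator A x * (f x - g x) \<partial>M) = (\<integral>x. indicator A x * f x \<partial>M) - (\<integral>x. indicator A x * g x \<partial>M)"
    proof -
      have "integrable M (\<lambda>x. indicator A x * h x)" if "integrable M h" for h :: "'a \<Rightarrow> real"
        using integrable_real_mult_indicator[OF A that] by (simp add: mult.commute)
      with f g show ?thesis
        unfolding right_diff_distrib by (intro Bochner_Integration.integral_diff)
    qed
    ultimately show "\<nu> A = (\<integral>x. indicator A x * (f x - g x) \<partial>M)"
      by (simp add: fP[OF A] gP[OF A])
  qed
qed

section \<open>Duality and isometry\<close>

lemma tameE:
  assumes "tame n F"
  obtains K :: real where "0 < K" "\<And>x. x \<in> space (Rn n) \<Longrightarrow> F x \<le> ennreal K"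
    "\<And>x i. x \<in> space (Rn n) \<Longrightarrow> i < n \<Longrightarrow> K < \<bar>x i\<bar> \<Longrightarrow> F x = 0"
proof -
  obtain K where K: "\<And>x. x \<in> space (Rn n) \<Longrightarrow> F x \<le> ennreal K"
    "\<And>x i. x \<in> space (Rn n) \<Longrightarrow> i < n \<Longrightarrow> K < \<bar>x i\<bar> \<Longrightarrow> F x = 0"
    using assms unfolding tame_def by blast
  show thesis
  proof (rule that[of "max K 1"])
    show "F x \<le> ennreal (max K 1)" if "x \<in> space (Rn n)" for x
      using K(1)[OF that] by (rule order_trans) (simp add: ennreal_leI)
    show "F x = 0" if "x \<in> space (Rn n)" "i < n" "max K 1 < \<bar>x i\<bar>" for x i
      using that by (intro K(2)[of x i]) auto
  qed simp
qed

lemma tameI: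
  assumes "F \<in> borel_measurable (Rn n)" "\<And>x. x \<in> space (Rn n) \<Longrightarrow> F x \<le> ennreal K"
    "\<And>x i. x \<in> space (Rn n) \<Longrightarrow> i < n \<Longrightarrow> K < \<bar>x i\<bar> \<Longrightarrow> F x = 0"
  shows "tame n F"
  using assms unfolding tame_def by blast

lemma tame_mono:
  assumes "tame n F" "G \<in> borel_measurable (Rn n)" "\<And>x. x \<in> space (Rn n) \<Longrightarrow> G x \<le> F x"
  shows "tame n G"
proof -
  obtain K where K: "\<And>x. x \<in> space (Rn n) \<Longrightarrow> F x \<le> ennreal K"
    "\<And>x i. x \<in> space (Rn n) \<Longrightarrow> i < n \<Longrightarrow> K < \<bar>x i\<bar> \<Longrightarrow> F x = 0"
    using assms(1) unfolding tame_def by blast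
  show ?thesis
  proof (rule tameI[OF assms(2)])
    show "G x \<le> ennreal K" if "x \<in> space (Rn n)" for x
      using assms(3)[OF that] K(1)[OF that] by (rule order_trans)
    show "G x = 0" if "x \<in> space (Rn n)" "i < n" "K < \<bar>x i\<bar>" for x i
      using assms(3)[OF that(1)] K(2)[OF that] by simp
  qed
qed

lemma tame_indicator_cube: "tame n (indicator (cube n 1 k))"
proof (rule tameI[OF measurable_indicator_cube])
  define K where "K = (\<Sum>i<n. \<bar>real_of_int (k i)\<bar>) + 1"
  have K: "0 \<le> (\<Sum>i<n. \<bar>real_of_int (k i)\<bar>)" by (intro sum_nonneg) auto
  then show "indicator (cube n 1 k) x \<le> ennreal K" for x
    by (auto simp: indicator_def K_def)
  show "indicator (cube n 1 k) x = (0 :: ennreal)" if "i < n" "K < \<bar>x i\<bar>" for x i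
  proof -
    have "\<bar>real_of_int (k i)\<bar> \<le> (\<Sum>i<n. \<bar>real_of_int (k i)\<bar>)"
      using that by (intro member_le_sum) auto
    then have "\<not> (of_int (k i) \<le> x i \<and> x i < of_int (k i) + 1)"
      using that(2) by (auto simp: K_def)
    then have "x \<notin> cube n 1 k" using that(1) by (auto simp: cube_def)
    then show ?thesis by simp
  qed
qed

lemma tame_dilate:
  assumes [measurable]: "f \<in> borel_measurable (Rn n)" and f: "tame n (\<lambda>x. ennreal (norm (f x)))" and r: "0 < r"
  shows "tame n (\<lambda>x. ennreal (norm (dilate n \<beta> r f x)))"
proof -
  obtain K where K: "0 < K" "\<And>x. x \<in> space (Rn n) \<Longrightarrow> ennreal (norm (f x)) \<le> ennreal K"
    "\<And>x i. x \<in> space (Rn n) \<Longrightarrow> i < n \<Longrightarrow> K < \<bar>x i\<bar> \<Longrightarrow> ennreal (norm (f x)) = 0"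
    using f by (rule tameE) (rule that, assumption, blast+)
  define c where "c = r powr (- real n * recip \<beta>)"
  have c: "0 < c" using r by (simp add: c_def)
  have norm: "norm (dilate n \<beta> r f x) = c * norm (f (scale_point n r x))" for x
    using c by (simp add: dilate_eq c_def norm_mult)
  show ?thesis
  proof (rule tameI)
    \<comment> \<open>The dilation multiplies the height by c and the radius of the support by r;
      one constant has to cover both.\<close>
    show "ennreal (norm (dilate n \<beta> r f x)) \<le> ennreal (max (c * K) (r * K))" for x
      unfolding norm using K(1) K(2)[OF scale_point_space, of r x] c
      by (intro ennreal_leI max.coboundedI1 mult_left_mono) auto
    show "ennreal (norm (dilate n \<beta> r f x)) = 0" if "i < n" "max (c * K) (r * K) < \<bar>x i\<bar>" for x i
    proof -
      have "K < \<bar>scale_point n r x i\<bar>"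
        using that r by (simp add: scale_point_def field_simps)
      then show ?thesis
        using K(3)[OF scale_point_space that(1)] by (simp add: norm)
    qed
  qed simp
qed

lemma integrable_tame_mult:
  assumes [measurable]: "f \<in> borel_measurable (Rn n)" and f: "tame n (\<lambda>x. ennreal (norm (f x)))" and g: "loc_int n g"
  shows "integrable (Rn n) (\<lambda>x. f x * g x)"
proof -
  have [measurable]: "g \<in> borel_measurable (Rn n)" using g by (rule loc_int_measurable)
  obtain K where K: "0 < K" "\<And>x. x \<in> space (Rn n) \<Longrightarrow> ennreal (norm (f x)) \<le> ennreal K"
    "\<And>x i. x \<in> space (Rn n) \<Longrightarrow> i < n \<Longrightarrow> K < \<bar>x i\<bar> \<Longrightarrow> ennreal (norm (f x)) = 0"
    using f by (rule tameE) (rule that, assumption, blast+)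
  have "(\<integral>\<^sup>+ x. ennreal (norm (f x * g x)) \<partial>Rn n)
      \<le> (\<integral>\<^sup>+ x. ennreal K * (ennreal (norm (g x)) * indicator (centred_box n K) x) \<partial>Rn n)"
  proof (rule nn_integral_mono)
    fix x assume x: "x \<in> space (Rn n)"
    show "ennreal (norm (f x * g x)) \<le> ennreal K * (ennreal (norm (g x)) * indicator (centred_box n K) x)"
    proof (cases "x \<in> centred_box n K")
      case True
      then show ?thesis
        using K(2)[OF x] by (simp add: norm_mult ennreal_mult mult_right_mono)
    next
      case False
      then obtain i where "i < n" "K < \<bar>x i\<bar>" by force
      then show ?thesis using K(3)[OF x] by simp
    qed
  qed
  also have "\<dots> < top"
    using g by (simp add: nn_integral_cmult loc_int_iff ennreal_mult_less_top)
  finally show ?thesis by (simp add: integrable_iff_bounded)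
qed

text \<open>Multiplication by the conjugate phase of g turns a pairing with g into an integral of
  moduli.\<close>

lemma cnj_sgn_mult: "cnj (sgn z) * z = of_real (norm z)"
proof -
  have "cnj (sgn z) * z = (z * cnj z) / of_real (norm z)"
    by (simp add: sgn_eq)
  also have "z * cnj z = of_real (norm z) * of_real (norm z)"
    by (simp add: complex_norm_square[symmetric] power2_eq_square)
  finally show ?thesis by simp
qed

lemma measurable_cnj_sgn:
  assumes [measurable]: "f \<in> borel_measurable M"
  shows "(\<lambda>x. cnj (sgn (f x))) \<in> borel_measurable M"
proof (rule measurable_compose[where f = "\<lambda>x. sgn (f x)" and g = cnj])
  show "(\<lambda>x. sgn (f x)) \<in> borel_measurable M"
    unfolding sgn_div_norm by measurable
  show "cnj \<in> borel_measurable borel"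
    by (intro borel_measurable_continuous_onI continuous_on_cnj continuous_on_id)
qed

locale strict_amalgam_exponents = amalgam_exponents +
  assumes p_gt: "\<And>i. i < n \<Longrightarrow> 1 < p i" and s_gt: "\<And>i. i < n \<Longrightarrow> 1 < s i"

context amalgam_exponents
begin

lemma tame_amalg_space:
  assumes "h \<in> borel_measurable (Rn n)" "tame n (\<lambda>x. ennreal (norm (h x)))"
  shows "h \<in> amalg_space n q t"
  using assms by (intro amalg_spaceI amalg_norm_tame q t)

lemma tame_dilate_block:
  assumes "h \<in> borel_measurable (Rn n)" "tame n (\<lambda>x. ennreal (norm (h x)))" "0 < r"
    "amalg_norm n q t (\<lambda>x. ennreal (norm (h x))) \<le> 1"
  shows "dilate n \<beta> r h \<in> block_space n q t \<beta>" "block_norm n q t \<beta> (dilate n \<beta> r h) \<le> 1"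
  using dilate_block[OF tame_amalg_space assms(3), of h 1] assms by (auto simp: amalg_r_1_eq)

end

context strict_amalgam_exponents
begin

text \<open>For each fixed r this is reduced to \<open>amalg_norm_le_by_duality\<close>: the weight
  c is divided out first and restored afterwards, and the complex test function is a nonnegative one
  times a phase.\<close>

lemma amalg_alpha_norm_le_by_duality:
  assumes g: "loc_int n g"
    and bound: "\<And>r h. 0 < r \<Longrightarrow> h \<in> borel_measurable (Rn n) \<Longrightarrow> tame n (\<lambda>x. ennreal (norm (h x))) \<Longrightarrow>
      amalg_norm n q t (\<lambda>x. ennreal (norm (h x))) \<le> 1 \<Longrightarrow> ennreal (norm (pairing n g (dilate n \<beta> r h))) \<le> C"
  shows "amalg_alpha_norm n p s \<alpha> g \<le> C"
proof -
  have gm[measurable]: "g \<in> borel_measurable (Rn n)" using g by (rule loc_int_measurable)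
  show ?thesis
    unfolding amalg_alpha_norm_eq[OF gm]
  proof (rule SUP_least)
    fix r :: real assume "r \<in> {0<..}"
    then have r: "0 < r" by simp
    define c where "c = r powr (real n * recip \<alpha>)"
    have c: "0 < c" using r by (simp add: c_def)
    define G where "G x = ennreal (norm (g (scale_point n (1 / r) x)))" for x
    have [measurable]: "G \<in> borel_measurable (Rn n)" unfolding G_def[abs_def] by measurable
    have "amalg_norm n p s G \<le> ennreal (1 / c) * C"
    proof (rule amalg_norm_le_by_duality[where p = p and s = s and n = n])
      fix F assume F: "tame n F" "amalg_norm n q t F \<le> 1"
      have [measurable]: "F \<in> borel_measurable (Rn n)" using F(1) by (simp add: tame_def)
      \<comment> \<open>\<open>scale_point n (1 / r)\<close> anticipates the dilation, so that the
        dilate of \<open>h\<close> carries the conjugate phase of g at x itself and its product with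
        g is nonnegative.\<close>
      define h where "h x = of_real (enn2real (F x)) * cnj (sgn (g (scale_point n (1 / r) x)))" for x
      have hm[measurable]: "h \<in> borel_measurable (Rn n)"
        unfolding h_def[abs_def] by (intro borel_measurable_times measurable_cnj_sgn) measurable
      have Ffin: "ennreal (enn2real (F x)) = F x" if x: "x \<in> space (Rn n)" for x
      proof -
        obtain K where "F x \<le> ennreal K" using F(1) x unfolding tame_def by blast
        then have "F x < top" by (rule le_less_trans) simp
        then show ?thesis by simp
      qed
      have h_le: "ennreal (norm (h x)) \<le> F x" if "x \<in> space (Rn n)" for x
      proof -
        have "norm (h x) \<le> enn2real (F x)"
          by (auto simp: h_def norm_mult norm_sgn)
        then have "ennreal (norm (h x)) \<le> ennreal (enn2real (F x))" by (rule ennreal_leI)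
        then show ?thesis by (simp add: Ffin that)
      qed
      have tame: "tame n (\<lambda>x. ennreal (norm (h x)))"
        using F(1) by (rule tame_mono) (simp_all add: h_le)
      have "amalg_norm n q t (\<lambda>x. ennreal (norm (h x))) \<le> amalg_norm n q t F"
        by (rule amalg_norm_mono[OF q t]) (simp_all add: h_le)
      then have h1: "amalg_norm n q t (\<lambda>x. ennreal (norm (h x))) \<le> 1"
        using F(2) by (rule order_trans)
      have int: "integrable (Rn n) (\<lambda>x. dilate n \<beta> r h x * g x)"
        using tame_dilate[OF hm tame r] by (intro integrable_tame_mult g) simp_all
      have pos: "dilate n \<beta> r h x * g x = of_real (norm (dilate n \<beta> r h x * g x))" if "x \<in> space (Rn n)" for x
      proof -
        define b where "b = r powr (- real n * recip \<beta>) * enn2real (F (scale_point n r x))"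
        have b: "0 \<le> b" by (simp add: b_def)
        have "dilate n \<beta> r h x * g x = of_real b * (cnj (sgn (g x)) * g x)"
          using scale_point_inverse[OF r that] by (simp add: dilate_eq h_def b_def)
        then have "dilate n \<beta> r h x * g x = of_real (b * norm (g x))"
          by (simp add: cnj_sgn_mult)
        then show ?thesis using b by (simp only: norm_of_real) simp
      qed
      have "pairing n g (dilate n \<beta> r h) = (\<integral>x. of_real (norm (dilate n \<beta> r h x * g x)) \<partial>Rn n)"
        unfolding pairing_def by (intro Bochner_Integration.integral_cong refl pos)
      also have "\<dots> = of_real (\<integral>x. norm (dilate n \<beta> r h x * g x) \<partial>Rn n)"
        by (rule integral_complex_of_real)
      finally have "norm (pairing n g (dilate n \<beta> r h)) = (\<integral>x. norm (dilate n \<beta> r h x * g x) \<partial>Rn n)"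
        by (simp add: Bochner_Integration.integral_nonneg)
      then have "ennreal (norm (pairing n g (dilate n \<beta> r h))) = (\<integral>\<^sup>+ x. ennreal (norm (dilate n \<beta> r h x * g x)) \<partial>Rn n)"
        using int by (subst nn_integral_eq_integral) auto
      also have "\<dots> = (\<integral>\<^sup>+ x. ennreal (norm (dilate n \<beta> r h x)) * ennreal (norm (g x)) \<partial>Rn n)"
        by (simp add: norm_mult ennreal_mult)
      also have "\<dots> = ennreal c * (\<integral>\<^sup>+ x. ennreal (norm (h x)) * G x \<partial>Rn n)"
        unfolding c_def G_def by (rule nn_integral_dilate'[OF r]) simp_all
      also have "(\<integral>\<^sup>+ x. ennreal (norm (h x)) * G x \<partial>Rn n) = (\<integral>\<^sup>+ x. F x * G x \<partial>Rn n)"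
      proof (rule nn_integral_cong)
        fix x assume x: "x \<in> space (Rn n)"
        show "ennreal (norm (h x)) * G x = F x * G x"
        proof (cases "g (scale_point n (1 / r) x) = 0")
          case False
          then have "norm (h x) = enn2real (F x)"
            by (simp add: h_def norm_mult norm_sgn)
          then show ?thesis using Ffin[OF x] by simp
        qed (simp add: G_def)
      qed
      finally have "ennreal c * (\<integral>\<^sup>+ x. F x * G x \<partial>Rn n) \<le> C"
        using bound[OF r hm tame h1] by simp
      then have "ennreal (1 / c) * (ennreal c * (\<integral>\<^sup>+ x. F x * G x \<partial>Rn n)) \<le> ennreal (1 / c) * C"
        by (rule mult_left_mono) simp
      also have "ennreal (1 / c) * (ennreal c * (\<integral>\<^sup>+ x. F x * G x \<partial>Rn n)) = (\<integral>\<^sup>+ x. F x * G x \<partial>Rn n)"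
        using c by (simp add: mult.assoc[symmetric] ennreal_mult[symmetric])
      finally show "(\<integral>\<^sup>+ x. F x * G x \<partial>Rn n) \<le> ennreal (1 / c) * C" .
    qed (simp_all add: p_gt s_gt)
    then have "ennreal c * amalg_norm n p s G \<le> ennreal c * (ennreal (1 / c) * C)"
      by (rule mult_left_mono) simp
    also have "\<dots> = C"
      using c by (simp add: mult.assoc[symmetric] ennreal_mult[symmetric])
    finally show "ennreal (r powr (real n * recip \<alpha>)) *
        amalg_norm n p s (\<lambda>x. ennreal (norm (g (scale_point n (1 / r) x)))) \<le> C"
      by (simp add: c_def G_def[abs_def])
  qed
qed

section \<open>Linearity, isometry and injectivity of the pairing\<close>

lemma pairing_linear:
  assumes g: "g \<in> amalg_alpha_space n p s \<alpha>" and h: "h \<in> amalg_alpha_space n p s \<alpha>"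
    and f: "f \<in> block_space n q t \<beta>"
  shows "pairing n (\<lambda>x. a * g x + b * h x) f = a * pairing n g f + b * pairing n h f"
proof -
  have "pairing n (\<lambda>x. a * g x + b * h x) f = (\<integral>x. a * (f x * g x) + b * (f x * h x) \<partial>Rn n)"
    unfolding pairing_def by (intro Bochner_Integration.integral_cong refl) (simp add: algebra_simps)
  also have "\<dots> = a * pairing n g f + b * pairing n h f"
    unfolding pairing_def using block_pairing(1)[OF g f] block_pairing(1)[OF h f] by simp
  finally show ?thesis .
qed

text \<open>Mixed norms have not been shown to be subadditive. Instead each pairing of the
  combination is bounded by linearity in g, and duality turns this into a bound for its
  norm.\<close>

lemma amalg_alpha_space_linear:
  assumes g: "g \<in> amalg_alpha_space n p s \<alpha>" and h: "h \<in> amalg_alpha_space n p s \<alpha>"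
  shows "(\<lambda>x. a * g x + b * h x) \<in> amalg_alpha_space n p s \<alpha>"
proof -
  have loc: "loc_int n (\<lambda>x. a * g x + b * h x)"
    using g h by (intro loc_int_add loc_int_cmult) (auto simp: amalg_alpha_space_def)
  define A B where "A = enn2real (amalg_alpha_norm n p s \<alpha> g)" and "B = enn2real (amalg_alpha_norm n p s \<alpha> h)"
  have "amalg_alpha_norm n p s \<alpha> (\<lambda>x. a * g x + b * h x) \<le> ennreal (norm a * A + norm b * B)"
  proof (rule amalg_alpha_norm_le_by_duality[OF loc])
    fix r :: real and u :: "(nat \<Rightarrow> real) \<Rightarrow> complex" assume u: "0 < r" "u \<in> borel_measurable (Rn n)" "tame n (\<lambda>x. ennreal (norm (u x)))"
      "amalg_norm n q t (\<lambda>x. ennreal (norm (u x))) \<le> 1"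
    define f where "f = dilate n \<beta> r u"
    have f: "f \<in> block_space n q t \<beta>" "block_norm n q t \<beta> f \<le> 1"
      unfolding f_def using u by (auto intro: tame_dilate_block)
    have "norm (pairing n k f) \<le> enn2real (amalg_alpha_norm n p s \<alpha> k)" if "k \<in> amalg_alpha_space n p s \<alpha>" for k
    proof -
      have "norm (pairing n k f) \<le> enn2real (amalg_alpha_norm n p s \<alpha> k) * block_norm n q t \<beta> f"
        by (rule block_pairing(2)[OF that f(1)])
      also have "\<dots> \<le> enn2real (amalg_alpha_norm n p s \<alpha> k) * 1"
        using f(2) by (intro mult_left_mono) auto
      finally show ?thesis by simp
    qed
    then have "norm a * norm (pairing n g f) + norm b * norm (pairing n h f) \<le> norm a * A + norm b * B"
      unfolding A_def B_def using g h by (intro add_mono mult_left_mono) auto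
    then have "norm (pairing n (\<lambda>x. a * g x + b * h x) f) \<le> norm a * A + norm b * B"
      unfolding pairing_linear[OF g h f(1)] norm_mult[symmetric]
      using norm_triangle_ineq order_trans by blast
    then show "ennreal (norm (pairing n (\<lambda>x. a * g x + b * h x) (dilate n \<beta> r u))) \<le> ennreal (norm a * A + norm b * B)"
      unfolding f_def by (rule ennreal_leI)
  qed
  also have "\<dots> < \<infinity>" by simp
  finally show ?thesis using loc by (simp add: amalg_alpha_space_def)
qed

lemma pairing_in_block_dual:
  assumes g: "g \<in> amalg_alpha_space n p s \<alpha>"
  shows "pairing n g \<in> block_dual n q t \<beta>"
  unfolding block_dual_def mem_Collect_eq
proof (intro conjI ballI allI)
  fix f h assume "f \<in> block_space n q t \<beta>" "h \<in> block_space n q t \<beta>"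
  then show "pairing n g (\<lambda>x. f x + h x) = pairing n g f + pairing n g h"
    unfolding pairing_def using block_pairing(1)[OF g] by (simp add: distrib_right)
next
  fix a f assume "f \<in> block_space n q t \<beta>"
  show "pairing n g (\<lambda>x. a * f x) = a * pairing n g f"
    unfolding pairing_def by (simp add: mult.assoc)
next
  show "\<exists>C. \<forall>f\<in>block_space n q t \<beta>. norm (pairing n g f) \<le> C * block_norm n q t \<beta> f"
    using block_pairing(2)[OF g] by blast
qed

lemma dual_norm_pairing:
  assumes g: "g \<in> amalg_alpha_space n p s \<alpha>"
  shows "ennreal (dual_norm n q t \<beta> (pairing n g)) = amalg_alpha_norm n p s \<alpha> g"
proof (rule antisym)
  define A where "A = enn2real (amalg_alpha_norm n p s \<alpha> g)"
  have A: "amalg_alpha_norm n p s \<alpha> g = ennreal A" "0 \<le> A"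
    using g by (auto simp: A_def amalg_alpha_space_def)
  define V where "V = {norm (pairing n g f) | f. f \<in> block_space n q t \<beta> \<and> block_norm n q t \<beta> f \<le> 1}"
  have dn: "dual_norm n q t \<beta> (pairing n g) = Sup V" by (simp add: dual_norm_def V_def)
  have upper: "x \<le> A" if "x \<in> V" for x
  proof -
    obtain f where f: "x = norm (pairing n g f)" "f \<in> block_space n q t \<beta>" "block_norm n q t \<beta> f \<le> 1"
      using \<open>x \<in> V\<close> by (auto simp: V_def)
    have "x \<le> A * block_norm n q t \<beta> f"
      unfolding f(1) A_def by (rule block_pairing(2)[OF g f(2)])
    also have "\<dots> \<le> A * 1" using f(3) A(2) by (rule mult_left_mono)
    finally show ?thesis by simp
  qed
  \<comment> \<open>The zero function shows that \<open>V\<close> is nonempty, which a real-valued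
    supremum requires.\<close>
  have zero: "amalg_norm n q t (\<lambda>x. ennreal (norm (0 :: complex))) = 0"
    by (subst amalg_norm_eq_0_iff[OF q t]) simp_all
  have tame0: "tame n (\<lambda>x. ennreal (norm (0 :: complex)))"
    by (rule tameI[where K = 0]) simp_all
  have "norm (pairing n g (dilate n \<beta> 1 (\<lambda>_. 0))) \<in> V"
    unfolding V_def using tame_dilate_block[of "\<lambda>_. 0" 1, OF _ tame0] zero by auto
  then have ne: "V \<noteq> {}" by auto
  show "ennreal (dual_norm n q t \<beta> (pairing n g)) \<le> amalg_alpha_norm n p s \<alpha> g"
    unfolding dn A(1) by (intro ennreal_leI cSup_least ne upper)
  show "amalg_alpha_norm n p s \<alpha> g \<le> ennreal (dual_norm n q t \<beta> (pairing n g))"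
  proof (rule amalg_alpha_norm_le_by_duality)
    show "loc_int n g" using g by (simp add: amalg_alpha_space_def)
    fix r :: real and h :: "(nat \<Rightarrow> real) \<Rightarrow> complex" assume "0 < r" "h \<in> borel_measurable (Rn n)" "tame n (\<lambda>x. ennreal (norm (h x)))"
      "amalg_norm n q t (\<lambda>x. ennreal (norm (h x))) \<le> 1"
    then have "norm (pairing n g (dilate n \<beta> r h)) \<in> V"
      unfolding V_def using tame_dilate_block by blast
    then show "ennreal (norm (pairing n g (dilate n \<beta> r h))) \<le> ennreal (dual_norm n q t \<beta> (pairing n g))"
      unfolding dn by (intro ennreal_leI cSup_upper bdd_aboveI[of _ A] upper)
  qed
qed

lemma pairing_injective:
  assumes g: "g \<in> amalg_alpha_space n p s \<alpha>" and h: "h \<in> amalg_alpha_space n p s \<alpha>"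
    and eq: "\<And>f. f \<in> block_space n q t \<beta> \<Longrightarrow> pairing n g f = pairing n h f"
  shows "AE x in Rn n. g x = h x"
proof -
  define u where "u x = 1 * g x + (-1) * h x" for x
  have u: "u \<in> amalg_alpha_space n p s \<alpha>"
    unfolding u_def[abs_def] by (rule amalg_alpha_space_linear[OF g h])
  then have loc: "loc_int n u" by (simp add: amalg_alpha_space_def)
  then have um[measurable]: "u \<in> borel_measurable (Rn n)" by (rule loc_int_measurable)
  have "amalg_alpha_norm n p s \<alpha> u \<le> 0"
  proof (rule amalg_alpha_norm_le_by_duality[OF loc])
    fix r :: real and k :: "(nat \<Rightarrow> real) \<Rightarrow> complex" assume "0 < r" "k \<in> borel_measurable (Rn n)" "tame n (\<lambda>x. ennreal (norm (k x)))"
      "amalg_norm n q t (\<lambda>x. ennreal (norm (k x))) \<le> 1"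
    then have f: "dilate n \<beta> r k \<in> block_space n q t \<beta>" by (intro tame_dilate_block(1))
    have "pairing n u (dilate n \<beta> r k) = 0"
      unfolding u_def[abs_def] pairing_linear[OF g h f] by (simp add: eq[OF f])
    then show "ennreal (norm (pairing n u (dilate n \<beta> r k))) \<le> 0" by simp
  qed
  then have "(SUP r\<in>{0<..}. ennreal (r powr (real n * recip \<alpha>)) *
      amalg_norm n p s (\<lambda>x. ennreal (norm (u (scale_point n (1 / r) x))))) \<le> 0"
    by (simp only: amalg_alpha_norm_eq[OF um])
  \<comment> \<open>The single scale r = 1 already forces u to vanish almost everywhere.\<close>
  then have "ennreal (1 powr (real n * recip \<alpha>)) *
      amalg_norm n p s (\<lambda>x. ennreal (norm (u (scale_point n (1 / 1) x)))) \<le> 0"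
    by (rule order_trans[OF SUP_upper, rotated]) simp
  then have "amalg_norm n p s (\<lambda>x. ennreal (norm (u (scale_point n 1 x)))) = 0"
    by simp
  then have "AE x in Rn n. ennreal (norm (u (scale_point n 1 x))) = 0"
    by (subst (asm) amalg_norm_eq_0_iff[OF p s]) simp_all
  then show ?thesis
    using AE_space
  proof eventually_elim
    case (elim x)
    have "scale_point n 1 x = x" using scale_point_inverse[of 1 x n] elim(2)
      by (auto simp: scale_point_def space_Rn PiE_def extensional_def fun_eq_iff)
    with elim(1) show ?case by (simp add: u_def)
  qed
qed

end

section \<open>Bounded functionals on the block space\<close>

text \<open>Functions here are total, while only their values on \<open>space (Rn n)\<close> carry
  meaning. The distinction is real: \<open>dilate_one\<close> identifies the dilate by 1 with f only
  on that space.\<close>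

lemma block_decomp_cong:
  assumes "block_decomp n q t \<beta> f c r fs" and eq: "\<And>x. x \<in> space (Rn n) \<Longrightarrow> f x = f' x"
  shows "block_decomp n q t \<beta> f' c r fs"
proof -
  have "(\<integral>\<^sup>+ x. ennreal (norm (f x - S x)) * indicator A x \<partial>Rn n)
      = (\<integral>\<^sup>+ x. ennreal (norm (f' x - S x)) * indicator A x \<partial>Rn n)" for S A
    by (intro nn_integral_cong) (simp add: eq)
  with assms(1) show ?thesis by (simp add: block_decomp_def conv_L1loc_def)
qed

lemma block_decomp_cong_iff:
  assumes "\<And>x. x \<in> space (Rn n) \<Longrightarrow> f x = f' x"
  shows "block_decomp n q t \<beta> f c r fs \<longleftrightarrow> block_decomp n q t \<beta> f' c r fs"
  using block_decomp_cong[of n q t \<beta> f c r fs f'] block_decomp_cong[of n q t \<beta> f' c r fs f] assms by auto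

lemma block_space_cong:
  assumes "\<And>x. x \<in> space (Rn n) \<Longrightarrow> f x = f' x"
  shows "f \<in> block_space n q t \<beta> \<longleftrightarrow> f' \<in> block_space n q t \<beta>"
    and "block_norm n q t \<beta> f = block_norm n q t \<beta> f'"
proof -
  have "f \<in> borel_measurable (Rn n) \<longleftrightarrow> f' \<in> borel_measurable (Rn n)"
    using assms by (rule measurable_cong)
  moreover have "(\<integral>\<^sup>+ x. ennreal (norm (f x)) * indicator A x \<partial>Rn n)
      = (\<integral>\<^sup>+ x. ennreal (norm (f' x)) * indicator A x \<partial>Rn n)" for A
    by (intro nn_integral_cong) (simp add: assms)
  ultimately have "loc_int n f \<longleftrightarrow> loc_int n f'"
    by (simp add: loc_int_iff)
  moreover have iff: "block_decomp n q t \<beta> f = block_decomp n q t \<beta> f'"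
    by (intro ext block_decomp_cong_iff) (rule assms)
  ultimately show "f \<in> block_space n q t \<beta> \<longleftrightarrow> f' \<in> block_space n q t \<beta>"
    by (simp add: block_space_def)
  show "block_norm n q t \<beta> f = block_norm n q t \<beta> f'"
    using iff by (simp add: block_norm_def)
qed

lemma dilate_one: "x \<in> space (Rn n) \<Longrightarrow> dilate n \<beta> 1 f x = f x"
  by (auto simp: dilate_eq scale_point_def space_Rn PiE_def extensional_def fun_eq_iff intro!: arg_cong[where f = f])

text \<open>Linearity and a bound C are packaged as a locale so that the difference of a functional
  and a pairing can be a second instance, with a larger constant. Nonnegativity of C lets it
  multiply estimates of block norms.\<close>

locale block_functional = strict_amalgam_exponents +
  fixes L :: "((nat \<Rightarrow> real) \<Rightarrow> complex) \<Rightarrow> complex" and C :: real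
  assumes L_add: "f \<in> block_space n q t \<beta> \<Longrightarrow> g \<in> block_space n q t \<beta> \<Longrightarrow> L (\<lambda>x. f x + g x) = L f + L g"
    and L_scale: "f \<in> block_space n q t \<beta> \<Longrightarrow> L (\<lambda>x. a * f x) = a * L f"
    and L_bound: "f \<in> block_space n q t \<beta> \<Longrightarrow> norm (L f) \<le> C * block_norm n q t \<beta> f"
    and C_nonneg: "0 \<le> C"
begin

lemma amalg_space_block:
  assumes "f \<in> amalg_space n q t"
  shows "f \<in> block_space n q t \<beta>"
proof -
  \<comment> \<open>Adding 1 keeps the bound positive when the norm is zero, as
    \<open>dilate_block\<close> demands.\<close>
  have "amalg_r n q t 1 f \<le> ennreal (enn2real (amalg_r n q t 1 f) + 1)"
    using assms by (cases "amalg_r n q t 1 f" rule: ennreal_cases) (auto simp: amalg_space_def intro: ennreal_leI)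
  then have "dilate n \<beta> 1 f \<in> block_space n q t \<beta>"
    by (intro dilate_block(1)[OF assms, where c = "enn2real (amalg_r n q t 1 f) + 1"]) (auto intro: add_nonneg_pos)
  then show ?thesis
    using block_space_cong(1)[of n "dilate n \<beta> 1 f" f] dilate_one by blast
qed

lemma dilate_in_block_space:
  assumes "f \<in> amalg_space n q t" "0 < r"
  shows "dilate n \<beta> r f \<in> block_space n q t \<beta>"
proof -
  have "amalg_r n q t 1 f \<le> ennreal (enn2real (amalg_r n q t 1 f) + 1)"
    using assms by (cases "amalg_r n q t 1 f" rule: ennreal_cases) (auto simp: amalg_space_def intro: ennreal_leI)
  then show ?thesis
    by (intro dilate_block(1)[OF assms, where c = "enn2real (amalg_r n q t 1 f) + 1"]) (auto intro: add_nonneg_pos)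
qed

lemma L_dilate_le:
  assumes f: "f \<in> amalg_space n q t" and r: "0 < r"
  shows "ennreal (norm (L (dilate n \<beta> r f))) \<le> ennreal C * amalg_r n q t 1 f"
proof -
  obtain a where a: "amalg_r n q t 1 f = ennreal a" "0 \<le> a"
    using f by (cases "amalg_r n q t 1 f" rule: ennreal_cases) (auto simp: amalg_space_def)
  have "norm (L (dilate n \<beta> r f)) \<le> C * a"
  proof (rule field_le_epsilon)
    fix e :: real assume e: "0 < e"
    \<comment> \<open>\<open>dilate_block\<close> demands a positive bound, so a is enlarged. The
      denominator C + 1 keeps C * c below C * a + e, also for C = 0.\<close>
    define c where "c = a + e / (C + 1)"
    have "0 < e / (C + 1)" using e C_nonneg by (simp add: add_nonneg_pos)
    then have c: "0 < c" "a \<le> c" using a(2) by (auto simp: c_def)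
    have "norm (L (dilate n \<beta> r f)) \<le> C * block_norm n q t \<beta> (dilate n \<beta> r f)"
      by (intro L_bound dilate_in_block_space f r)
    also have "\<dots> \<le> C * c"
      using c a by (intro mult_left_mono C_nonneg dilate_block(2)[OF f r c(1)]) (simp add: ennreal_leI)
    also have "\<dots> \<le> C * a + e"
      using e C_nonneg by (simp add: c_def distrib_left divide_le_eq mult.commute)
    finally show "norm (L (dilate n \<beta> r f)) \<le> C * a + e" .
  qed
  then show ?thesis using a C_nonneg by (simp add: ennreal_leI flip: ennreal_mult)
qed

lemma dominated_amalg_space:
  assumes "f \<in> borel_measurable (Rn n)" "amalg_norm n q t H < top"
    and "\<And>x. x \<in> space (Rn n) \<Longrightarrow> ennreal (norm (f x)) \<le> H x"
  shows "f \<in> amalg_space n q t"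
proof (intro amalg_spaceI q t assms(1))
  have "amalg_norm n q t (\<lambda>x. ennreal (norm (f x))) \<le> amalg_norm n q t H"
    by (rule amalg_norm_mono[OF q t]) (auto intro: assms(3))
  then show "amalg_norm n q t (\<lambda>x. ennreal (norm (f x))) < top"
    using assms(2) by (rule le_less_trans)
qed

text \<open>\<open>L\<close> acts on functions, not on classes, so its blindness to null sets has to
  be proved: the block norm of such an f is at most every e > 0.\<close>

lemma L_eq_0:
  assumes f[measurable]: "f \<in> borel_measurable (Rn n)" and "AE x in Rn n. f x = 0"
  shows "f \<in> block_space n q t \<beta>" "L f = 0"
proof -
  have 0: "amalg_norm n q t (\<lambda>x. ennreal (norm (f x))) = 0"
    using assms(2) by (subst amalg_norm_eq_0_iff[OF q t]) auto
  then have fa: "f \<in> amalg_space n q t" by (intro amalg_spaceI q t f) auto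
  then show fb: "f \<in> block_space n q t \<beta>" by (rule amalg_space_block)
  have "block_norm n q t \<beta> f \<le> 0"
  proof (rule field_le_epsilon)
    fix e :: real assume "0 < e"
    then have "block_norm n q t \<beta> (dilate n \<beta> 1 f) \<le> e"
      using dilate_block(2)[OF fa, of 1 e] 0 by (simp add: amalg_r_1_eq)
    then show "block_norm n q t \<beta> f \<le> 0 + e"
      using block_space_cong(2)[of n "dilate n \<beta> 1 f" f] dilate_one by simp
  qed
  then have "C * block_norm n q t \<beta> f \<le> 0" by (rule mult_nonneg_nonpos[OF C_nonneg])
  with L_bound[OF fb] have "norm (L f) \<le> 0" by (rule order_trans)
  then show "L f = 0" by simp
qed

lemma L_cong:
  assumes f: "f \<in> block_space n q t \<beta>" and eq: "\<And>x. x \<in> space (Rn n) \<Longrightarrow> f x = f' x"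
  shows "L f = L f'"
proof -
  have f': "f' \<in> block_space n q t \<beta>" using f block_space_cong(1)[of n f f' q t \<beta>] eq by blast
  have [measurable]: "f \<in> borel_measurable (Rn n)" "f' \<in> borel_measurable (Rn n)"
    using f f' by (auto simp: block_space_def intro: loc_int_measurable)
  have d: "(\<lambda>x. f' x - f x) \<in> block_space n q t \<beta>" "L (\<lambda>x. f' x - f x) = 0"
    by (rule L_eq_0; simp add: eq)+
  have "L (\<lambda>x. f x + (f' x - f x)) = L f + L (\<lambda>x. f' x - f x)"
    by (rule L_add[OF f d(1)])
  then show ?thesis by (simp add: d)
qed

text \<open>Conjugates of exponents above 1 are finite, so \<open>amalg_norm_dominated\<close>
  applies to the differences, which 2 * H dominates; \<open>L_dilate_le\<close> passes this on to
  L.\<close>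

lemma L_dominated:
  assumes r: "0 < r" and H: "amalg_norm n q t H < top" and [measurable]: "H \<in> borel_measurable (Rn n)"
    "\<And>m. f m \<in> borel_measurable (Rn n)" "g \<in> borel_measurable (Rn n)"
    and le: "\<And>m x. x \<in> space (Rn n) \<Longrightarrow> ennreal (norm (f m x)) \<le> H x"
      "\<And>x. x \<in> space (Rn n) \<Longrightarrow> ennreal (norm (g x)) \<le> H x"
    and lim: "\<And>x. x \<in> space (Rn n) \<Longrightarrow> (\<lambda>m. f m x) \<longlonglongrightarrow> g x"
  shows "(\<lambda>m. L (dilate n \<beta> r (f m))) \<longlonglongrightarrow> L (dilate n \<beta> r g)"
proof -
  define d where "d m x = f m x - g x" for m x
  have [measurable]: "d m \<in> borel_measurable (Rn n)" for m unfolding d_def[abs_def] by measurable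
  have fs: "f m \<in> amalg_space n q t" and gs: "g \<in> amalg_space n q t" for m
    by (rule dominated_amalg_space[OF _ H]; simp add: le)+
  have H2: "amalg_norm n q t (\<lambda>x. 2 * H x) < top"
    using H by (subst amalg_norm_cmult[OF q t]) (auto simp: ennreal_mult_less_top)
  have d_le: "ennreal (norm (d m x)) \<le> 2 * H x" if "x \<in> space (Rn n)" for m x
  proof -
    have "ennreal (norm (d m x)) \<le> ennreal (norm (f m x) + norm (g x))"
      unfolding d_def by (intro ennreal_leI norm_triangle_ineq4)
    also have "\<dots> \<le> H x + H x"
      using le[OF that] by (simp add: add_mono)
    finally show ?thesis by (simp add: mult_2)
  qed
  have ds: "d m \<in> amalg_space n q t" for m
    by (rule dominated_amalg_space[OF _ H2]) (simp_all add: d_le)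
  have "(\<lambda>m. amalg_norm n q t (\<lambda>x. ennreal (norm (d m x)))) \<longlonglongrightarrow> 0"
  proof (rule amalg_norm_dominated[OF q t _ _ _ _ d_le _ H2])
    show "conj_exp (p i) \<noteq> \<infinity>" "conj_exp (s i) \<noteq> \<infinity>" if "i < n" for i
      using that by (auto intro!: conj_exp_finite p_gt s_gt)
    fix x assume "x \<in> space (Rn n)"
    then have "(\<lambda>m. norm (d m x)) \<longlonglongrightarrow> 0"
      unfolding d_def using lim by (intro tendsto_norm_zero) (simp add: LIM_zero)
    then show "(\<lambda>m. ennreal (norm (d m x))) \<longlonglongrightarrow> 0"
      using tendsto_ennrealI by fastforce
  qed simp_all
  then have "(\<lambda>m. ennreal C * amalg_norm n q t (\<lambda>x. ennreal (norm (d m x)))) \<longlonglongrightarrow> ennreal C * 0"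
    by (intro ennreal_tendsto_cmult) auto
  then have lim0: "(\<lambda>m. ennreal C * amalg_norm n q t (\<lambda>x. ennreal (norm (d m x)))) \<longlonglongrightarrow> 0"
    by (simp only: mult_zero_right)
  have "ennreal (norm (L (dilate n \<beta> r (d m)))) \<le> ennreal C * amalg_norm n q t (\<lambda>x. ennreal (norm (d m x)))" for m
    using L_dilate_le[OF ds r] by (simp add: amalg_r_1_eq)
  then have "(\<lambda>m. ennreal (norm (L (dilate n \<beta> r (d m))))) \<longlonglongrightarrow> 0"
    by (intro tendsto_sandwich[OF _ _ tendsto_const lim0] always_eventually allI) simp_all
  then have "(\<lambda>m. L (dilate n \<beta> r (d m))) \<longlonglongrightarrow> 0"
    by (simp add: ennreal_tendsto_0_iff tendsto_norm_zero_iff)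
  moreover have "L (dilate n \<beta> r (d m)) = L (dilate n \<beta> r (f m)) - L (dilate n \<beta> r g)" for m
  proof -
    have B: "dilate n \<beta> r (f m) \<in> block_space n q t \<beta>" "dilate n \<beta> r g \<in> block_space n q t \<beta>"
      "dilate n \<beta> r (d m) \<in> block_space n q t \<beta>"
      by (intro dilate_in_block_space r fs gs ds)+
    have "L (\<lambda>x. dilate n \<beta> r g x + dilate n \<beta> r (d m) x) = L (dilate n \<beta> r g) + L (dilate n \<beta> r (d m))"
      by (rule L_add[OF B(2,3)])
    moreover have "(\<lambda>x. dilate n \<beta> r g x + dilate n \<beta> r (d m) x) = dilate n \<beta> r (f m)"
      by (auto simp: d_def dilate_eq algebra_simps)
    ultimately show ?thesis by simp
  qed
  ultimately show ?thesis by (simp add: LIM_zero_iff)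
qed

lemma L_dilate_one: "f \<in> amalg_space n q t \<Longrightarrow> L (dilate n \<beta> 1 f) = L f"
  using L_cong[of f "dilate n \<beta> 1 f"] amalg_space_block dilate_one by metis

lemma L_dominated':
  assumes "amalg_norm n q t H < top" "H \<in> borel_measurable (Rn n)"
    "\<And>m. f m \<in> borel_measurable (Rn n)" "g \<in> borel_measurable (Rn n)"
    and "\<And>m x. x \<in> space (Rn n) \<Longrightarrow> ennreal (norm (f m x)) \<le> H x"
      "\<And>x. x \<in> space (Rn n) \<Longrightarrow> ennreal (norm (g x)) \<le> H x"
    and "\<And>x. x \<in> space (Rn n) \<Longrightarrow> (\<lambda>m. f m x) \<longlonglongrightarrow> g x"
  shows "(\<lambda>m. L (f m)) \<longlonglongrightarrow> L g"
proof -
  have "f m \<in> amalg_space n q t" "g \<in> amalg_space n q t" for m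
    using assms by (auto intro!: dominated_amalg_space[of _ H])
  with L_dominated[of 1, OF _ assms] show ?thesis by (simp add: L_dilate_one)
qed

text \<open>A common majorant for the sum of the moduli puts all partial sums into the space at
  once, so that additivity can be applied term by term.\<close>

lemma L_sum:
  assumes "finite I" and H: "amalg_norm n q t H < top" and f[measurable]: "\<And>k. k \<in> I \<Longrightarrow> f k \<in> borel_measurable (Rn n)"
    and le: "\<And>x. x \<in> space (Rn n) \<Longrightarrow> (\<Sum>k\<in>I. norm (f k x)) \<le> h x" "\<And>x. x \<in> space (Rn n) \<Longrightarrow> ennreal (h x) \<le> H x"
  shows "L (\<lambda>x. \<Sum>k\<in>I. f k x) = (\<Sum>k\<in>I. L (f k))"
proof -
  have B: "(\<lambda>x. \<Sum>k\<in>J. f k x) \<in> block_space n q t \<beta>" if J: "J \<subseteq> I" for J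
  proof (intro amalg_space_block dominated_amalg_space[OF _ H])
    show "(\<lambda>x. \<Sum>k\<in>J. f k x) \<in> borel_measurable (Rn n)"
      using J by (intro borel_measurable_sum f) auto
    fix x assume x: "x \<in> space (Rn n)"
    have "norm (\<Sum>k\<in>J. f k x) \<le> (\<Sum>k\<in>J. norm (f k x))" by (rule norm_sum)
    also have "\<dots> \<le> (\<Sum>k\<in>I. norm (f k x))"
      using J \<open>finite I\<close> by (intro sum_mono2) auto
    also note le(1)[OF x]
    finally show "ennreal (norm (\<Sum>k\<in>J. f k x)) \<le> H x"
      using le(2)[OF x] ennreal_leI order_trans by blast
  qed
  have "J \<subseteq> I \<Longrightarrow> L (\<lambda>x. \<Sum>k\<in>J. f k x) = (\<Sum>k\<in>J. L (f k))" if "finite J" for J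
    using that
  proof (induction J)
    case empty
    then show ?case using L_eq_0(2)[of "\<lambda>_. 0"] by simp
  next
    case (insert k J)
    have "f k \<in> block_space n q t \<beta>" using B[of "{k}"] insert.prems by simp
    then have "L (\<lambda>x. f k x + (\<Sum>k\<in>J. f k x)) = L (f k) + L (\<lambda>x. \<Sum>k\<in>J. f k x)"
      using insert.prems by (intro L_add B) auto
    with insert show ?case by simp
  qed
  then show ?thesis using \<open>finite I\<close> by blast
qed

section \<open>Densities on single cubes\<close>

lemma cell_density:
  obtains g where "integrable (Rn n) g" "\<And>A. A \<in> sets (Rn n) \<Longrightarrow>
    L (\<lambda>x. indicator (A \<inter> cube n 1 k) x) = (\<integral>x. indicator (A \<inter> cube n 1 k) x * g x \<partial>Rn n)"
proof -
  define Q where "Q = cube n 1 k"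
  have pred_Q[measurable]: "Measurable.pred (Rn n) (\<lambda>x. x \<in> Q)" by (simp add: Q_def)
  have Qm[measurable]: "(\<lambda>x. indicator Q x :: ennreal) \<in> borel_measurable (Rn n)"
    unfolding indicator_def by measurable
  \<comment> \<open>On a single cube the indicator of Q has finite norm. It dominates all partial
    sums of disjoint indicators and, multiplied by C, bounds the set function.\<close>
  have H: "amalg_norm n q t (indicator Q) < top"
    unfolding Q_def by (intro amalg_norm_tame q t tame_indicator_cube)
  have AQ: "A \<inter> Q \<in> sets (Rn n)" if A: "A \<in> sets (Rn n)" for A
  proof -
    have "A \<inter> Q = {x \<in> space (Rn n). x \<in> A \<and> x \<in> Q}"
      using sets.sets_into_space[OF A] by auto
    also have "\<dots> \<in> sets (Rn n)" using A by measurable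
    finally show ?thesis .
  qed
  define ind where "ind A x = (indicator (A \<inter> Q) x :: complex)" for A x
  have indm: "ind A \<in> borel_measurable (Rn n)" if "A \<in> sets (Rn n)" for A
    unfolding ind_def[abs_def] using AQ[OF that] by measurable
  have ind_le: "ennreal (norm (ind A x)) \<le> indicator Q x" for A x
    by (auto simp: ind_def indicator_def)
  have sums: "(\<lambda>i. L (ind (A i))) sums L (ind (\<Union>i. A i))"
    if A: "range A \<subseteq> sets (Rn n)" "disjoint_family A" for A :: "nat \<Rightarrow> _"
  proof -
    have disj: "A i \<inter> Q \<inter> (A j \<inter> Q) = {}" if "i \<noteq> j" for i j
      using A(2) that by (auto simp: disjoint_family_on_def)
    have s: "(\<lambda>i. indicator (A i \<inter> Q) x :: real) sums indicator (\<Union>i. A i \<inter> Q) x" for x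
      by (rule indicator_sums) (rule disj)
    have U: "(\<Union>i. A i \<inter> Q) = (\<Union>i. A i) \<inter> Q" by auto
    have ind_of_real: "ind B x = of_real (indicator (B \<inter> Q) x)" for B x
      by (auto simp: ind_def indicator_def)
    have lim: "(\<lambda>m. \<Sum>i<m. ind (A i) x) \<longlonglongrightarrow> ind (\<Union>i. A i) x" for x
    proof -
      have "(\<lambda>m. complex_of_real (\<Sum>i<m. indicator (A i \<inter> Q) x)) \<longlonglongrightarrow> of_real (indicator ((\<Union>i. A i) \<inter> Q) x)"
        using s[of x] unfolding sums_def U by (rule tendsto_of_real)
      then show ?thesis by (simp add: ind_of_real)
    qed
    have part: "(\<Sum>i<m. norm (ind (A i) x)) \<le> indicator Q x" for m x
    proof -
      have "(\<Sum>i<m. norm (ind (A i) x)) = (\<Sum>i<m. indicator (A i \<inter> Q) x)"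
        by (simp add: ind_of_real)
      also have "\<dots> \<le> (\<Sum>i. indicator (A i \<inter> Q) x)"
        by (intro sum_le_suminf sums_summable[OF s]) auto
      also have "\<dots> = indicator (\<Union>i. A i \<inter> Q) x" using s by (simp add: sums_iff)
      also have "\<dots> \<le> indicator Q x" by (auto simp: indicator_def)
      finally show ?thesis .
    qed
    have Am: "ind (A i) \<in> borel_measurable (Rn n)" for i using A(1) by (intro indm) auto
    have ennind: "ennreal (indicator Q x) = indicator Q x" for x by (auto simp: indicator_def)
    have "L (\<lambda>x. \<Sum>i<m. ind (A i) x) = (\<Sum>i<m. L (ind (A i)))" for m
      by (rule L_sum[OF _ H, where h = "indicator Q"]) (simp_all add: Am part ennind)
    moreover have "(\<lambda>m. L (\<lambda>x. \<Sum>i<m. ind (A i) x)) \<longlonglongrightarrow> L (ind (\<Union>i. A i))"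
    proof (rule L_dominated'[OF H Qm])
      show "(\<lambda>x. \<Sum>i<m. ind (A i) x) \<in> borel_measurable (Rn n)" for m
        by (intro borel_measurable_sum Am)
      show "ind (\<Union>i. A i) \<in> borel_measurable (Rn n)"
        using A(1) by (intro indm) auto
      show "ennreal (norm (\<Sum>i<m. ind (A i) x)) \<le> indicator Q x" for m x
        unfolding ennind[symmetric] using norm_sum part by (intro ennreal_leI) (rule order_trans)
    qed (rule ind_le, rule lim)
    ultimately show ?thesis by (simp add: sums_def)
  qed
  have null: "L (ind A) = 0" if A: "A \<in> null_sets (Rn n)" for A
  proof (rule L_eq_0)
    show "ind A \<in> borel_measurable (Rn n)" using A by (intro indm) auto
    show "AE x in Rn n. ind A x = 0"
      using AE_not_in[OF A] by eventually_elim (auto simp: ind_def)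
  qed
  obtain K where K: "amalg_norm n q t (indicator Q) = ennreal K" "0 \<le> K"
    using H by (cases "amalg_norm n q t (indicator Q)" rule: ennreal_cases) auto
  have bdd: "norm (L (ind A)) \<le> C * K" if A: "A \<in> sets (Rn n)" for A
  proof -
    have inds: "ind A \<in> amalg_space n q t"
      by (rule dominated_amalg_space[OF indm[OF A] H ind_le])
    have "ennreal (norm (L (ind A))) \<le> ennreal C * amalg_norm n q t (\<lambda>x. ennreal (norm (ind A x)))"
      using L_dilate_le[OF inds, of 1] by (simp add: L_dilate_one[OF inds] amalg_r_1_eq)
    also have "\<dots> \<le> ennreal C * ennreal K"
      unfolding K(1)[symmetric] by (intro mult_left_mono amalg_norm_mono[OF q t] ind_le) simp_all
    finally show ?thesis using C_nonneg K(2) by (simp add: ennreal_le_iff flip: ennreal_mult)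
  qed
  have sf: "sigma_finite_measure (Rn n)"
    unfolding Rn_def by (rule lborel.prod.sigma_finite) simp
  have bRe: "\<bar>Re (L (ind A))\<bar> \<le> C * K" and bIm: "\<bar>Im (L (ind A))\<bar> \<le> C * K" if "A \<in> sets (Rn n)" for A
    using bdd[OF that] abs_Re_le_cmod[of "L (ind A)"] abs_Im_le_cmod[of "L (ind A)"] by linarith+
  obtain u where u: "integrable (Rn n) u" "\<And>A. A \<in> sets (Rn n) \<Longrightarrow> Re (L (ind A)) = (\<integral>x. indicator A x * u x \<partial>Rn n)"
    by (rule Radon_Nikodym_real[OF sf sums_Re[OF sums] _ bRe]) (auto simp: null)
  obtain v where v: "integrable (Rn n) v" "\<And>A. A \<in> sets (Rn n) \<Longrightarrow> Im (L (ind A)) = (\<integral>x. indicator A x * v x \<partial>Rn n)"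
    by (rule Radon_Nikodym_real[OF sf sums_Im[OF sums] _ bIm]) (auto simp: null)
  define g where "g x = complex_of_real (u x) + \<i> * complex_of_real (v x)" for x
  have g: "integrable (Rn n) g"
    unfolding g_def[abs_def] using u(1) v(1) by auto
  have "L (ind A) = (\<integral>x. indicator (A \<inter> Q) x * g x \<partial>Rn n)" if A: "A \<in> sets (Rn n)" for A
  proof -
    \<comment> \<open>Since \<open>ind\<close> already contains the intersection with Q, applying
      the density formulas to A \<inter> Q leaves the left side unchanged and brings Q into the
      integral.\<close>
    have eq: "ind (A \<inter> Q) = ind A" by (auto simp: ind_def fun_eq_iff)
    have int: "integrable (Rn n) (\<lambda>x. indicator (A \<inter> Q) x * w x)" if "integrable (Rn n) w" for w :: "_ \<Rightarrow> real"
      using integrable_real_mult_indicator[OF AQ[OF A] that] by (simp add: mult.commute)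
    have "(\<integral>x. indicator (A \<inter> Q) x * g x \<partial>Rn n)
        = (\<integral>x. complex_of_real (indicator (A \<inter> Q) x * u x) + \<i> * complex_of_real (indicator (A \<inter> Q) x * v x) \<partial>Rn n)"
      by (intro Bochner_Integration.integral_cong refl) (auto simp: g_def indicator_def)
    also have "\<dots> = complex_of_real (\<integral>x. indicator (A \<inter> Q) x * u x \<partial>Rn n) + \<i> * complex_of_real (\<integral>x. indicator (A \<inter> Q) x * v x \<partial>Rn n)"
      using int[OF u(1)] int[OF v(1)]
      by (subst Bochner_Integration.integral_add) (auto simp del: of_real_mult)
    also have "\<dots> = L (ind (A \<inter> Q))"
      using u(2)[OF AQ[OF A]] v(2)[OF AQ[OF A]] by (simp add: complex_eq_iff)
    finally show ?thesis by (simp add: eq)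
  qed
  with g show thesis
    by (intro that[of g]) (simp_all add: ind_def[abs_def] Q_def)
qed

text \<open>Linearity gives the formula for simple functions. In the limit the left side is
  controlled by \<open>L_dominated'\<close>, the right side by dominated convergence with an
  integrable multiple of |g|.\<close>

lemma cell_representation:
  assumes g: "integrable (Rn n) g" and A: "\<And>A. A \<in> sets (Rn n) \<Longrightarrow>
      L (\<lambda>x. indicator (A \<inter> cube n 1 k) x) = (\<integral>x. indicator (A \<inter> cube n 1 k) x * g x \<partial>Rn n)"
    and f[measurable]: "f \<in> borel_measurable (Rn n)" and K: "\<And>x. x \<in> space (Rn n) \<Longrightarrow> norm (f x) \<le> K"
  shows "L (\<lambda>x. f x * indicator (cube n 1 k) x) = (\<integral>x. f x * indicator (cube n 1 k) x * g x \<partial>Rn n)"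
proof -
  define Q where "Q = cube n 1 k"
  have pred_Q[measurable]: "Measurable.pred (Rn n) (\<lambda>x. x \<in> Q)" by (simp add: Q_def)
  have Qm[measurable]: "(\<lambda>x. indicator Q x :: ennreal) \<in> borel_measurable (Rn n)"
    "(\<lambda>x. indicator Q x :: complex) \<in> borel_measurable (Rn n)"
    unfolding indicator_def by measurable
  have g'[measurable]: "g \<in> borel_measurable (Rn n)" using g by simp
  \<comment> \<open>The approximating simple functions are only known to satisfy norm (S i x) \<le>
    2 * norm (f x), whence the factor 2.\<close>
  define H where "H x = ennreal (2 * \<bar>K\<bar>) * indicator Q x" for x
  have Hm[measurable]: "H \<in> borel_measurable (Rn n)" unfolding H_def[abs_def] by measurable
  have H: "amalg_norm n q t H < top"
    unfolding H_def[abs_def] using amalg_norm_tame[OF q t tame_indicator_cube]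
    by (subst amalg_norm_cmult[OF q t]) (auto simp: Q_def ennreal_mult_less_top)
  obtain S where S: "\<And>i. simple_function (Rn n) (S i)" "\<And>x. x \<in> space (Rn n) \<Longrightarrow> (\<lambda>i. S i x) \<longlonglongrightarrow> f x"
    "\<And>i x. x \<in> space (Rn n) \<Longrightarrow> dist (S i x) 0 \<le> 2 * dist (f x) 0"
    using borel_measurable_implies_sequence_metric[OF f, of 0] by blast
  have Sm[measurable]: "S i \<in> borel_measurable (Rn n)" for i using S(1) by (rule borel_measurable_simple_function)
  have S_le: "norm (S i x) \<le> 2 * \<bar>K\<bar>" if "x \<in> space (Rn n)" for i x
    using S(3)[OF that, of i] K[OF that] by simp
  have dom: "ennreal (norm (h x * indicator Q x)) \<le> H x" if "norm (h x) \<le> 2 * \<bar>K\<bar>" for h :: "_ \<Rightarrow> complex" and x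
    using that by (auto simp: H_def indicator_def intro: ennreal_leI)
  have simple: "L (\<lambda>x. S i x * indicator Q x) = (\<integral>x. S i x * indicator Q x * g x \<partial>Rn n)" for i
  proof -
    define R where "R = S i ` space (Rn n)"
    have R: "finite R" using S(1)[of i] by (simp add: R_def simple_function_def)
    define A where "A y = S i -` {y} \<inter> space (Rn n)" for y
    have Am: "A y \<in> sets (Rn n)" for y
      unfolding A_def using simple_functionD(2)[OF S(1)] by blast
    have AQ: "A y \<inter> Q \<in> sets (Rn n)" for y
    proof -
      have "A y \<inter> Q = {x \<in> space (Rn n). x \<in> A y \<and> x \<in> Q}" by (auto simp: A_def)
      also have "\<dots> \<in> sets (Rn n)" using Am[of y] by measurable
      finally show ?thesis .
    qed
    have im[measurable]: "(\<lambda>x. indicator (A y \<inter> Q) x :: complex) \<in> borel_measurable (Rn n)" for y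
      using AQ by measurable
    have ex: "(\<Sum>y\<in>R. y * indicator (A y \<inter> Q) x) = S i x * indicator Q x" if x: "x \<in> space (Rn n)" for x
    proof -
      have "(\<Sum>y\<in>R. y * indicator (A y \<inter> Q) x) = (\<Sum>y\<in>R. if y = S i x then y * indicator Q x else 0)"
        using x by (intro sum.cong) (auto simp: A_def indicator_def)
      also have "\<dots> = S i x * indicator Q x"
        using R x by (subst sum.delta) (auto simp: R_def)
      finally show ?thesis .
    qed
    have ex': "(\<Sum>y\<in>R. norm (y * indicator (A y \<inter> Q) x)) = norm (S i x * indicator Q x)" if x: "x \<in> space (Rn n)" for x
    proof -
      have "(\<Sum>y\<in>R. norm (y * indicator (A y \<inter> Q) x)) = (\<Sum>y\<in>R. if y = S i x then norm (y * indicator Q x) else 0)"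
        using x by (intro sum.cong) (auto simp: A_def indicator_def)
      also have "\<dots> = norm (S i x * indicator Q x)"
        using R x by (subst sum.delta) (auto simp: R_def)
      finally show ?thesis .
    qed
    have ind_block: "(\<lambda>x. indicator (A y \<inter> Q) x) \<in> block_space n q t \<beta>" for y
    proof (intro amalg_space_block dominated_amalg_space[OF im])
      show "amalg_norm n q t (indicator Q) < top"
        unfolding Q_def by (intro amalg_norm_tame q t tame_indicator_cube)
    qed (auto simp: indicator_def)
    have SB: "(\<lambda>x. S i x * indicator Q x) \<in> block_space n q t \<beta>"
      by (intro amalg_space_block dominated_amalg_space[OF _ H] dom S_le) simp_all
    have "L (\<lambda>x. S i x * indicator Q x) = L (\<lambda>x. \<Sum>y\<in>R. y * indicator (A y \<inter> Q) x)"
      by (rule L_cong[OF SB]) (simp add: ex)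
    also have "\<dots> = (\<Sum>y\<in>R. L (\<lambda>x. y * indicator (A y \<inter> Q) x))"
      by (rule L_sum[OF R H, where h = "\<lambda>x. norm (S i x * indicator Q x)"])
        (simp, simp add: ex', intro dom S_le)
    also have "\<dots> = (\<Sum>y\<in>R. y * (\<integral>x. indicator (A y \<inter> Q) x * g x \<partial>Rn n))"
    proof (rule sum.cong[OF refl])
      fix y
      show "L (\<lambda>x. y * indicator (A y \<inter> Q) x) = y * (\<integral>x. indicator (A y \<inter> Q) x * g x \<partial>Rn n)"
        using L_scale[OF ind_block[of y], of y] A[OF Am[of y]] by (simp add: Q_def)
    qed
    also have "\<dots> = (\<Sum>y\<in>R. \<integral>x. y * indicator (A y \<inter> Q) x * g x \<partial>Rn n)"
      by (simp add: mult.assoc)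
    also have "\<dots> = (\<integral>x. (\<Sum>y\<in>R. y * indicator (A y \<inter> Q) x * g x) \<partial>Rn n)"
    proof (rule Bochner_Integration.integral_sum[symmetric])
      fix y
      have "integrable (Rn n) (\<lambda>x. y * (indicator (A y \<inter> Q) x *\<^sub>R g x))"
        by (intro integrable_mult_right integrable_mult_indicator AQ g)
      moreover have "(\<lambda>x. y * (indicator (A y \<inter> Q) x *\<^sub>R g x)) = (\<lambda>x. y * indicator (A y \<inter> Q) x * g x)"
        by (auto simp: indicator_def fun_eq_iff)
      ultimately show "integrable (Rn n) (\<lambda>x. y * indicator (A y \<inter> Q) x * g x)" by simp
    qed
    also have "\<dots> = (\<integral>x. S i x * indicator Q x * g x \<partial>Rn n)"
      by (intro Bochner_Integration.integral_cong refl) (simp add: sum_distrib_right[symmetric] ex)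
    finally show ?thesis .
  qed
  have "(\<lambda>i. L (\<lambda>x. S i x * indicator Q x)) \<longlonglongrightarrow> L (\<lambda>x. f x * indicator Q x)"
  proof (rule L_dominated'[OF H Hm])
    show "ennreal (norm (S i x * indicator Q x)) \<le> H x" if "x \<in> space (Rn n)" for i x
      by (intro dom S_le that)
    show "ennreal (norm (f x * indicator Q x)) \<le> H x" if "x \<in> space (Rn n)" for x
      using K[OF that] by (intro dom) auto
  qed (auto intro!: tendsto_mult_right S)
  moreover have "(\<lambda>i. \<integral>x. S i x * indicator Q x * g x \<partial>Rn n) \<longlonglongrightarrow> (\<integral>x. f x * indicator Q x * g x \<partial>Rn n)"
  proof (rule integral_dominated_convergence[where w = "\<lambda>x. 2 * \<bar>K\<bar> * norm (g x)"])
    show "integrable (Rn n) (\<lambda>x. 2 * \<bar>K\<bar> * norm (g x))" using g by simp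
    show "AE x in Rn n. (\<lambda>i. S i x * indicator Q x * g x) \<longlonglongrightarrow> f x * indicator Q x * g x"
      by (intro AE_I2 tendsto_mult_right S)
    show "AE x in Rn n. norm (S i x * indicator Q x * g x) \<le> 2 * \<bar>K\<bar> * norm (g x)" for i
    proof (intro AE_I2)
      fix x assume "x \<in> space (Rn n)"
      then have "norm (S i x) * norm (g x) \<le> 2 * \<bar>K\<bar> * norm (g x)"
        by (intro mult_right_mono S_le) auto
      then show "norm (S i x * indicator Q x * g x) \<le> 2 * \<bar>K\<bar> * norm (g x)"
        by (auto simp: norm_mult indicator_def)
    qed
  qed simp_all
  ultimately show ?thesis
    unfolding Q_def[symmetric] simple by (rule LIMSEQ_unique)
qed

end

section \<open>Cubes meeting a box\<close>

lemma cell_centred_box: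
  assumes "x \<in> centred_box n R"
  shows "cell n x \<in> PiE {..<n} (\<lambda>_. {-\<lceil>R\<rceil>..\<lceil>R\<rceil>})"
proof -
  have "- \<lceil>R\<rceil> \<le> \<lfloor>x i\<rfloor>" "\<lfloor>x i\<rfloor> \<le> \<lceil>R\<rceil>" if "i < n" for i
  proof -
    have "- R \<le> x i" "x i \<le> R" using assms that by auto
    then show "- \<lceil>R\<rceil> \<le> \<lfloor>x i\<rfloor>" "\<lfloor>x i\<rfloor> \<le> \<lceil>R\<rceil>" by linarith+
  qed
  then show ?thesis by (simp add: cell_def)
qed

lemma sum_indicator_cubes:
  fixes z :: "'a :: comm_semiring_1"
  assumes "J \<subseteq> cells n" "finite J"
  shows "(\<Sum>k\<in>J. z * indicator (cube n 1 k) x) = (if cell n x \<in> J then z else 0)"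
proof -
  have "(\<Sum>k\<in>J. z * indicator (cube n 1 k) x) = (\<Sum>k\<in>J. if k = cell n x then z else 0)"
  proof (rule sum.cong[OF refl])
    fix k assume "k \<in> J"
    then have "k \<in> cells n" using assms(1) by blast
    then show "z * indicator (cube n 1 k) x = (if k = cell n x then z else 0)"
      using mem_cube_iff[of k n x] by (auto simp: indicator_def)
  qed
  also have "\<dots> = (if cell n x \<in> J then z else 0)"
    using assms(2) by (simp add: sum.delta')
  finally show ?thesis .
qed

section \<open>Partial sums and remainders of block decompositions\<close>

lemma loc_int_sum:
  assumes "\<And>j. j < N \<Longrightarrow> loc_int n (f j)"
  shows "loc_int n (\<lambda>x. \<Sum>j<(N :: nat). f j x)"
  using assms
proof (induction N)
  case 0
  then show ?case by (simp add: loc_int_iff)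
next
  case (Suc N)
  then show ?case by (simp add: loc_int_add)
qed

text \<open>With zero coefficients from N on, the series is eventually constant and converges
  trivially.\<close>

lemma block_decomp_partial_sum:
  assumes "block_decomp n q t \<beta> f c r fs"
  shows "block_decomp n q t \<beta> (\<lambda>x. \<Sum>j<N. c j * dilate n \<beta> (r j) (fs j) x) (\<lambda>j. if j < N then c j else 0) r fs"
  unfolding block_decomp_def
proof (intro conjI)
  show "summable (\<lambda>j. norm (if j < N then c j else 0))"
    by (rule summable_finite[of "{..<N}"]) auto
  have "(\<Sum>j<M. (if j < N then c j else 0) * dilate n \<beta> (r j) (fs j) x) = (\<Sum>j<N. c j * dilate n \<beta> (r j) (fs j) x)"
    if "N \<le> M" for M x
    using that by (intro sum.mono_neutral_cong_right) auto
  then show "conv_L1loc n (\<lambda>M x. \<Sum>j<M. (if j < N then c j else 0) * dilate n \<beta> (r j) (fs j) x)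
      (\<lambda>x. \<Sum>j<N. c j * dilate n \<beta> (r j) (fs j) x)"
    unfolding conv_L1loc_def
    by (intro allI tendsto_eventually eventually_mono[OF eventually_ge_at_top[of N]]) simp
qed (use assms in \<open>auto simp: block_decomp_def\<close>)

text \<open>Shifting a decomposition decomposes the remainder, whose block norm is therefore at most
  a tail of the coefficient sum. This replaces a separate proof that the series converges in the
  block norm.\<close>

lemma block_decomp_tail:
  assumes "block_decomp n q t \<beta> f c r fs"
  shows "block_decomp n q t \<beta> (\<lambda>x. f x - (\<Sum>j<N. c j * dilate n \<beta> (r j) (fs j) x))
    (\<lambda>j. c (j + N)) (\<lambda>j. r (j + N)) (\<lambda>j. fs (j + N))"
  unfolding block_decomp_def
proof (intro conjI)
  show "summable (\<lambda>j. norm (c (j + N)))"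
    using assms by (subst summable_iff_shift[of "\<lambda>j. norm (c j)"]) (simp add: block_decomp_def)
  have eq: "f x - (\<Sum>j<N. c j * dilate n \<beta> (r j) (fs j) x) - (\<Sum>j<M. c (j + N) * dilate n \<beta> (r (j + N)) (fs (j + N)) x)
      = f x - (\<Sum>j<M + N. c j * dilate n \<beta> (r j) (fs j) x)" for M x
  proof -
    have "(\<Sum>j<M + N. c j * dilate n \<beta> (r j) (fs j) x) = (\<Sum>j<N. c j * dilate n \<beta> (r j) (fs j) x)
        + (\<Sum>j<M. c (j + N) * dilate n \<beta> (r (j + N)) (fs (j + N)) x)"
      by (induction M) simp_all
    then show ?thesis by simp
  qed
  show "conv_L1loc n (\<lambda>M x. \<Sum>j<M. c (j + N) * dilate n \<beta> (r (j + N)) (fs (j + N)) x)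
      (\<lambda>x. f x - (\<Sum>j<N. c j * dilate n \<beta> (r j) (fs j) x))"
    using assms unfolding conv_L1loc_def eq block_decomp_def
    by (auto intro: LIMSEQ_ignore_initial_segment)
qed (use assms in \<open>auto simp: block_decomp_def\<close>)

section \<open>Gluing the densities; functionals determined by tame functions\<close>

context block_functional
begin

lemma tame_representation:
  obtains g where "loc_int n g"
    "\<And>f. f \<in> borel_measurable (Rn n) \<Longrightarrow> tame n (\<lambda>x. ennreal (norm (f x))) \<Longrightarrow> L f = (\<integral>x. f x * g x \<partial>Rn n)"
proof -
  have "\<exists>g. integrable (Rn n) g \<and> (\<forall>A\<in>sets (Rn n).
      L (\<lambda>x. indicator (A \<inter> cube n 1 k) x) = (\<integral>x. indicator (A \<inter> cube n 1 k) x * g x \<partial>Rn n))" for k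
    by (rule cell_density[of k]) blast
  then obtain \<gamma> where \<gamma>: "\<And>k. integrable (Rn n) (\<gamma> k)"
    and L\<gamma>: "\<And>k A. A \<in> sets (Rn n) \<Longrightarrow>
      L (\<lambda>x. indicator (A \<inter> cube n 1 k) x) = (\<integral>x. indicator (A \<inter> cube n 1 k) x * \<gamma> k x \<partial>Rn n)"
    by metis
  have \<gamma>m[measurable]: "\<gamma> k \<in> borel_measurable (Rn n)" for k using \<gamma> by (rule borel_measurable_integrable)
  define g where "g x = \<gamma> (cell n x) x" for x
  have gm[measurable]: "g \<in> borel_measurable (Rn n)"
    unfolding g_def[abs_def] by (rule measurable_glue[OF \<gamma>m])
  \<comment> \<open>Finitely many cubes cover the box of radius K. So on a box g is controlled by
    finitely many integrable densities, and a tame f splits into finitely many bounded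
    pieces.\<close>
  define J where "J K = PiE {..<n} (\<lambda>_. {-\<lceil>K\<rceil>..\<lceil>K\<rceil>})" for K :: real
  have J: "finite (J K)" "J K \<subseteq> cells n" for K
  proof -
    show "finite (J K)" unfolding J_def by (rule finite_PiE) simp_all
    show "J K \<subseteq> cells n" unfolding J_def by (rule PiE_mono) simp
  qed
  have "(\<integral>\<^sup>+ x. ennreal (norm (g x)) * indicator (centred_box n R) x \<partial>Rn n) < top" for R
  proof -
    have "(\<integral>\<^sup>+ x. ennreal (norm (g x)) * indicator (centred_box n R) x \<partial>Rn n)
        \<le> (\<integral>\<^sup>+ x. (\<Sum>k\<in>J R. ennreal (norm (\<gamma> k x))) \<partial>Rn n)"
    proof (rule nn_integral_mono)
      fix x
      show "ennreal (norm (g x)) * indicator (centred_box n R) x \<le> (\<Sum>k\<in>J R. ennreal (norm (\<gamma> k x)))"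
      proof (cases "x \<in> centred_box n R")
        case True
        then have "cell n x \<in> J R" unfolding J_def by (rule cell_centred_box)
        then have "ennreal (norm (\<gamma> (cell n x) x)) \<le> (\<Sum>k\<in>J R. ennreal (norm (\<gamma> k x)))"
          using J by (intro member_le_sum) auto
        with True show ?thesis by (simp add: g_def)
      qed simp
    qed
    also have "\<dots> = (\<Sum>k\<in>J R. \<integral>\<^sup>+ x. ennreal (norm (\<gamma> k x)) \<partial>Rn n)"
      by (rule nn_integral_sum) simp
    also have "\<dots> < top"
      using J(1) \<gamma> by (auto simp: integrable_iff_bounded)
    finally show ?thesis .
  qed
  then have loc: "loc_int n g" by (simp add: loc_int_iff gm)
  have "L f = (\<integral>x. f x * g x \<partial>Rn n)"
    if f[measurable]: "f \<in> borel_measurable (Rn n)" and tame: "tame n (\<lambda>x. ennreal (norm (f x)))" for f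
  proof -
    obtain K where K: "0 < K" "\<And>x. x \<in> space (Rn n) \<Longrightarrow> ennreal (norm (f x)) \<le> ennreal K"
      "\<And>x i. x \<in> space (Rn n) \<Longrightarrow> i < n \<Longrightarrow> K < \<bar>x i\<bar> \<Longrightarrow> ennreal (norm (f x)) = 0"
      using tame by (rule tameE) (rule that, assumption, blast+)
    have f0: "f x = 0" if x: "x \<in> space (Rn n)" "cell n x \<notin> J K" for x
    proof -
      have "x \<notin> centred_box n K" using x(2) cell_centred_box unfolding J_def by blast
      then obtain i where "i < n" "K < \<bar>x i\<bar>" by force
      then show ?thesis using K(3)[OF x(1)] by simp
    qed
    have ex: "(\<Sum>k\<in>J K. f x * indicator (cube n 1 k) x) = f x" if "x \<in> space (Rn n)" for x
      using f0[OF that] by (simp add: sum_indicator_cubes[OF J(2,1)])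
    have im[measurable]: "(\<lambda>x. indicator (cube n 1 k) x :: complex) \<in> borel_measurable (Rn n)" for k
      unfolding indicator_def by measurable
    have "L f = L (\<lambda>x. \<Sum>k\<in>J K. f x * indicator (cube n 1 k) x)"
      by (rule L_cong) (simp_all add: ex amalg_space_block tame_amalg_space f tame)
    also have "\<dots> = (\<Sum>k\<in>J K. L (\<lambda>x. f x * indicator (cube n 1 k) x))"
    proof (rule L_sum[OF J(1) amalg_norm_tame[OF q t tame], where h = "\<lambda>x. norm (f x)"])
      fix x
      have "norm (indicator (cube n 1 k) x :: complex) = indicator (cube n 1 k) x" for k
        by (auto simp: indicator_def)
      then show "(\<Sum>k\<in>J K. norm (f x * indicator (cube n 1 k) x)) \<le> norm (f x)"
        by (simp add: norm_mult sum_indicator_cubes[OF J(2,1)])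
    qed simp_all
    also have "\<dots> = (\<Sum>k\<in>J K. \<integral>x. f x * indicator (cube n 1 k) x * \<gamma> k x \<partial>Rn n)"
    proof (rule sum.cong[OF refl])
      fix k
      show "L (\<lambda>x. f x * indicator (cube n 1 k) x) = (\<integral>x. f x * indicator (cube n 1 k) x * \<gamma> k x \<partial>Rn n)"
      proof (rule cell_representation[OF \<gamma> L\<gamma> f])
        show "norm (f x) \<le> K" if "x \<in> space (Rn n)" for x
          using K(1) K(2)[OF that] by simp
      qed
    qed
    also have "\<dots> = (\<Sum>k\<in>J K. \<integral>x. f x * indicator (cube n 1 k) x * g x \<partial>Rn n)"
    proof (intro sum.cong Bochner_Integration.integral_cong refl)
      fix k x assume "k \<in> J K"
      then have "k \<in> cells n" using J(2) by blast
      then show "f x * indicator (cube n 1 k) x * \<gamma> k x = f x * indicator (cube n 1 k) x * g x"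
        using mem_cube_iff[of k n x] by (auto simp: g_def indicator_def)
    qed
    also have "\<dots> = (\<integral>x. (\<Sum>k\<in>J K. f x * indicator (cube n 1 k) x * g x) \<partial>Rn n)"
    proof (rule Bochner_Integration.integral_sum[symmetric])
      fix k
      show "integrable (Rn n) (\<lambda>x. f x * indicator (cube n 1 k) x * g x)"
      proof (rule integrable_tame_mult[OF _ tame_mono[OF tame] loc])
        show "ennreal (norm (f x * indicator (cube n 1 k) x)) \<le> ennreal (norm (f x))" for x
          by (auto simp: indicator_def)
      qed simp_all
    qed
    also have "\<dots> = (\<integral>x. f x * g x \<partial>Rn n)"
      by (intro Bochner_Integration.integral_cong refl) (simp add: sum_distrib_right[symmetric] ex)
    finally show ?thesis .
  qed
  with loc show thesis by (rule that)
qed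

text \<open>A dilated block is approximated by dilated truncations, which are tame, so L vanishes on
  it and hence on all partial sums. Thus L f equals L of every remainder, which is at most C times a
  tail of a convergent series.\<close>

lemma vanishes_if_vanishes_on_tame:
  assumes tame0: "\<And>f. f \<in> borel_measurable (Rn n) \<Longrightarrow> tame n (\<lambda>x. ennreal (norm (f x))) \<Longrightarrow> L f = 0"
    and f: "f \<in> block_space n q t \<beta>"
  shows "L f = 0"
proof -
  have dil0: "L (dilate n \<beta> r h) = 0" if h: "h \<in> amalg_space n q t" and r: "0 < r" for h r
  proof -
    have hm[measurable]: "h \<in> borel_measurable (Rn n)"
      using h by (auto simp: amalg_space_def intro: loc_int_measurable)
    \<comment> \<open>Setting h to 0 where its modulus is large, rather than capping the modulus,
      leaves the phase untouched.\<close>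
    define u where "u m x = (if x \<in> centred_box n (real m) \<and> norm (h x) \<le> real m then h x else 0)" for m x
    have um[measurable]: "u m \<in> borel_measurable (Rn n)" for m
      unfolding u_def[abs_def] mem_Collect_eq by measurable
    have ut: "tame n (\<lambda>x. ennreal (norm (u m x)))" for m
    proof (rule tameI)
      show "ennreal (norm (u m x)) \<le> ennreal (real m)" for x
        by (auto simp: u_def intro: ennreal_leI)
      show "ennreal (norm (u m x)) = 0" if "i < n" "real m < \<bar>x i\<bar>" for x i
        using that by (auto simp: u_def)
    qed simp
    have "(\<lambda>m. L (dilate n \<beta> r (u m))) \<longlonglongrightarrow> L (dilate n \<beta> r h)"
    proof (rule L_dominated[OF r, where H = "\<lambda>x. ennreal (norm (h x))"])
      show "amalg_norm n q t (\<lambda>x. ennreal (norm (h x))) < top"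
        using h by (simp add: amalg_space_def amalg_r_1_eq)
      show "(\<lambda>m. u m x) \<longlonglongrightarrow> h x" for x
      proof (rule tendsto_eventually)
        obtain N where N: "\<forall>m\<ge>N. x \<in> centred_box n (real m)" using ex_nat_box by blast
        obtain N' where N': "norm (h x) \<le> real N'" using real_arch_simple by blast
        show "eventually (\<lambda>m. u m x = h x) sequentially"
          unfolding eventually_sequentially
        proof (intro exI[of _ "max N N'"] allI impI)
          fix m assume m: "max N N' \<le> m"
          then have "real N' \<le> real m" by simp
          with N' have "norm (h x) \<le> real m" by (rule order_trans)
          moreover have "x \<in> centred_box n (real m)" using N m by simp
          ultimately show "u m x = h x" by (simp add: u_def)
        qed
      qed
    qed (simp_all add: u_def)
    moreover have "L (dilate n \<beta> r (u m)) = 0" for m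
      by (intro tame0 tame_dilate ut r) simp_all
    ultimately have "(\<lambda>_. 0) \<longlonglongrightarrow> L (dilate n \<beta> r h)" by simp
    then show ?thesis by (simp add: LIMSEQ_const_iff)
  qed
  obtain c r fs where dec: "block_decomp n q t \<beta> f c r fs" and loc: "loc_int n f"
    using f by (auto simp: block_space_def)
  have r: "\<And>j. 0 < r j" and fs: "\<And>j. fs j \<in> amalg_space n q t" and sum: "summable (\<lambda>j. norm (c j))"
    using dec by (auto simp: block_decomp_def)
  have term_loc: "loc_int n (\<lambda>x. c j * dilate n \<beta> (r j) (fs j) x)" for j
    using fs[of j] r[of j] by (intro loc_int_cmult loc_int_dilate) (auto simp: amalg_space_def)
  define S where "S N x = (\<Sum>j<N. c j * dilate n \<beta> (r j) (fs j) x)" for N x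
  have S_loc: "loc_int n (S N)" for N
    unfolding S_def[abs_def] by (intro loc_int_sum term_loc)
  have S_block: "S N \<in> block_space n q t \<beta>" for N
    using block_decomp_partial_sum[OF dec, of N] S_loc[of N] by (auto simp: block_space_def S_def[abs_def])
  have term_block: "(\<lambda>x. c j * dilate n \<beta> (r j) (fs j) x) \<in> block_space n q t \<beta>" for j
  proof -
    have fm: "fs j \<in> borel_measurable (Rn n)" and fin: "amalg_norm n q t (\<lambda>x. ennreal (norm (fs j x))) < top"
      using fs[of j] by (auto simp: amalg_space_def amalg_r_1_eq intro: loc_int_measurable)
    have "(\<lambda>x. c j * fs j x) \<in> amalg_space n q t"
    proof (rule dominated_amalg_space[where H = "\<lambda>x. ennreal (norm (c j)) * ennreal (norm (fs j x))"])
      show "amalg_norm n q t (\<lambda>x. ennreal (norm (c j)) * ennreal (norm (fs j x))) < top"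
        using fin fm by (subst amalg_norm_cmult[OF q t]) (auto simp: ennreal_mult_less_top)
    qed (use fm in \<open>auto simp: norm_mult ennreal_mult\<close>)
    from dilate_in_block_space[OF this r[of j]] show ?thesis
      by (simp add: dilate_cmult[abs_def])
  qed
  have S0: "L (S N) = 0" for N
  proof (induction N)
    case 0
    then show ?case using L_eq_0(2)[of "\<lambda>_. 0"] by (simp add: S_def[abs_def])
  next
    case (Suc N)
    have "L (\<lambda>x. S N x + c N * dilate n \<beta> (r N) (fs N) x) = L (S N) + L (\<lambda>x. c N * dilate n \<beta> (r N) (fs N) x)"
      by (intro L_add S_block term_block)
    also have "L (\<lambda>x. c N * dilate n \<beta> (r N) (fs N) x) = 0"
      using L_scale[OF dilate_in_block_space[OF fs r]] dil0[OF fs r] by simp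
    finally show ?case using Suc by (simp add: S_def[abs_def])
  qed
  have "norm (L f) \<le> C * (\<Sum>j. norm (c (j + N)))" for N
  proof -
    define R where "R x = f x - S N x" for x
    have decR: "block_decomp n q t \<beta> R (\<lambda>j. c (j + N)) (\<lambda>j. r (j + N)) (\<lambda>j. fs (j + N))"
      unfolding R_def[abs_def] S_def by (rule block_decomp_tail[OF dec])
    have "loc_int n (\<lambda>x. f x + (-1) * S N x)"
      by (intro loc_int_add loc_int_cmult loc S_loc)
    then have "loc_int n R" by (simp add: R_def[abs_def])
    with decR have RB: "R \<in> block_space n q t \<beta>" by (auto simp: block_space_def)
    have "L (\<lambda>x. S N x + R x) = L (S N) + L R" by (rule L_add[OF S_block RB])
    then have "L f = L R" by (simp add: S0 R_def)
    also have "norm (L R) \<le> C * block_norm n q t \<beta> R" by (rule L_bound[OF RB])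
    also have "\<dots> \<le> C * (\<Sum>j. norm (c (j + N)))"
      by (intro mult_left_mono C_nonneg block_norm_lower[OF decR])
    finally show ?thesis .
  qed
  moreover have "(\<lambda>N. C * (\<Sum>j. norm (c (j + N)))) \<longlonglongrightarrow> C * 0"
  proof (intro tendsto_mult_left)
    have "(\<lambda>N. (\<Sum>j. norm (c j)) - (\<Sum>j<N. norm (c j))) \<longlonglongrightarrow> (\<Sum>j. norm (c j)) - (\<Sum>j. norm (c j))"
      by (intro tendsto_diff tendsto_const summable_LIMSEQ sum)
    then show "(\<lambda>N. \<Sum>j. norm (c (j + N))) \<longlonglongrightarrow> 0"
      by (simp add: suminf_minus_initial_segment[OF sum])
  qed
  ultimately have "norm (L f) \<le> C * 0"
    by (intro LIMSEQ_le_const[of "\<lambda>N. C * (\<Sum>j. norm (c (j + N)))"]) auto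
  then show ?thesis by simp
qed

lemma representation:
  obtains g where "g \<in> amalg_alpha_space n p s \<alpha>" "\<And>f. f \<in> block_space n q t \<beta> \<Longrightarrow> L f = pairing n g f"
proof -
  obtain g where loc: "loc_int n g" and rep: "\<And>f. f \<in> borel_measurable (Rn n) \<Longrightarrow>
      tame n (\<lambda>x. ennreal (norm (f x))) \<Longrightarrow> L f = (\<integral>x. f x * g x \<partial>Rn n)"
    by (rule tame_representation) blast
  have "amalg_alpha_norm n p s \<alpha> g \<le> ennreal C"
  proof (rule amalg_alpha_norm_le_by_duality[OF loc])
    fix r :: real and h :: "(nat \<Rightarrow> real) \<Rightarrow> complex"
    assume h: "0 < r" "h \<in> borel_measurable (Rn n)" "tame n (\<lambda>x. ennreal (norm (h x)))"
      "amalg_norm n q t (\<lambda>x. ennreal (norm (h x))) \<le> 1"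
    have "pairing n g (dilate n \<beta> r h) = L (dilate n \<beta> r h)"
      unfolding pairing_def using h by (intro rep[symmetric] measurable_dilate tame_dilate)
    moreover have "norm (L (dilate n \<beta> r h)) \<le> C * block_norm n q t \<beta> (dilate n \<beta> r h)"
      using h by (intro L_bound tame_dilate_block)
    moreover have "C * block_norm n q t \<beta> (dilate n \<beta> r h) \<le> C * 1"
      using h by (intro mult_left_mono C_nonneg tame_dilate_block)
    ultimately show "ennreal (norm (pairing n g (dilate n \<beta> r h))) \<le> ennreal C"
      by (intro ennreal_leI) simp
  qed
  also have "\<dots> < \<infinity>" by simp
  finally have g: "g \<in> amalg_alpha_space n p s \<alpha>" using loc by (simp add: amalg_alpha_space_def)
  define A where "A = enn2real (amalg_alpha_norm n p s \<alpha> g)"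
  \<comment> \<open>The difference of L and the pairing satisfies the same axioms with the constant
    C + A, and it vanishes on tame functions by the choice of g.\<close>
  interpret diff: block_functional n p s \<alpha> "\<lambda>f. L f - pairing n g f" "C + A"
  proof
    fix f assume f: "f \<in> block_space n q t \<beta>"
    show "L (\<lambda>x. a * f x) - pairing n g (\<lambda>x. a * f x) = a * (L f - pairing n g f)" for a
      using L_scale[OF f] by (simp add: pairing_def mult.assoc right_diff_distrib)
    have "norm (L f - pairing n g f) \<le> norm (L f) + norm (pairing n g f)" by (rule norm_triangle_ineq4)
    also have "\<dots> \<le> C * block_norm n q t \<beta> f + A * block_norm n q t \<beta> f"
      unfolding A_def by (intro add_mono L_bound block_pairing(2) f g)
    finally show "norm (L f - pairing n g f) \<le> (C + A) * block_norm n q t \<beta> f"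
      by (simp add: distrib_right)
    fix h assume h: "h \<in> block_space n q t \<beta>"
    show "L (\<lambda>x. f x + h x) - pairing n g (\<lambda>x. f x + h x) = L f - pairing n g f + (L h - pairing n g h)"
      using L_add[OF f h] block_pairing(1)[OF g f] block_pairing(1)[OF g h]
      by (simp add: pairing_def distrib_right)
  next
    show "0 \<le> C + A" using C_nonneg by (simp add: A_def)
  qed
  have "L f = pairing n g f" if f: "f \<in> block_space n q t \<beta>" for f
  proof -
    have "L f - pairing n g f = 0"
      by (rule diff.vanishes_if_vanishes_on_tame[OF _ f]) (simp add: rep pairing_def)
    then show ?thesis by simp
  qed
  with g show thesis by (rule that)
qed

end

lemma (in strict_amalgam_exponents) block_dual_representation:
  assumes L: "L \<in> block_dual n q t \<beta>"
  shows "\<exists>g\<in>amalg_alpha_space n p s \<alpha>. \<forall>f\<in>block_space n q t \<beta>. L f = pairing n g f"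
proof -
  obtain C where C: "\<And>f. f \<in> block_space n q t \<beta> \<Longrightarrow> norm (L f) \<le> C * block_norm n q t \<beta> f"
    using L unfolding block_dual_def by blast
  \<comment> \<open>The constant in \<open>block_dual\<close> may be negative; replacing it by
    \<open>max C 0\<close> preserves the bound because block norms are nonnegative.\<close>
  interpret block_functional n p s \<alpha> L "max C 0"
  proof
    fix f assume f: "f \<in> block_space n q t \<beta>"
    show "norm (L f) \<le> max C 0 * block_norm n q t \<beta> f"
      using C[OF f] by (rule order_trans) (intro mult_right_mono block_norm_nonneg f, simp)
  qed (use L in \<open>auto simp: block_dual_def\<close>)
  show ?thesis by (rule representation) blast
qed

text \<open>A mean of numbers 1 / p i, each at most 1, is at most 1; positivity of \<alpha> excludes
  the negative exponents.\<close>

lemma one_le_exponent: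
  assumes "1 \<le> n" "\<And>i. i < n \<Longrightarrow> 1 \<le> p i" "0 < \<alpha>" "recip \<alpha> \<le> (\<Sum>i<n. recip (p i)) / real n"
  shows "1 \<le> \<alpha>"
proof (cases \<alpha>)
  case (real a)
  have "(\<Sum>i<n. recip (p i)) \<le> (\<Sum>i<n. 1)"
    by (intro sum_mono recip_le_one assms) auto
  then have "(\<Sum>i<n. recip (p i)) / real n \<le> 1"
    using assms(1) by (simp add: divide_le_eq)
  with assms(4) have "recip \<alpha> \<le> 1" by simp
  with assms(3) real show ?thesis by (simp add: recip_def divide_le_eq)
qed (use assms in auto)

text \<open>The spaces consist of functions rather than classes, so injectivity can only hold up to
  null sets. The last clause reads the isomorphism as one onto the whole dual.\<close>

theorem theorem2p7:
  fixes n :: nat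
  assumes "1 \<le> n"
  shows
   "(\<forall>(p::nat \<Rightarrow> ereal) (s::nat \<Rightarrow> ereal) (\<alpha>::ereal).
      (\<forall>i<n. 1 \<le> p i) \<and> (\<forall>i<n. 1 \<le> s i) \<and> 0 < \<alpha>
      \<and> (\<Sum>i<n. recip (s i)) / real n \<le> recip \<alpha>
      \<and> recip \<alpha> \<le> (\<Sum>i<n. recip (p i)) / real n \<longrightarrow>
      (\<forall>g\<in>amalg_alpha_space n p s \<alpha>.
        \<forall>f\<in>block_space n (\<lambda>i. conj_exp (p i)) (\<lambda>i. conj_exp (s i)) (conj_exp \<alpha>).
          integrable (Rn n) (\<lambda>x. f x * g x)
          \<and> ennreal (norm (\<integral>x. f x * g x \<partial>Rn n))
              \<le> amalg_alpha_norm n p s \<alpha> g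
                 * ennreal (block_norm n (\<lambda>i. conj_exp (p i)) (\<lambda>i. conj_exp (s i)) (conj_exp \<alpha>) f)))
  \<and> (\<forall>(p::nat \<Rightarrow> ereal) (s::nat \<Rightarrow> ereal) (\<alpha>::ereal).
      (\<forall>i<n. 1 < p i) \<and> (\<forall>i<n. 1 < s i) \<and> 0 < \<alpha>
      \<and> (\<Sum>i<n. recip (s i)) / real n \<le> recip \<alpha>
      \<and> recip \<alpha> \<le> (\<Sum>i<n. recip (p i)) / real n \<longrightarrow>
      (\<forall>g\<in>amalg_alpha_space n p s \<alpha>. \<forall>h\<in>amalg_alpha_space n p s \<alpha>. \<forall>a b::complex.
         (\<lambda>x. a * g x + b * h x) \<in> amalg_alpha_space n p s \<alpha>
         \<and> (\<forall>f\<in>block_space n (\<lambda>i. conj_exp (p i)) (\<lambda>i. conj_exp (s i)) (conj_exp \<alpha>).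
              pairing n (\<lambda>x. a * g x + b * h x) f = a * pairing n g f + b * pairing n h f))
      \<and> (\<forall>g\<in>amalg_alpha_space n p s \<alpha>.
           pairing n g \<in> block_dual n (\<lambda>i. conj_exp (p i)) (\<lambda>i. conj_exp (s i)) (conj_exp \<alpha>)
         \<and> ennreal (dual_norm n (\<lambda>i. conj_exp (p i)) (\<lambda>i. conj_exp (s i)) (conj_exp \<alpha>) (pairing n g))
             = amalg_alpha_norm n p s \<alpha> g)
      \<and> (\<forall>g\<in>amalg_alpha_space n p s \<alpha>. \<forall>h\<in>amalg_alpha_space n p s \<alpha>.
           (\<forall>f\<in>block_space n (\<lambda>i. conj_exp (p i)) (\<lambda>i. conj_exp (s i)) (conj_exp \<alpha>).
              pairing n g f = pairing n h f)
           \<longrightarrow> (AE x in Rn n. g x = h x))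
      \<and> (\<forall>L\<in>block_dual n (\<lambda>i. conj_exp (p i)) (\<lambda>i. conj_exp (s i)) (conj_exp \<alpha>).
           \<exists>g\<in>amalg_alpha_space n p s \<alpha>.
             \<forall>f\<in>block_space n (\<lambda>i. conj_exp (p i)) (\<lambda>i. conj_exp (s i)) (conj_exp \<alpha>).
               L f = pairing n g f))"
proof (intro conjI allI impI; elim conjE)
  fix p s :: "nat \<Rightarrow> ereal" and \<alpha>
  assume *: "\<forall>i<n. 1 \<le> p i" "\<forall>i<n. 1 \<le> s i" "0 < \<alpha>" "recip \<alpha> \<le> (\<Sum>i<n. recip (p i)) / real n"
  have "1 \<le> \<alpha>" by (rule one_le_exponent[OF assms, of p]) (use * in simp_all)
  with * interpret amalgam_exponents n p s \<alpha>
    by unfold_locales simp_all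
  show "\<forall>g\<in>amalg_alpha_space n p s \<alpha>. \<forall>f\<in>block_space n q t \<beta>.
      integrable (Rn n) (\<lambda>x. f x * g x) \<and>
      ennreal (norm (\<integral>x. f x * g x \<partial>Rn n)) \<le> amalg_alpha_norm n p s \<alpha> g * ennreal (block_norm n q t \<beta> f)"
    using block_pairing(1) block_pairing_ennreal by blast
next
  fix p s :: "nat \<Rightarrow> ereal" and \<alpha>
  assume *: "\<forall>i<n. 1 < p i" "\<forall>i<n. 1 < s i" "0 < \<alpha>" "recip \<alpha> \<le> (\<Sum>i<n. recip (p i)) / real n"
  then have p1: "\<forall>i<n. 1 \<le> p i" "\<forall>i<n. 1 \<le> s i" by (simp_all add: less_imp_le)
  have "1 \<le> \<alpha>" by (rule one_le_exponent[OF assms, of p]) (use p1 * in simp_all)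
  with * p1 interpret strict_amalgam_exponents n p s \<alpha>
    by unfold_locales simp_all
  show "\<forall>g\<in>amalg_alpha_space n p s \<alpha>. \<forall>h\<in>amalg_alpha_space n p s \<alpha>. \<forall>a b.
      (\<lambda>x. a * g x + b * h x) \<in> amalg_alpha_space n p s \<alpha> \<and>
      (\<forall>f\<in>block_space n q t \<beta>. pairing n (\<lambda>x. a * g x + b * h x) f = a * pairing n g f + b * pairing n h f)"
    by (intro ballI allI conjI amalg_alpha_space_linear pairing_linear)
  show "\<forall>g\<in>amalg_alpha_space n p s \<alpha>. pairing n g \<in> block_dual n q t \<beta> \<and>
      ennreal (dual_norm n q t \<beta> (pairing n g)) = amalg_alpha_norm n p s \<alpha> g"
    by (intro ballI conjI pairing_in_block_dual dual_norm_pairing)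
  show "\<forall>g\<in>amalg_alpha_space n p s \<alpha>. \<forall>h\<in>amalg_alpha_space n p s \<alpha>.
      (\<forall>f\<in>block_space n q t \<beta>. pairing n g f = pairing n h f) \<longrightarrow> (AE x in Rn n. g x = h x)"
    by (intro ballI impI pairing_injective) simp_all
  show "\<forall>L\<in>block_dual n q t \<beta>. \<exists>g\<in>amalg_alpha_space n p s \<alpha>. \<forall>f\<in>block_space n q t \<beta>. L f = pairing n g f"
    by (intro ballI block_dual_representation)
qed

end
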